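(* Let $n,m\in\mathbb{N}$. Assume $\varrho\in C(\mathbb{C};\mathbb{C})$ is not polyharmonic and that there exists $z_0\in\mathbb{C}$ such that $\varrho$ is real differentiable at $z_0$ with non-zero derivative. (i) If $\partial_{\mathrm{wirt}}\varrho(z_0)\neq0$ and $\overline{\partial}_{\mathrm{wirt}}\varrho(z_0)=0$, then $\mathcal{NN}^\varrho_{n,m,n+m+1}$ is universal. (ii) If $\partial_{\mathrm{wirt}}\varrho(z_0)=0$ and $\overline{\partial}_{\mathrm{wirt}}\varrho(z_0)\neq0$, then $\mathcal{NN}^\varrho_{n,m,n+m+1}$ is universal. (iii) If $\partial_{\mathrm{wirt}}\varrho(z_0)\neq0$ and $\overline{\partial}_{\mathrm{wirt}}\varrho(z_0)\neq0$, then $\mathcal{NN}^\varrho_{n,m,2n+2m+1}$ is universal.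
   Context: For $\varrho:\mathbb{C}\to\mathbb{C}$ and $n,m,W\in\mathbb{N}$, $\mathcal{NN}^\varrho_{n,m,W}$ denotes the set of all functions $\mathbb{C}^n\to\mathbb{C}^m$ of the form $V_L\circ\varrho^{\times W}\circ V_{L-1}\circ\cdots\circ\varrho^{\times W}\circ V_1$ with arbitrary depth $L\ge 2$, where $V_1:\mathbb{C}^n\to\mathbb{C}^W$, $V_2,\dots,V_{L-1}:\mathbb{C}^W\to\mathbb{C}^W$, $V_L:\mathbb{C}^W\to\mathbb{C}^m$ are $\mathbb{C}$-affine maps ($z\mapsto Az+b$ with complex $A,b$) and $\varrho^{\times W}$ applies $\varrho$ componentwise. A class $\mathcal{F}\subseteq C(\mathbb{C}^n;\mathbb{C}^m)$ is universal if for every $g\in C(\mathbb{C}^n;\mathbb{C}^m)$, compact $K\subseteq\mathbb{C}^n$ and $\varepsilon>0$ there is $f\in\mathcal{F}$ with $\sup_{z\in K}\|f(z)-g(z)\|<\varepsilon$. $\varrho$ is polyharmonic if $\varrho\in C^\infty(\mathbb{C};\mathbb{C})$ and $\Delta^k\varrho=0$ for some $k\in\mathbb{N}$, where $\Delta=\partial_x^2+\partial_y^2$. Wirtinger derivatives: $\partial_{\mathrm{wirt}}\varrho=\frac12(\partial_x\varrho-\mathrm{i}\partial_y\varrho)$, $\overline{\partial}_{\mathrm{wirt}}\varrho=\frac12(\partial_x\varrho+\mathrm{i}\partial_y\varrho)$. Real differentiability at $z_0$: partial derivatives exist and $\lim_{h\to0}\frac{\varrho(z_0+h)-\varrho(z_0)-\partial_x\varrho(z_0)\mathrm{Re}(h)-\partial_y\varrho(z_0)\mathrm{Im}(h)}{h}=0$;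 the derivative is non-zero if $(\partial_x\varrho(z_0),\partial_y\varrho(z_0))\neq(0,0)$. *)

theory Defs
  imports "HOL-Analysis.Analysis"
begin

definition px :: "(complex \<Rightarrow> complex) \<Rightarrow> complex \<Rightarrow> complex" where
  "px f z = vector_derivative (\<lambda>t::real. f (z + of_real t)) (at 0)"

definition py :: "(complex \<Rightarrow> complex) \<Rightarrow> complex \<Rightarrow> complex" where
  "py f z = vector_derivative (\<lambda>t::real. f (z + \<i> * of_real t)) (at 0)"

definition wirt :: "(complex \<Rightarrow> complex) \<Rightarrow> complex \<Rightarrow> complex" where
  "wirt f z = (px f z - \<i> * py f z) / 2"

definition wirt_bar :: "(complex \<Rightarrow> complex) \<Rightarrow> complex \<Rightarrow> complex" where
  "wirt_bar f z = (px f z + \<i> * py f z) / 2"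

definition laplacian :: "(complex \<Rightarrow> complex) \<Rightarrow> complex \<Rightarrow> complex" where
  "laplacian f = (\<lambda>z. px (px f) z + py (py f) z)"

definition iter_partial :: "bool list \<Rightarrow> (complex \<Rightarrow> complex) \<Rightarrow> complex \<Rightarrow> complex" where
  "iter_partial ds f = foldr (\<lambda>d g. if d then py g else px g) ds f"

definition smooth_C :: "(complex \<Rightarrow> complex) \<Rightarrow> bool" where
  "smooth_C f \<longleftrightarrow>
     (\<forall>ds. continuous_on UNIV (iter_partial ds f) \<and>
       (\<forall>z. (\<lambda>t::real. iter_partial ds f (z + of_real t)) differentiable (at 0) \<and>
            (\<lambda>t::real. iter_partial ds f (z + \<i> * of_real t)) differentiable (at 0)))"

definition polyharmonic :: "(complex \<Rightarrow> complex) \<Rightarrow> bool" where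
  "polyharmonic f \<longleftrightarrow> smooth_C f \<and> (\<exists>k::nat. (laplacian ^^ k) f = (\<lambda>_. 0))"

definition real_diff_at :: "(complex \<Rightarrow> complex) \<Rightarrow> complex \<Rightarrow> bool" where
  "real_diff_at f z0 \<longleftrightarrow>
     (\<lambda>t::real. f (z0 + of_real t)) differentiable (at 0) \<and>
     (\<lambda>t::real. f (z0 + \<i> * of_real t)) differentiable (at 0) \<and>
     ((\<lambda>h. (f (z0 + h) - f z0 - px f z0 * of_real (Re h) - py f z0 * of_real (Im h)) / h)
        \<longlongrightarrow> 0) (at 0)"

text \<open>Inputs live in complex^'n, outputs in complex^'m; hidden vectors of width W are
  represented as functions nat => complex, only indices < W being relevant.\<close>

definition in_layer :: "nat \<Rightarrow> (nat \<Rightarrow> 'n::finite \<Rightarrow> complex) \<Rightarrow> (nat \<Rightarrow> complex)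
    \<Rightarrow> complex^'n \<Rightarrow> nat \<Rightarrow> complex" where
  "in_layer W A b x = (\<lambda>i. if i < W then (\<Sum>j\<in>UNIV. A i j * x $ j) + b i else 0)"

definition hid_layer :: "nat \<Rightarrow> (nat \<Rightarrow> nat \<Rightarrow> complex) \<Rightarrow> (nat \<Rightarrow> complex)
    \<Rightarrow> (nat \<Rightarrow> complex) \<Rightarrow> nat \<Rightarrow> complex" where
  "hid_layer W A b y = (\<lambda>i. if i < W then (\<Sum>j<W. A i j * y j) + b i else 0)"

definition out_layer :: "nat \<Rightarrow> ('m::finite \<Rightarrow> nat \<Rightarrow> complex) \<Rightarrow> ('m \<Rightarrow> complex)
    \<Rightarrow> (nat \<Rightarrow> complex) \<Rightarrow> complex^'m" where
  "out_layer W A b y = (\<chi> i. (\<Sum>j<W. A i j * y j) + b i)"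

definition act :: "(complex \<Rightarrow> complex) \<Rightarrow> nat \<Rightarrow> (nat \<Rightarrow> complex) \<Rightarrow> nat \<Rightarrow> complex" where
  "act \<rho> W y = (\<lambda>i. if i < W then \<rho> (y i) else 0)"

text \<open>NN^\<rho>_{n,m,W}: V_L o \<rho> o V_{L-1} o ... o \<rho> o V_1 with arbitrary depth L \<ge> 2;
  the list hs holds the L-2 hidden affine maps V_2, ..., V_{L-1}.\<close>

definition NN :: "(complex \<Rightarrow> complex) \<Rightarrow> nat \<Rightarrow> (complex^'n::finite \<Rightarrow> complex^'m::finite) set" where
  "NN \<rho> W = {f. \<exists>A1 b1 hs AL bL. f = (\<lambda>x.
      out_layer W AL bL
        (foldl (\<lambda>y (A, b). act \<rho> W (hid_layer W A b y)) (act \<rho> W (in_layer W A1 b1 x)) hs))}"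

definition universal :: "(complex^'n::finite \<Rightarrow> complex^'m::finite) set \<Rightarrow> bool" where
  "universal F \<longleftrightarrow>
     (\<forall>g. continuous_on UNIV g \<longrightarrow>
        (\<forall>K \<epsilon>. compact K \<and> \<epsilon> > 0 \<longrightarrow> (\<exists>f\<in>F. \<forall>z\<in>K. norm (f z - g z) < \<epsilon>)))"

end

theory Submission
  imports Defs
begin

text \<open>
  Let \<open>V\<close> be the locally uniform closure of the span of the functions \<open>\<rho>(a z + b)\<close> on the plane.
  If all \<open>|z|\<^sup>2\<^sup>k\<close> lie in \<open>V\<close>, then so does \<open>exp (Re z)\<close>, and the ridge functions
  \<open>exp (Re (a \<bullet> z))\<close> span a dense algebra, so shallow networks are dense. Otherwise let \<open>k\<close> be
  least with \<open>|z|\<^sup>2\<^sup>k\<close> not in \<open>V\<close>. The circular means of a smooth \<open>f\<close> in \<open>V\<close> lie in \<open>V\<close>, and by Pizzetti's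
  expansion their coefficient of \<open>|z|\<^sup>2\<^sup>k\<close> is a nonzero multiple of \<open>\<Delta>\<^sup>k f\<close>, which therefore vanishes
  for every smooth \<open>f\<close> in \<open>V\<close>. Mollifications of \<open>\<rho>\<close> lie in \<open>V\<close>, so \<open>\<rho>\<close> is a locally uniform limit of
  smooth functions annihilated by \<open>\<Delta>\<^sup>k\<close> and hence polyharmonic, a contradiction.

  A shallow network is then simulated by a deep narrow one: \<open>n\<close> registers keep the input, \<open>m\<close>
  registers accumulate the output, and one further neuron evaluates one summand at a time. Near
  \<open>z0\<close> the activation is affine up to higher order, so after rescaling a neuron carries a register
  (or its conjugate) unchanged; if both Wirtinger derivatives are nonzero, two neurons are needed.
\<close>

section \<open>Locally uniform closure\<close>

text \<open>Averaging a continuous function over small squares raises its order of differentiability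
  only by one. The smooth members of \<open>V\<close> are therefore jets of arbitrary but finite
  order \<open>N\<close>, and the approximants of \<open>\<rho>\<close> for different
  \<open>N\<close> are unrelated. Their locally uniform limit has no derivatives a priori. The way
  out: on functions annihilated by the \<open>k\<close>-th power of the Laplacian, a partial
  derivative is a fixed linear combination of circular means over the radii 1, 2, 4, ...,
  \<open>2 ^ k\<close>. Such means make sense for every continuous function and survive locally
  uniform limits. Minimality of \<open>k\<close> matters because Pizzetti's expansion contains all
  lower powers of \<open>|z|\<^sup>2\<close>, which must lie in \<open>V\<close> before they can be
  subtracted. In the narrow network the obstacle is that a register may be relayed only up to
  conjugation. Each summand therefore takes two layers, the second undoing the first, and the
  shallow network is fed with the conjugated input.\<close>

definition ucl :: "('a::topological_space \<Rightarrow> 'b::real_normed_vector) set \<Rightarrow> ('a \<Rightarrow> 'b) set" where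
  "ucl S = {f. \<forall>K \<epsilon>. compact K \<and> \<epsilon> > 0 \<longrightarrow> (\<exists>g\<in>S. \<forall>z\<in>K. norm (g z - f z) < \<epsilon>)}"

lemma uclI:
  assumes "\<And>K \<epsilon>. compact K \<Longrightarrow> \<epsilon> > 0 \<Longrightarrow> \<exists>g\<in>S. \<forall>z\<in>K. norm (g z - f z) < \<epsilon>"
  shows "f \<in> ucl S"
  using assms by (auto simp: ucl_def)

lemma uclE:
  assumes "f \<in> ucl S" "compact K" "\<epsilon> > 0"
  obtains g where "g \<in> S" "\<And>z. z \<in> K \<Longrightarrow> norm (g z - f z) < \<epsilon>"
proof -
  have "\<exists>g\<in>S. \<forall>z\<in>K. norm (g z - f z) < \<epsilon>" using assms(1-3) by (simp add: ucl_def)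
  then show ?thesis using that by blast
qed

lemma ucl_incl: "f \<in> S \<Longrightarrow> f \<in> ucl S"
  by (rule uclI, rule bexI[of _ f]) auto

lemma ucl_trans:
  assumes f: "f \<in> ucl S" and S: "S \<subseteq> ucl T"
  shows "f \<in> ucl T"
proof (rule uclI)
  fix K :: "'a set" and \<epsilon> :: real assume K: "compact K" "\<epsilon> > 0"
  obtain g where g: "g \<in> S" "\<And>z. z \<in> K \<Longrightarrow> norm (g z - f z) < \<epsilon>/2"
    using uclE[OF f K(1), of "\<epsilon>/2"] K by auto
  obtain h where h: "h \<in> T" "\<And>z. z \<in> K \<Longrightarrow> norm (h z - g z) < \<epsilon>/2"
    using uclE[of g T K "\<epsilon>/2"] g S K by auto
  have "norm (h z - f z) < \<epsilon>" if "z \<in> K" for z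
    using norm_triangle_ineq[of "h z - g z" "g z - f z"] g(2)[OF that] h(2)[OF that] by simp
  then show "\<exists>g\<in>T. \<forall>z\<in>K. norm (g z - f z) < \<epsilon>" using h by blast
qed

lemma ucl_mono: "S \<subseteq> T \<Longrightarrow> f \<in> ucl S \<Longrightarrow> f \<in> ucl T"
  by (erule ucl_trans) (auto intro: ucl_incl)

definition closed_subspace :: "('a::topological_space \<Rightarrow> complex) set \<Rightarrow> bool" where
  "closed_subspace V \<longleftrightarrow> ucl V \<subseteq> V \<and> (\<lambda>_. 0) \<in> V \<and> (\<forall>f\<in>V. \<forall>g\<in>V. \<forall>c. (\<lambda>z. c * f z + g z) \<in> V)"

lemma closed_subspaceD:
  assumes "closed_subspace V"
  shows "f \<in> ucl V \<Longrightarrow> f \<in> V" "(\<lambda>_. 0) \<in> V"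
    "f \<in> V \<Longrightarrow> g \<in> V \<Longrightarrow> (\<lambda>z. c * f z + g z) \<in> V"
    "f \<in> V \<Longrightarrow> (\<lambda>z. c * f z) \<in> V"
    "f \<in> V \<Longrightarrow> g \<in> V \<Longrightarrow> (\<lambda>z. f z + g z) \<in> V"
    "f \<in> V \<Longrightarrow> g \<in> V \<Longrightarrow> (\<lambda>z. f z - g z) \<in> V"
proof -
  have *: "f \<in> V \<Longrightarrow> g \<in> V \<Longrightarrow> (\<lambda>z. c * f z + g z) \<in> V" for f g c
    using assms by (auto simp: closed_subspace_def)
  show 0: "(\<lambda>_. 0) \<in> V" "f \<in> ucl V \<Longrightarrow> f \<in> V" using assms by (auto simp: closed_subspace_def)
  show "f \<in> V \<Longrightarrow> g \<in> V \<Longrightarrow> (\<lambda>z. c * f z + g z) \<in> V" by (rule *)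
  show "f \<in> V \<Longrightarrow> (\<lambda>z. c * f z) \<in> V" using *[OF _ 0(1), of f c] by simp
  show "f \<in> V \<Longrightarrow> g \<in> V \<Longrightarrow> (\<lambda>z. f z + g z) \<in> V" using *[of f g 1] by simp
  show "f \<in> V \<Longrightarrow> g \<in> V \<Longrightarrow> (\<lambda>z. f z - g z) \<in> V" using *[of g f "-1"] by simp
qed

lemma closed_subspace_sum:
  assumes V: "closed_subspace V" and "\<And>i. i \<in> I \<Longrightarrow> f i \<in> V"
  shows "(\<lambda>z. \<Sum>i\<in>I. c i * f i z) \<in> V"
  using assms(2)
proof (induction I rule: infinite_finite_induct)
  case (insert i I)
  then show ?case using closed_subspaceD(3)[OF V, of "f i" _ "c i"] by simp
qed (simp_all add: closed_subspaceD(2)[OF V])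

text \<open>Generated one summand at a time: a claim about linear combinations becomes an induction
  whose step treats a single generator. \<open>shallow\<close> later has the same shape for
  vector-valued sums.\<close>

inductive_set lin_hull :: "('a \<Rightarrow> complex) set \<Rightarrow> ('a \<Rightarrow> complex) set" for S where
  zero: "(\<lambda>_. 0) \<in> lin_hull S"
| step: "g \<in> lin_hull S \<Longrightarrow> f \<in> S \<Longrightarrow> (\<lambda>z. c * f z + g z) \<in> lin_hull S"

lemma lin_hull_incl: "f \<in> S \<Longrightarrow> f \<in> lin_hull S"
  using lin_hull.step[OF lin_hull.zero, of f S 1] by simp

lemma lin_hull_comb:
  assumes "f \<in> lin_hull S" "g \<in> lin_hull S"
  shows "(\<lambda>z. c * f z + g z) \<in> lin_hull S"
  using assms(1)
proof induction
  case zero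
  then show ?case using assms by simp
next
  case (step h f d)
  then show ?case using lin_hull.step[OF step.IH step.hyps(2), of "c * d"]
    by (simp add: algebra_simps)
qed

lemma ucl_comb:
  assumes f: "f \<in> ucl S" and g: "g \<in> ucl S"
    and S: "\<And>f g. f \<in> S \<Longrightarrow> g \<in> S \<Longrightarrow> (\<lambda>z. c * f z + g z) \<in> S"
  shows "(\<lambda>z. c * f z + g z :: complex) \<in> ucl S"
proof (rule uclI)
  fix K :: "'a set" and \<epsilon> :: real assume K: "compact K" "\<epsilon> > 0"
  define \<delta> where "\<delta> = \<epsilon> / (2 * (1 + norm c))"
  have nc: "1 + norm c > 0" using norm_ge_zero[of c] by linarith
  have \<delta>: "\<delta> > 0" "(1 + norm c) * \<delta> = \<epsilon> / 2" using K nc by (simp_all add: \<delta>_def divide_simps)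
  obtain f' where f': "f' \<in> S" "\<And>z. z \<in> K \<Longrightarrow> norm (f' z - f z) < \<delta>"
    using uclE[OF f K(1) \<delta>(1)] by auto
  obtain g' where g': "g' \<in> S" "\<And>z. z \<in> K \<Longrightarrow> norm (g' z - g z) < \<delta>"
    using uclE[OF g K(1) \<delta>(1)] by auto
  have "norm (c * f' z + g' z - (c * f z + g z)) < \<epsilon>" if z: "z \<in> K" for z
  proof -
    have "c * f' z + g' z - (c * f z + g z) = c * (f' z - f z) + (g' z - g z)"
      by (simp add: algebra_simps)
    also have "norm \<dots> \<le> norm c * norm (f' z - f z) + norm (g' z - g z)"
      by (metis norm_mult norm_triangle_ineq)
    also have "\<dots> \<le> norm c * \<delta> + \<delta>"
      by (intro add_mono mult_left_mono less_imp_le[OF f'(2)[OF z]] less_imp_le[OF g'(2)[OF z]]) auto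
    also have "\<dots> = \<epsilon> / 2" using \<delta> by (simp add: algebra_simps)
    also have "\<dots> < \<epsilon>" using K by simp
    finally show ?thesis .
  qed
  then show "\<exists>g'\<in>S. \<forall>z\<in>K. norm (g' z - (c * f z + g z)) < \<epsilon>"
    by (intro bexI[OF _ S[OF f'(1) g'(1)]] ballI)
qed

lemma closed_subspace_ucl_lin_hull: "closed_subspace (ucl (lin_hull S))"
  unfolding closed_subspace_def
proof (intro conjI ballI allI)
  show "ucl (ucl (lin_hull S)) \<subseteq> ucl (lin_hull S)" by (auto elim: ucl_trans)
  show "(\<lambda>_. 0) \<in> ucl (lin_hull S)" by (intro ucl_incl lin_hull.zero)
qed (intro ucl_comb lin_hull_comb)

lemma integral_minus_rectangle_le:
  fixes g :: "real \<Rightarrow> complex"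
  assumes "continuous_on {s..s+d} g" "d \<ge> 0" "\<And>t. t \<in> {s..s+d} \<Longrightarrow> norm (g t - g s) \<le> e"
  shows "norm (integral {s..s+d} g - of_real d * g s) \<le> e * d"
proof -
  have "integral {s..s+d} g - of_real d * g s = integral {s..s+d} (\<lambda>t. g t - g s)"
    using assms by (subst integral_diff) (auto intro: integrable_continuous_real simp: scaleR_conv_of_real)
  also have "norm \<dots> \<le> e * (s + d - s)"
    using assms by (intro integral_bound continuous_intros) auto
  finally show ?thesis by simp
qed

text \<open>The integral is a locally uniform limit of Riemann sums, which lie in the span of the integrands.\<close>

lemma closed_subspace_integral:
  fixes F :: "real \<Rightarrow> 'a::metric_space \<Rightarrow> complex"
  assumes V: "closed_subspace V" and FV: "\<And>t. t \<in> {a..b} \<Longrightarrow> F t \<in> V"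
    and cont: "continuous_on ({a..b} \<times> UNIV) (\<lambda>(t, z). F t z)"
  shows "(\<lambda>z. integral {a..b} (\<lambda>t. F t z)) \<in> V"
proof (cases "a < b")
  case False
  then have "integral {a..b} (\<lambda>t. F t z) = 0" for z by (cases "a = b") auto
  then show ?thesis using closed_subspaceD(2)[OF V] by simp
next
  case True
  have contt: "continuous_on {a..b} (\<lambda>t. F t z)" for z
    using continuous_on_compose2[OF cont, of "{a..b}" "\<lambda>t. (t, z)"]
    by (simp add: continuous_on_Pair image_subset_iff)
  have "(\<lambda>z. integral {a..b} (\<lambda>t. F t z)) \<in> ucl V"
  proof (rule uclI)
    fix K :: "'a set" and \<epsilon> :: real assume K: "compact K" "\<epsilon> > 0"
    define e where "e = \<epsilon> / (2 * (b - a))"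
    have e: "e > 0" "e * (b - a) < \<epsilon>" using K True by (auto simp: e_def field_simps)
    have "uniformly_continuous_on ({a..b} \<times> K) (\<lambda>(t, z). F t z)"
      using K by (intro compact_uniformly_continuous compact_Times continuous_on_subset[OF cont]) auto
    then obtain \<delta> where \<delta>: "\<delta> > 0"
      "\<And>t z t' z'. \<lbrakk>t \<in> {a..b}; t' \<in> {a..b}; z \<in> K; z' \<in> K; dist (t', z') (t, z) < \<delta>\<rbrakk> \<Longrightarrow> dist (F t' z') (F t z) < e"
      unfolding uniformly_continuous_on_def using e(1)
      by (metis (no_types, lifting) SigmaI case_prod_conv)
    obtain n :: nat where n: "(b - a) / \<delta> < real n" using reals_Archimedean2 by blast
    have n0: "n > 0" using n True \<delta> by (cases n) (auto simp: field_simps)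
    define d where "d = (b - a) / n"
    have d: "d > 0" "d < \<delta>" "real n * d = b - a" using n n0 True \<delta> by (auto simp: d_def field_simps)
    \<comment> \<open>The Riemann sum is built cell by cell. Its error after \<open>k\<close> cells
      is at most \<open>e\<close> times the length covered so far, since each new cell of length
      \<open>d < \<delta>\<close> adds at most \<open>e * d\<close>. The factor 2 in
      \<open>e\<close> makes the final bound strict.\<close>
    have "k \<le> n \<Longrightarrow> \<exists>g\<in>V. \<forall>z\<in>K. norm (g z - integral {a..a + real k * d} (\<lambda>t. F t z)) \<le> e * (real k * d)" for k
    proof (induction k)
      case 0
      then show ?case using closed_subspaceD(2)[OF V] by (auto intro!: bexI[of _ "\<lambda>_. 0"])
    next
      case (Suc k)
      define s where "s = a + real k * d"
      obtain g where g: "g \<in> V" "\<And>z. z \<in> K \<Longrightarrow> norm (g z - integral {a..s} (\<lambda>t. F t z)) \<le> e * (real k * d)"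
        using Suc by (auto simp: s_def)
      have "real (Suc k) * d \<le> real n * d" using Suc.prems d by (intro mult_right_mono) auto
      then have sd: "a \<le> s" "s + d \<le> b" "s \<le> b" using d by (auto simp: s_def algebra_simps)
      have "norm (of_real d * F s z + g z - integral {a..s+d} (\<lambda>t. F t z)) \<le> e * (real (Suc k) * d)" if z: "z \<in> K" for z
      proof -
        have 1: "integral {a..s+d} (\<lambda>t. F t z) = integral {a..s} (\<lambda>t. F t z) + integral {s..s+d} (\<lambda>t. F t z)"
          by (rule Henstock_Kurzweil_Integration.integral_combine[symmetric])
            (use sd d in \<open>auto intro!: integrable_continuous_real continuous_on_subset[OF contt]\<close>)
        have 2: "norm (integral {s..s+d} (\<lambda>t. F t z) - of_real d * F s z) \<le> e * d"
        proof (rule integral_minus_rectangle_le)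
          show "continuous_on {s..s+d} (\<lambda>t. F t z)" using sd by (intro continuous_on_subset[OF contt]) auto
          show "norm (F t z - F s z) \<le> e" if "t \<in> {s..s+d}" for t
            using \<delta>(2)[of s t z z] that sd d z by (simp add: dist_norm norm_Pair dist_Pair_Pair abs_if less_imp_le)
        qed (use d in auto)
        have "of_real d * F s z + g z - integral {a..s+d} (\<lambda>t. F t z)
            = (g z - integral {a..s} (\<lambda>t. F t z)) - (integral {s..s+d} (\<lambda>t. F t z) - of_real d * F s z)"
          using 1 by simp
        also have "norm \<dots> \<le> e * (real k * d) + e * d"
          using norm_triangle_ineq4 g(2)[OF z] 2 by (smt (verit))
        finally show ?thesis by (simp add: algebra_simps)
      qed
      moreover have "(\<lambda>z. of_real d * F s z + g z) \<in> V"
        using sd by (intro closed_subspaceD(3)[OF V] FV g) auto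
      moreover have ak: "a + real (Suc k) * d = s + d" by (simp add: s_def algebra_simps)
      ultimately show ?case unfolding ak by (intro bexI[of _ "\<lambda>z. of_real d * F s z + g z"]) auto
    qed
    from this[of n] obtain g where g: "g \<in> V" "\<forall>z\<in>K. norm (g z - integral {a..b} (\<lambda>t. F t z)) \<le> e * (b - a)"
      using d by auto
    then show "\<exists>g\<in>V. \<forall>z\<in>K. norm (g z - integral {a..b} (\<lambda>t. F t z)) < \<epsilon>"
      using e(2) by (meson le_less_trans)
  qed
  then show ?thesis using closed_subspaceD(1)[OF V] by blast
qed


section \<open>Smoothing\<close>

text \<open>With \<open>e = 1\<close> and \<open>e = \<i>\<close> these are the limits behind
  \<open>px\<close> and \<open>py\<close>, stated as a relation so that existence of the derivative
  is part of it.\<close>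

definition has_dir_deriv :: "complex \<Rightarrow> (complex \<Rightarrow> complex) \<Rightarrow> (complex \<Rightarrow> complex) \<Rightarrow> bool" where
  "has_dir_deriv e f f' \<longleftrightarrow> (\<forall>z. ((\<lambda>t::real. f (z + e * of_real t)) has_vector_derivative f' z) (at 0))"

lemma has_dir_derivD:
  assumes "has_dir_deriv e f f'"
  shows "((\<lambda>t::real. f (z + e * of_real t)) has_vector_derivative f' (z + e * of_real s)) (at s within A)"
proof -
  have "((\<lambda>t::real. f ((z + e * of_real s) + e * of_real t)) has_vector_derivative f' (z + e * of_real s)) (at (s - s))"
    using assms by (simp add: has_dir_deriv_def)
  then have "((\<lambda>t::real. f ((z + e * of_real s) + e * of_real t)) \<circ> (\<lambda>t. t - s) has_vector_derivative 1 *\<^sub>R f' (z + e * of_real s)) (at s)"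
    by (intro vector_diff_chain_at) (auto intro!: derivative_eq_intros)
  then have "((\<lambda>t::real. f (z + e * of_real t)) has_vector_derivative f' (z + e * of_real s)) (at s)"
    by (simp add: o_def algebra_simps)
  then show ?thesis using has_vector_derivative_at_within by blast
qed

lemma has_dir_deriv_add:
  "has_dir_deriv e f f' \<Longrightarrow> has_dir_deriv e g g' \<Longrightarrow> has_dir_deriv e (\<lambda>z. f z + g z) (\<lambda>z. f' z + g' z)"
  by (auto simp: has_dir_deriv_def intro!: has_vector_derivative_add)

lemma has_dir_deriv_cmult:
  "has_dir_deriv e f f' \<Longrightarrow> has_dir_deriv e (\<lambda>z. c * f z) (\<lambda>z. c * f' z)"
  by (auto simp: has_dir_deriv_def intro!: has_vector_derivative_mult_right)

lemma has_dir_deriv_diff_shift: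
  assumes "has_dir_deriv e f f'"
  shows "has_dir_deriv e (\<lambda>z. f (z + c) - f z) (\<lambda>z. f' (z + c) - f' z)"
proof -
  have "((\<lambda>t::real. f (z + e * of_real t + c)) has_vector_derivative f' (z + c)) (at 0)" for z
  proof -
    have "z + e * of_real t + c = (z + c) + e * of_real t" for t by simp
    then show ?thesis using assms unfolding has_dir_deriv_def by presburger
  qed
  then show ?thesis using assms by (auto simp: has_dir_deriv_def intro!: has_vector_derivative_diff)
qed

lemma has_dir_deriv_unique_zero:
  assumes "has_dir_deriv e (\<lambda>_. 0) f'"
  shows "f' z = 0"
proof -
  have "((\<lambda>t::real. 0::complex) has_vector_derivative f' z) (at 0)"
    using assms unfolding has_dir_deriv_def by blast
  from vector_derivative_at[OF this] show ?thesis by simp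
qed

lemma continuous_line:
  assumes "continuous_on UNIV f"
  shows "continuous_on A (\<lambda>t::real. f (z + e * of_real t :: complex))"
  by (intro continuous_on_compose2[OF assms] continuous_intros) auto

lemma has_dir_deriv_eq_integral:
  assumes f: "has_dir_deriv e f f'" and "0 \<le> t"
  shows "integral {0..t} (\<lambda>s. f' (z + e * of_real s)) = f (z + e * of_real t) - f z"
  using fundamental_theorem_of_calculus[of 0 t "\<lambda>t. f (z + e * of_real t)" "\<lambda>s. f' (z + e * of_real s)"]
    has_dir_derivD[OF f] assms(2) by (auto simp: integral_unique)

text \<open>Converse of the fundamental theorem for continuous \<open>f'\<close>. The integral
  identity is the form that can be checked for \<open>line_int\<close> by shifting intervals, and
  the form that passes to locally uniform limits.\<close>

lemma has_dir_derivI_integral: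
  assumes cont: "continuous_on UNIV f'"
    and eq: "\<And>z t. 0 \<le> t \<Longrightarrow> integral {0..t} (\<lambda>s. f' (z + e * of_real s)) = f (z + e * of_real t) - f z"
  shows "has_dir_deriv e f f'"
  unfolding has_dir_deriv_def
proof
  fix z
  \<comment> \<open>The identity covers only \<open>t \<ge> 0\<close>. Moving the base point back by
    \<open>e\<close> turns \<open>z\<close> into the interior parameter value 1, so the derivative
    obtained is two-sided.\<close>
  define w where "w = z - e"
  have "((\<lambda>u. integral {0..u} (\<lambda>s. f' (w + e * of_real s))) has_vector_derivative f' (w + e * of_real 1)) (at 1 within {0..2})"
    by (rule integral_has_vector_derivative) (auto intro!: continuous_line cont)
  then have "((\<lambda>u. integral {0..u} (\<lambda>s. f' (w + e * of_real s))) has_vector_derivative f' z) (at 1)"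
    by (simp add: at_within_Icc_at w_def)
  then have "((\<lambda>u. f (w + e * of_real u) - f w) has_vector_derivative f' z) (at 1)"
    by (rule has_vector_derivative_transform_within_open[where S = "{0<..}"]) (auto simp: eq)
  then have "((\<lambda>u. f (w + e * of_real u) - f w + f w) has_vector_derivative f' z + 0) (at (1 + 0))"
    by (intro has_vector_derivative_add) auto
  then have "((\<lambda>u. f (w + e * of_real u)) \<circ> (\<lambda>t. 1 + t) has_vector_derivative 1 *\<^sub>R f' z) (at 0)"
    by (intro vector_diff_chain_at) (auto intro!: derivative_eq_intros)
  then show "((\<lambda>t. f (z + e * of_real t)) has_vector_derivative f' z) (at 0)"
    by (simp add: o_def w_def algebra_simps)
qed

text \<open>Convolution with a box kernel along \<open>e\<close>, without the factor
  \<open>1 / h\<close>. Its derivative along \<open>e\<close> is a difference of two values of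
  \<open>f\<close>, so a merely continuous \<open>f\<close> gains one derivative.\<close>

definition line_int :: "complex \<Rightarrow> real \<Rightarrow> (complex \<Rightarrow> complex) \<Rightarrow> complex \<Rightarrow> complex" where
  "line_int e h f z = integral {0..h} (\<lambda>t. f (z + e * of_real t))"

lemma continuous_on_param_integral:
  fixes F :: "real \<Rightarrow> 'a::topological_space \<Rightarrow> complex"
  assumes "continuous_on (UNIV \<times> {a..b}) (\<lambda>(z, t). F t z)"
  shows "continuous_on UNIV (\<lambda>z. integral {a..b} (\<lambda>t. F t z))"
  using integral_continuous_on_param[of UNIV a b "\<lambda>z t. F t z"] assms by simp

lemma continuous_line_int:
  assumes "continuous_on UNIV f"
  shows "continuous_on UNIV (line_int e h f)"
proof -
  have "continuous_on (UNIV \<times> {0..h}) (\<lambda>(z, t). f (z + e * of_real t))"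
    unfolding split_beta by (intro continuous_on_compose2[OF assms] continuous_intros) auto
  from continuous_on_param_integral[OF this] show ?thesis by (simp add: line_int_def[abs_def])
qed

lemma has_dir_deriv_line_int:
  assumes f: "continuous_on UNIV f" and h: "h \<ge> 0"
  shows "has_dir_deriv e (line_int e h f) (\<lambda>z. f (z + e * of_real h) - f z)"
proof (rule has_dir_derivI_integral)
  show "continuous_on UNIV (\<lambda>z. f (z + e * of_real h) - f z)"
    by (intro continuous_intros continuous_on_compose2[OF f]) auto
next
  fix z and t :: real assume t: "0 \<le> t"
  define g where "g = (\<lambda>s. f (z + e * of_real s))"
  have g: "continuous_on A g" for A unfolding g_def by (rule continuous_line[OF f])
  have gi: "g integrable_on {a..b}" for a b by (intro integrable_continuous_real g)
  have shift: "integral {0..r} (\<lambda>s. f (z + e * of_real c + e * of_real s)) = integral {c..r + c} g" for r c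
    using integral_shift_real_ivl[of c c "r + c" g] by (simp add: g_def algebra_simps)
  have "integral {0..t} (\<lambda>s. f (z + e * of_real s + e * of_real h) - f (z + e * of_real s))
      = integral {0..t} (\<lambda>s. f (z + e * of_real h + e * of_real s)) - integral {0..t} g"
    by (subst integral_diff[symmetric])
       (auto simp: g_def add.assoc add.commute[of "e * of_real h"]
         intro!: integrable_continuous_real continuous_on_compose2[OF f] continuous_intros)
  also have "\<dots> = integral {h..t + h} g - integral {0..t} g" by (simp add: shift)
  \<comment> \<open>Both differences equal the integral over \<open>{0..t + h}\<close> minus those
    over \<open>{0..h}\<close> and \<open>{0..t}\<close>: a window of length \<open>t\<close> moved
    by \<open>h\<close> is traded for a window of length \<open>h\<close> moved by
    \<open>t\<close>.\<close>
  also have "\<dots> = integral {t..h + t} g - integral {0..h} g"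
    using Henstock_Kurzweil_Integration.integral_combine[of 0 h "t + h" g] Henstock_Kurzweil_Integration.integral_combine[of 0 t "h + t" g] gi t h
    by (simp add: add.commute algebra_simps)
  also have "\<dots> = line_int e h f (z + e * of_real t) - line_int e h f z"
    by (simp add: line_int_def shift) (simp add: g_def)
  finally show "integral {0..t} (\<lambda>s. f (z + e * of_real s + e * of_real h) - f (z + e * of_real s)) =
      line_int e h f (z + e * of_real t) - line_int e h f z" .
qed

lemma has_dir_deriv_line_int':
  assumes f: "continuous_on UNIV f" and f': "continuous_on UNIV f'" and d: "has_dir_deriv e f f'"
  shows "has_dir_deriv e (line_int d h f) (line_int d h f')"
  unfolding has_dir_deriv_def
proof
  fix z
  have "((\<lambda>x. integral (cbox 0 h) (\<lambda>t. f (z + e * of_real x + d * of_real t))) has_vector_derivative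
         integral (cbox 0 h) (\<lambda>t. f' (z + e * of_real 0 + d * of_real t))) (at 0 within UNIV)"
  proof (rule leibniz_rule_vector_derivative)
    show "continuous_on (UNIV \<times> cbox 0 h) (\<lambda>(x, t). f' (z + e * of_real x + d * of_real t))"
      unfolding split_beta by (intro continuous_on_compose2[OF f'] continuous_intros) auto
    show "(\<lambda>t. f (z + e * of_real x + d * of_real t)) integrable_on cbox 0 h" for x
      by (intro integrable_continuous continuous_line f)
    show "((\<lambda>x. f (z + e * of_real x + d * of_real t)) has_vector_derivative f' (z + e * of_real x + d * of_real t)) (at x within UNIV)" for x t
      using has_dir_derivD[OF assms(3), of "z + d * of_real t" x UNIV] by (simp add: algebra_simps)
  qed auto
  then show "((\<lambda>t. line_int d h f (z + e * of_real t)) has_vector_derivative line_int d h f' z) (at 0)"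
    by (simp add: line_int_def)
qed

text \<open>\<open>F i j\<close> stands for the derivative of \<open>F 0 0\<close> taken
  \<open>i\<close> times in x and \<open>j\<close> times in y. The derivatives are carried as data,
  so that operators can act on the whole array, and symmetry of mixed partials is built into the
  indexing. Entries with \<open>i + j > N\<close> are unconstrained.\<close>

definition jet :: "nat \<Rightarrow> (nat \<Rightarrow> nat \<Rightarrow> complex \<Rightarrow> complex) \<Rightarrow> bool" where
  "jet N F \<longleftrightarrow> (\<forall>i j. i + j \<le> N \<longrightarrow> continuous_on UNIV (F i j)) \<and>
     (\<forall>i j. i + j < N \<longrightarrow> has_dir_deriv 1 (F i j) (F (Suc i) j) \<and> has_dir_deriv \<i> (F i j) (F i (Suc j)))"

text \<open>For \<open>i > 0\<close> this is meant to be applied to the derivative of order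
  \<open>i - 1\<close>: the derivative of order \<open>i\<close> of a line integral along its own
  direction is a difference of two values of that one.\<close>

definition smooth_dir :: "complex \<Rightarrow> real \<Rightarrow> nat \<Rightarrow> (complex \<Rightarrow> complex) \<Rightarrow> complex \<Rightarrow> complex" where
  "smooth_dir e h i f = (if i = 0 then line_int e h f else (\<lambda>z. f (z + e * of_real h) - f z))"

lemma continuous_smooth_dir: "continuous_on UNIV f \<Longrightarrow> continuous_on UNIV (smooth_dir e h i f)"
  by (auto simp: smooth_dir_def intro!: continuous_line_int continuous_intros intro: continuous_on_compose2)

lemma has_dir_deriv_smooth_dir:
  "continuous_on UNIV f \<Longrightarrow> continuous_on UNIV f' \<Longrightarrow> has_dir_deriv e f f' \<Longrightarrow>
    has_dir_deriv e (smooth_dir d h i f) (smooth_dir d h i f')"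
  by (auto simp: smooth_dir_def intro: has_dir_deriv_line_int' has_dir_deriv_diff_shift)

lemma has_dir_deriv_smooth_dir_Suc:
  assumes "continuous_on UNIV (F (i - 1))" "h \<ge> 0"
    and "i > 0 \<Longrightarrow> has_dir_deriv e (F (i - 1)) (F i)"
  shows "has_dir_deriv e (smooth_dir e h i (F (i - 1))) (smooth_dir e h (Suc i) (F i))"
  using assms has_dir_deriv_diff_shift[of e "F (i - 1)" "F i" "e * of_real h"]
  by (auto simp: smooth_dir_def has_dir_deriv_line_int)

text \<open>Differentiating a line integral along its own direction consumes one order less of
  \<open>F\<close>. With truncated subtraction the entry \<open>(i, j)\<close> needs
  \<open>F\<close> at \<open>(i - 1, j - 1)\<close>, which has order at most \<open>N\<close>
  whenever \<open>i + j \<le> N + 1\<close>. Averaging in both directions covers the pure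
  derivatives in x and in y alike.\<close>

lemma jet_smooth:
  assumes F: "jet N F" and h: "h \<ge> 0"
  shows "jet (Suc N) (\<lambda>i j z. c * smooth_dir 1 h i (smooth_dir \<i> h j (F (i - 1) (j - 1))) z)"
proof -
  have c: "continuous_on UNIV (F i j)" if "i + j \<le> N" for i j using F that by (auto simp: jet_def)
  have 1: "has_dir_deriv 1 (F i j) (F (Suc i) j)" "has_dir_deriv \<i> (F i j) (F i (Suc j))" if "i + j < N" for i j
    using F that by (auto simp: jet_def)
  show ?thesis unfolding jet_def
  proof (intro conjI allI impI)
    fix i j :: nat assume "i + j \<le> Suc N"
    then show "continuous_on UNIV (\<lambda>z. c * smooth_dir 1 h i (smooth_dir \<i> h j (F (i - 1) (j - 1))) z)"
      by (intro continuous_on_mult_left continuous_smooth_dir c) linarith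
  next
    fix i j :: nat assume ij: "i + j < Suc N"
    have A: "continuous_on UNIV (F (i - 1) (j - 1))" "continuous_on UNIV (F i (j - 1))" "continuous_on UNIV (F (i - 1) j)"
      using ij by (auto intro!: c)
    have "has_dir_deriv 1 (smooth_dir 1 h i (smooth_dir \<i> h j (F (i - 1) (j - 1))))
        (smooth_dir 1 h (Suc i) (smooth_dir \<i> h j (F i (j - 1))))"
    proof (rule has_dir_deriv_smooth_dir_Suc[where F = "\<lambda>i. smooth_dir \<i> h j (F i (j - 1))"])
      assume "i > 0"
      then show "has_dir_deriv 1 (smooth_dir \<i> h j (F (i - 1) (j - 1))) (smooth_dir \<i> h j (F i (j - 1)))"
        using 1(1)[of "i - 1" "j - 1"] ij by (intro has_dir_deriv_smooth_dir A) auto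
    qed (intro continuous_smooth_dir A h)+
    then show "has_dir_deriv 1 (\<lambda>z. c * smooth_dir 1 h i (smooth_dir \<i> h j (F (i - 1) (j - 1))) z)
        (\<lambda>z. c * smooth_dir 1 h (Suc i) (smooth_dir \<i> h j (F (Suc i - 1) (j - 1))) z)"
      by (simp add: has_dir_deriv_cmult)
    have "has_dir_deriv \<i> (smooth_dir \<i> h j (F (i - 1) (j - 1))) (smooth_dir \<i> h (Suc j) (F (i - 1) j))"
    proof (rule has_dir_deriv_smooth_dir_Suc)
      assume "j > 0"
      then show "has_dir_deriv \<i> (F (i - 1) (j - 1)) (F (i - 1) j)"
        using 1(2)[of "i - 1" "j - 1"] ij by auto
    qed (intro A h)+
    then have "has_dir_deriv \<i> (smooth_dir 1 h i (smooth_dir \<i> h j (F (i - 1) (j - 1))))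
        (smooth_dir 1 h i (smooth_dir \<i> h (Suc j) (F (i - 1) j)))"
      by (intro has_dir_deriv_smooth_dir continuous_smooth_dir A)
    then show "has_dir_deriv \<i> (\<lambda>z. c * smooth_dir 1 h i (smooth_dir \<i> h j (F (i - 1) (j - 1))) z)
        (\<lambda>z. c * smooth_dir 1 h i (smooth_dir \<i> h (Suc j) (F (i - 1) (Suc j - 1))) z)"
      by (simp add: has_dir_deriv_cmult)
  qed
qed

lemma line_int_approx:
  fixes f :: "complex \<Rightarrow> complex"
  assumes f: "continuous_on UNIV f" and "h > 0" "norm e = 1"
    and "\<And>t. 0 \<le> t \<Longrightarrow> t \<le> h \<Longrightarrow> norm (f (z + e * of_real t) - w) \<le> \<epsilon>"
  shows "norm (inverse (of_real h) * line_int e h f z - w) \<le> \<epsilon>"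
proof -
  have "norm (line_int e h f z - of_real h * w) = norm (integral {0..h} (\<lambda>t. f (z + e * of_real t) - w))"
    using assms by (subst integral_diff)
      (auto simp: line_int_def scaleR_conv_of_real intro!: integrable_continuous_real continuous_line)
  also have "\<dots> \<le> \<epsilon> * (h - 0)"
    using assms by (intro integral_bound continuous_intros continuous_line f) auto
  finally have "norm (line_int e h f z - of_real h * w) \<le> \<epsilon> * h" by simp
  moreover have "inverse (of_real h) * line_int e h f z - w = (line_int e h f z - of_real h * w) / of_real h"
    using assms by (simp add: field_simps)
  ultimately show ?thesis using assms by (simp add: norm_divide pos_divide_le_eq)
qed

lemma smooth_approx:
  fixes f :: "complex \<Rightarrow> complex"
  assumes f: "continuous_on UNIV f" and K: "compact K" and "\<epsilon> > 0"
  obtains h where "h > 0" "\<And>z. z \<in> K \<Longrightarrow>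
    norm (inverse (of_real h) * inverse (of_real h) * line_int 1 h (line_int \<i> h f) z - f z) < \<epsilon>"
proof -
  define K' where "K' = {x + y | x y. x \<in> K \<and> y \<in> cball (0::complex) 2}"
  have K': "compact K'" unfolding K'_def by (intro compact_sums K compact_cball)
  have "uniformly_continuous_on K' f"
    by (intro compact_uniformly_continuous continuous_on_subset[OF f] K') auto
  then obtain \<delta> where \<delta>: "\<delta> > 0" "\<And>x y. x \<in> K' \<Longrightarrow> y \<in> K' \<Longrightarrow> dist y x < \<delta> \<Longrightarrow> dist (f y) (f x) < \<epsilon>/2"
    unfolding uniformly_continuous_on_def using \<open>\<epsilon> > 0\<close> by (metis half_gt_zero)
  \<comment> \<open>Points of the square with corner \<open>z\<close> and side \<open>h\<close>
    differ from \<open>z\<close> by at most \<open>2 * h\<close>: \<open>h \<le> 1\<close> keeps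
    them in \<open>K'\<close>, and \<open>h \<le> \<delta>/3\<close> makes the displacement smaller
    than \<open>\<delta>\<close>.\<close>
  define h where "h = min 1 (\<delta>/3)"
  have h: "h > 0" "h \<le> 1" "2 * h < \<delta>" using \<delta> by (auto simp: h_def)
  have "norm (inverse (of_real h) * inverse (of_real h) * line_int 1 h (line_int \<i> h f) z - f z) \<le> \<epsilon>/2" if z: "z \<in> K" for z
  proof -
    have n: "norm (f (z + 1 * of_real s + \<i> * of_real t) - f z) \<le> \<epsilon>/2" if st: "0 \<le> s" "s \<le> h" "0 \<le> t" "t \<le> h" for s t
    proof -
      have "norm (of_real s + \<i> * of_real t) \<le> norm (of_real s :: complex) + norm (\<i> * of_real t)" by (rule norm_triangle_ineq)
      also have "\<dots> \<le> 2 * h" using st by (simp add: norm_mult)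
      finally have *: "norm (of_real s + \<i> * of_real t) \<le> 2 * h" .
      have K'I: "z + y \<in> K'" if "norm y \<le> 2" for y using z that unfolding K'_def by force
      have "z + (of_real s + \<i> * of_real t) \<in> K'" "z \<in> K'"
        using * h K'I[of 0] by (auto intro!: K'I)
      then show ?thesis using \<delta>(2)[of z "z + (of_real s + \<i> * of_real t)"] * h
        by (simp add: dist_norm algebra_simps less_imp_le)
    qed
    have 1: "norm (inverse (of_real h) * line_int \<i> h f (z + 1 * of_real s) - f z) \<le> \<epsilon>/2" if "0 \<le> s" "s \<le> h" for s
    proof (rule line_int_approx[OF f])
      show "norm (f (z + 1 * of_real s + \<i> * of_real t) - f z) \<le> \<epsilon>/2" if "0 \<le> t" "t \<le> h" for t
        using n[of s t] that \<open>0 \<le> s\<close> \<open>s \<le> h\<close> by blast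
    qed (use h in auto)
    have "norm (inverse (of_real h) * line_int 1 h (\<lambda>z. inverse (of_real h) * line_int \<i> h f z) z - f z) \<le> \<epsilon>/2"
      by (rule line_int_approx[OF _ h(1)]) (use 1 in \<open>auto intro!: continuous_on_mult_left continuous_line_int f\<close>)
    moreover have "line_int 1 h (\<lambda>z. inverse (of_real h) * line_int \<i> h f z) z = inverse (of_real h) * line_int 1 h (line_int \<i> h f) z"
      by (simp add: line_int_def integral_mult_right)
    ultimately show ?thesis by (simp add: mult.assoc)
  qed
  moreover have "\<epsilon>/2 < \<epsilon>" using \<open>\<epsilon> > 0\<close> by simp
  ultimately show ?thesis using that[OF h(1)] le_less_trans by blast
qed

lemma line_int_in_closed_subspace:
  assumes V: "closed_subspace V" and tr: "\<And>f c. f \<in> V \<Longrightarrow> (\<lambda>z. f (z + c)) \<in> V"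
    and f: "f \<in> V" "continuous_on UNIV f"
  shows "line_int e h f \<in> V"
proof -
  have "continuous_on ({0..h} \<times> UNIV) (\<lambda>(t, z). f (z + e * of_real t))"
    unfolding split_beta by (intro continuous_on_compose2[OF f(2)] continuous_intros) auto
  from closed_subspace_integral[OF V _ this] tr f(1)
  show ?thesis by (simp add: line_int_def[abs_def])
qed

text \<open>Induction on \<open>N\<close>: averaging the approximants of order \<open>N\<close> over
  squares gains one order and stays in \<open>V\<close>, because \<open>V\<close> is invariant under
  translations and closed under integrals. Idempotence of \<open>ucl\<close> chains the two
  approximations.\<close>

lemma jet_dense:
  assumes V: "closed_subspace V" and tr: "\<And>f c. f \<in> V \<Longrightarrow> (\<lambda>z. f (z + c)) \<in> V"
    and f: "f \<in> V" "continuous_on UNIV f"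
  shows "f \<in> ucl {F 0 0 | F. jet N F \<and> F 0 0 \<in> V}"
proof (induction N)
  case 0
  have "jet 0 (\<lambda>_ _. f)" using f by (simp add: jet_def)
  then have "f \<in> {F 0 0 | F. jet 0 F \<and> F 0 0 \<in> V}" using f by force
  then show ?case by (rule ucl_incl)
next
  case (Suc N)
  show ?case
  proof (rule ucl_trans[OF Suc], safe)
    fix F assume F: "jet N F" "F 0 0 \<in> V"
    have F0: "continuous_on UNIV (F 0 0)" using F by (simp add: jet_def)
    show "F 0 0 \<in> ucl {F 0 0 | F. jet (Suc N) F \<and> F 0 0 \<in> V}"
    proof (rule uclI)
      fix K :: "complex set" and \<epsilon> :: real assume K: "compact K" "\<epsilon> > 0"
      obtain h where h: "h > 0" "\<And>z. z \<in> K \<Longrightarrow>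
          norm (inverse (of_real h) * inverse (of_real h) * line_int 1 h (line_int \<i> h (F 0 0)) z - F 0 0 z) < \<epsilon>"
        using smooth_approx[OF F0 K] by blast
      define G where "G = (\<lambda>i j z. inverse (of_real h) * inverse (of_real h) * smooth_dir 1 h i (smooth_dir \<i> h j (F (i - 1) (j - 1))) z)"
      have "jet (Suc N) G" unfolding G_def by (rule jet_smooth) (use F h in auto)
      moreover have G0: "G 0 0 = (\<lambda>z. inverse (of_real h) * inverse (of_real h) * line_int 1 h (line_int \<i> h (F 0 0)) z)"
        by (simp add: G_def smooth_dir_def)
      moreover have "G 0 0 \<in> V" unfolding G0
        by (intro closed_subspaceD(4)[OF V] line_int_in_closed_subspace[OF V] tr F continuous_line_int F0)
      ultimately have "G 0 0 \<in> {F 0 0 | F. jet (Suc N) F \<and> F 0 0 \<in> V}" by blast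
      then show "\<exists>g\<in>{F 0 0 | F. jet (Suc N) F \<and> F 0 0 \<in> V}. \<forall>z\<in>K. norm (g z - F 0 0 z) < \<epsilon>"
        using h(2) G0 by (intro bexI[of _ "G 0 0"]) auto
    qed
  qed
qed


section \<open>Weighted circular means\<close>

text \<open>Continuity of \<open>fy\<close> upgrades the two directional derivatives to a total
  derivative, which the chain rule along circles requires.\<close>

lemma has_derivative_from_dir_derivs:
  assumes fx: "has_dir_deriv 1 f fx" and fy: "has_dir_deriv \<i> f fy" and cy: "continuous_on UNIV fy"
  shows "(f has_derivative (\<lambda>h. of_real (Re h) * fx z + of_real (Im h) * fy z)) (at z)"
proof -
  have 1: "((\<lambda>x. f (Complex x (Im z))) has_derivative (\<lambda>t. t *\<^sub>R fx z)) (at (Re z) within UNIV)"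
  proof -
    have "\<i> * of_real (Im z) + 1 * of_real t = Complex t (Im z)" for t
      by (simp add: complex_eq_iff)
    then show ?thesis using has_dir_derivD[OF fx, of "\<i> * of_real (Im z)" "Re z" UNIV]
      by (simp add: has_vector_derivative_def)
  qed
  have 2: "((\<lambda>y. f (Complex x y)) has_derivative blinfun_apply (blinfun_scaleR_left (fy (Complex x y)))) (at y within UNIV)" for x y
  proof -
    have "of_real x + \<i> * of_real t = Complex x t" for t
      by (simp add: complex_eq_iff)
    then show ?thesis using has_dir_derivD[OF fy, of "of_real x" y UNIV]
      by (simp add: has_vector_derivative_def)
  qed
  have "continuous_on UNIV (\<lambda>p. blinfun_scaleR_left (fy (Complex (fst p) (snd p))))"
    by (intro bounded_linear.continuous_on[OF bounded_linear_blinfun_scaleR_left] continuous_on_compose2[OF cy]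
        continuous_intros) auto
  then have 3: "continuous (at (Re z, Im z) within UNIV \<times> UNIV) (\<lambda>(x, y). blinfun_scaleR_left (fy (Complex x y)))"
    unfolding split_beta by (simp add: continuous_on_eq_continuous_at del: split_paired_All)
  have "((\<lambda>(x, y). f (Complex x y)) has_derivative (\<lambda>(tx, ty). tx *\<^sub>R fx z + blinfun_apply (blinfun_scaleR_left (fy (Complex (Re z) (Im z)))) ty)) (at (Re z, Im z) within UNIV \<times> UNIV)"
    by (rule has_derivative_partialsI[OF 1 2 3]) auto
  then have D: "((\<lambda>p. f (Complex (fst p) (snd p))) has_derivative (\<lambda>p. fst p *\<^sub>R fx z + snd p *\<^sub>R fy z)) (at (Re z, Im z))"
    unfolding split_beta by simp
  have "((\<lambda>w. (Re w, Im w)) has_derivative (\<lambda>h. (Re h, Im h))) (at z)"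
    by (auto intro!: derivative_eq_intros)
  from diff_chain_at[OF this D] show ?thesis
    by (simp add: o_def scaleR_conv_of_real)
qed

text \<open>The integral is not divided by \<open>2 * pi\<close>; the constants
  \<open>mean_coeff\<close> and the factor \<open>pi\<close> in \<open>deriv_op\<close> account for
  this.\<close>

definition wmean :: "(real \<Rightarrow> real) \<Rightarrow> (complex \<Rightarrow> complex) \<Rightarrow> complex \<Rightarrow> real \<Rightarrow> complex" where
  "wmean w f b r = integral {0..2*pi} (\<lambda>\<theta>. of_real (w \<theta>) * f (b + of_real r * cis \<theta>))"

lemma has_vector_derivative_cis: "(cis has_vector_derivative \<i> * cis \<theta>) (at \<theta> within A)"
  unfolding has_vector_derivative_def using has_derivative_cis[OF has_derivative_ident] .

lemma continuous_wmean_integrand: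
  fixes f :: "complex \<Rightarrow> complex"
  assumes "continuous_on UNIV f" "continuous_on UNIV w"
  shows "continuous_on A (\<lambda>\<theta>. of_real (w \<theta>) * f (b + of_real r * cis \<theta>))"
  by (intro continuous_intros continuous_on_compose2[OF assms(1)] continuous_on_compose2[OF assms(2)]) auto

lemma wmean_integrable:
  fixes f :: "complex \<Rightarrow> complex"
  assumes "continuous_on UNIV f" "continuous_on UNIV w"
  shows "(\<lambda>\<theta>. of_real (w \<theta>) * f (b + of_real r * cis \<theta>)) integrable_on {a..c}"
  by (intro integrable_continuous_real continuous_wmean_integrand assms)

lemma continuous_wmean:
  assumes "continuous_on UNIV f" "continuous_on UNIV w"
  shows "continuous_on UNIV (\<lambda>b. wmean w f b r)"
proof -
  have "continuous_on (UNIV \<times> {0..2*pi}) (\<lambda>(b, \<theta>). of_real (w \<theta>) * f (b + of_real r * cis \<theta>))"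
    unfolding split_beta by (intro continuous_intros continuous_on_compose2[OF assms(1)] continuous_on_compose2[OF assms(2)]) auto
  from continuous_on_param_integral[OF this] show ?thesis by (simp add: wmean_def)
qed

lemma wmean_add_weight:
  assumes "continuous_on UNIV f" "continuous_on UNIV v" "continuous_on UNIV w"
  shows "wmean (\<lambda>\<theta>. v \<theta> + w \<theta>) f b r = wmean v f b r + wmean w f b r"
  unfolding wmean_def by (subst integral_add[symmetric]) (auto intro!: wmean_integrable assms simp: ring_distribs)

lemma wmean_add:
  assumes "continuous_on UNIV f" "continuous_on UNIV g" "continuous_on UNIV w"
  shows "wmean w (\<lambda>z. f z + g z) b r = wmean w f b r + wmean w g b r"
  unfolding wmean_def by (subst integral_add[symmetric]) (auto intro!: wmean_integrable assms simp: ring_distribs)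

lemma wmean_diff:
  assumes "continuous_on UNIV f" "continuous_on UNIV g" "continuous_on UNIV w"
  shows "wmean w f b r - wmean w g b r = wmean w (\<lambda>z. f z - g z) b r"
  unfolding wmean_def by (subst integral_diff[symmetric]) (auto intro!: wmean_integrable assms simp: ring_distribs)

lemma wmean_bound:
  assumes "continuous_on UNIV f" "continuous_on UNIV w" "\<And>\<theta>. \<bar>w \<theta>\<bar> \<le> 1"
    and "\<And>\<theta>. norm (f (b + of_real r * cis \<theta>)) \<le> B"
  shows "norm (wmean w f b r) \<le> 2 * pi * B"
proof -
  have "norm (of_real (w \<theta>) * f (b + of_real r * cis \<theta>)) \<le> 1 * B" for \<theta>
    unfolding norm_mult using assms(3)[of \<theta>] assms(4)[of \<theta>] by (intro mult_mono) auto
  then have "norm (integral {0..2*pi} (\<lambda>\<theta>. of_real (w \<theta>) * f (b + of_real r * cis \<theta>))) \<le> B * (2 * pi - 0)"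
    by (intro integral_bound continuous_wmean_integrand assms) auto
  then show ?thesis by (simp add: wmean_def algebra_simps)
qed

locale C1 =
  fixes f fx fy :: "complex \<Rightarrow> complex"
  assumes f: "continuous_on UNIV f" and cfx: "continuous_on UNIV fx" and cfy: "continuous_on UNIV fy"
    and dx: "has_dir_deriv 1 f fx" and dy: "has_dir_deriv \<i> f fy"
begin

lemma along_curve:
  assumes "(\<gamma> has_vector_derivative \<gamma>') (at t within A)"
  shows "((\<lambda>t. f (\<gamma> t)) has_vector_derivative (of_real (Re \<gamma>') * fx (\<gamma> t) + of_real (Im \<gamma>') * fy (\<gamma> t))) (at t within A)"
proof -
  have "(f has_derivative (\<lambda>h. of_real (Re h) * fx (\<gamma> t) + of_real (Im h) * fy (\<gamma> t))) (at (\<gamma> t) within \<gamma> ` A)"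
    using has_derivative_from_dir_derivs[OF dx dy cfy] has_derivative_at_withinI by blast
  from diff_chain_within[OF assms[unfolded has_vector_derivative_def] this] show ?thesis
    by (simp add: has_vector_derivative_def o_def scaleR_conv_of_real algebra_simps)
qed

lemma wmean_deriv:
  assumes w: "continuous_on UNIV w"
  shows "((\<lambda>r. wmean w f b r) has_vector_derivative
     (wmean (\<lambda>\<theta>. w \<theta> * cos \<theta>) fx b r + wmean (\<lambda>\<theta>. w \<theta> * sin \<theta>) fy b r)) (at r)"
proof -
  define g where "g = (\<lambda>r \<theta>. of_real (w \<theta> * cos \<theta>) * fx (b + of_real r * cis \<theta>) + of_real (w \<theta> * sin \<theta>) * fy (b + of_real r * cis \<theta>))"
  have "((\<lambda>r. integral (cbox 0 (2*pi)) (\<lambda>\<theta>. of_real (w \<theta>) * f (b + of_real r * cis \<theta>))) has_vector_derivative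
     integral (cbox 0 (2*pi)) (g r)) (at r within UNIV)"
  proof (rule leibniz_rule_vector_derivative)
    show "continuous_on (UNIV \<times> cbox 0 (2*pi)) (\<lambda>(r, \<theta>). g r \<theta>)"
      unfolding g_def split_beta
      by (intro continuous_intros continuous_on_compose2[OF cfx] continuous_on_compose2[OF cfy] continuous_on_compose2[OF w]) auto
    show "((\<lambda>r. of_real (w \<theta>) * f (b + of_real r * cis \<theta>)) has_vector_derivative g r \<theta>) (at r within UNIV)" for r \<theta>
    proof -
      have "((\<lambda>r. b + of_real r * cis \<theta>) has_vector_derivative cis \<theta>) (at r)"
        by (auto intro!: derivative_eq_intros)
      from has_vector_derivative_mult_right[OF along_curve[OF this], of "of_real (w \<theta>)"]
      show ?thesis by (simp add: g_def algebra_simps)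
    qed
  qed (auto intro!: wmean_integrable f w)
  moreover have "integral (cbox 0 (2*pi)) (g r) = wmean (\<lambda>\<theta>. w \<theta> * cos \<theta>) fx b r + wmean (\<lambda>\<theta>. w \<theta> * sin \<theta>) fy b r"
    unfolding wmean_def g_def box_real
    by (intro integral_add wmean_integrable cfx cfy continuous_intros w)
  ultimately show ?thesis by (simp add: wmean_def)
qed

text \<open>The left side is the integral over a full period of the derivative in
  \<open>\<theta>\<close> of \<open>w \<theta> * f (b + r * cis \<theta>)\<close>, a function with
  equal values at both ends.\<close>

lemma wmean_by_parts:
  assumes w: "\<And>\<theta>. (w has_real_derivative w' \<theta>) (at \<theta>)" and cw': "continuous_on UNIV w'" and per: "w (2*pi) = w 0"
  shows "wmean w' f b r + of_real r * (wmean (\<lambda>\<theta>. w \<theta> * cos \<theta>) fy b r - wmean (\<lambda>\<theta>. w \<theta> * sin \<theta>) fx b r) = 0"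
proof -
  have cw: "continuous_on UNIV w" using w by (meson DERIV_isCont continuous_at_imp_continuous_on)
  define h where "h = (\<lambda>\<theta>. of_real (w' \<theta>) * f (b + of_real r * cis \<theta>)
     + of_real (w \<theta>) * (of_real (r * cos \<theta>) * fy (b + of_real r * cis \<theta>) - of_real (r * sin \<theta>) * fx (b + of_real r * cis \<theta>)))"
  have "((\<lambda>\<theta>. of_real (w \<theta>) * f (b + of_real r * cis \<theta>)) has_vector_derivative h \<theta>) (at \<theta> within {0..2*pi})" for \<theta>
  proof -
    have "((\<lambda>\<theta>. b + of_real r * cis \<theta>) has_vector_derivative (of_real r * (\<i> * cis \<theta>))) (at \<theta> within {0..2*pi})"
      using has_vector_derivative_add[OF has_vector_derivative_const has_vector_derivative_mult_right[OF has_vector_derivative_cis]]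
      by simp
    from along_curve[OF this]
    have 1: "((\<lambda>\<theta>. f (b + of_real r * cis \<theta>)) has_vector_derivative
       (of_real (r * cos \<theta>) * fy (b + of_real r * cis \<theta>) - of_real (r * sin \<theta>) * fx (b + of_real r * cis \<theta>))) (at \<theta> within {0..2*pi})"
      by (simp add: algebra_simps)
    have 2: "((\<lambda>\<theta>. complex_of_real (w \<theta>)) has_vector_derivative of_real (w' \<theta>)) (at \<theta> within {0..2*pi})"
      using w[of \<theta>] by (intro has_vector_derivative_of_real) (auto simp: has_real_derivative_iff_has_vector_derivative intro: has_vector_derivative_at_within)
    show ?thesis using has_vector_derivative_mult[OF 2 1] by (simp add: h_def algebra_simps)
  qed
  from fundamental_theorem_of_calculus[OF _ this]
  have "(h has_integral 0) {0..2*pi}" using per by simp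
  moreover have "(h has_integral (wmean w' f b r + of_real r * (wmean (\<lambda>\<theta>. w \<theta> * cos \<theta>) fy b r - wmean (\<lambda>\<theta>. w \<theta> * sin \<theta>) fx b r))) {0..2*pi}"
  proof -
    have 1: "((\<lambda>\<theta>. of_real (w' \<theta>) * f (b + of_real r * cis \<theta>)) has_integral wmean w' f b r) {0..2*pi}"
      unfolding wmean_def by (intro integrable_integral wmean_integrable f cw')
    have 2: "((\<lambda>\<theta>. of_real (w \<theta> * cos \<theta>) * fy (b + of_real r * cis \<theta>)) has_integral wmean (\<lambda>\<theta>. w \<theta> * cos \<theta>) fy b r) {0..2*pi}"
      unfolding wmean_def by (intro integrable_integral wmean_integrable cfy continuous_intros cw)
    have 3: "((\<lambda>\<theta>. of_real (w \<theta> * sin \<theta>) * fx (b + of_real r * cis \<theta>)) has_integral wmean (\<lambda>\<theta>. w \<theta> * sin \<theta>) fx b r) {0..2*pi}"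
      unfolding wmean_def by (intro integrable_integral wmean_integrable cfx continuous_intros cw)
    show ?thesis
      using has_integral_add[OF 1 has_integral_mult_right[OF has_integral_diff[OF 2 3], of "of_real r"]]
      by (simp add: h_def algebra_simps)
  qed
  ultimately show ?thesis using has_integral_unique by blast
qed

text \<open>This is the divergence theorem on discs, differentiated in the radius:
  \<open>r * wmean cos f b r\<close> is the flux of the field \<open>(f, 0)\<close> through the
  circle, hence the integral of \<open>fx\<close> over the disc. The companion with
  \<open>sin\<close> treats the field \<open>(0, f)\<close>.\<close>

lemma wmean_cos_deriv:
  "((\<lambda>r. of_real r * wmean cos f b r) has_vector_derivative of_real r * wmean (\<lambda>_. 1) fx b r) (at r)"
proof -
  have D: "((\<lambda>r. of_real r * wmean cos f b r) has_vector_derivative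
      of_real r * (wmean (\<lambda>\<theta>. cos \<theta> * cos \<theta>) fx b r + wmean (\<lambda>\<theta>. cos \<theta> * sin \<theta>) fy b r) + of_real 1 * wmean cos f b r) (at r)"
    by (intro has_vector_derivative_mult wmean_deriv has_vector_derivative_of_real continuous_intros) auto
  \<comment> \<open>Integration by parts against \<open>sin\<close> expresses the mean of
    \<open>f\<close> through \<open>fx\<close> and \<open>fy\<close>. The mixed
    \<open>cos * sin\<close> terms then cancel, and the squares of \<open>cos\<close> and
    \<open>sin\<close> add up to the weight 1.\<close>
  have P: "wmean cos f b r + of_real r * (wmean (\<lambda>\<theta>. sin \<theta> * cos \<theta>) fy b r - wmean (\<lambda>\<theta>. sin \<theta> * sin \<theta>) fx b r) = 0"
    by (rule wmean_by_parts) (auto intro!: derivative_eq_intros continuous_intros)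
  have S: "wmean (\<lambda>_. 1) fx b r = wmean (\<lambda>\<theta>. cos \<theta> * cos \<theta>) fx b r + wmean (\<lambda>\<theta>. sin \<theta> * sin \<theta>) fx b r"
    by (subst wmean_add_weight[symmetric]) (auto intro!: cfx continuous_intros simp flip: power2_eq_square)
  have C: "wmean (\<lambda>\<theta>. sin \<theta> * cos \<theta>) fy b r = wmean (\<lambda>\<theta>. cos \<theta> * sin \<theta>) fy b r"
    by (simp add: wmean_def mult.commute)
  have "wmean cos f b r = of_real r * (wmean (\<lambda>\<theta>. sin \<theta> * sin \<theta>) fx b r - wmean (\<lambda>\<theta>. cos \<theta> * sin \<theta>) fy b r)"
    using P unfolding C by (simp add: add_eq_0_iff2 right_diff_distrib)
  then have "of_real r * (wmean (\<lambda>\<theta>. cos \<theta> * cos \<theta>) fx b r + wmean (\<lambda>\<theta>. cos \<theta> * sin \<theta>) fy b r) + of_real 1 * wmean cos f b r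
      = of_real r * wmean (\<lambda>_. 1) fx b r" using S by (simp add: algebra_simps)
  then show ?thesis using D by metis
qed

lemma wmean_sin_deriv:
  "((\<lambda>r. of_real r * wmean sin f b r) has_vector_derivative of_real r * wmean (\<lambda>_. 1) fy b r) (at r)"
proof -
  have D: "((\<lambda>r. of_real r * wmean sin f b r) has_vector_derivative
      of_real r * (wmean (\<lambda>\<theta>. sin \<theta> * cos \<theta>) fx b r + wmean (\<lambda>\<theta>. sin \<theta> * sin \<theta>) fy b r) + of_real 1 * wmean sin f b r) (at r)"
    by (intro has_vector_derivative_mult wmean_deriv has_vector_derivative_of_real continuous_intros) auto
  have P: "wmean sin f b r + of_real r * (wmean (\<lambda>\<theta>. - cos \<theta> * cos \<theta>) fy b r - wmean (\<lambda>\<theta>. - cos \<theta> * sin \<theta>) fx b r) = 0"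
    by (rule wmean_by_parts) (auto intro!: derivative_eq_intros continuous_intros)
  have S: "wmean (\<lambda>_. 1) fy b r = wmean (\<lambda>\<theta>. cos \<theta> * cos \<theta>) fy b r + wmean (\<lambda>\<theta>. sin \<theta> * sin \<theta>) fy b r"
    by (subst wmean_add_weight[symmetric]) (auto intro!: cfy continuous_intros simp flip: power2_eq_square)
  have N: "wmean (\<lambda>\<theta>. - cos \<theta> * u \<theta>) g b r = - wmean (\<lambda>\<theta>. cos \<theta> * u \<theta>) g b r" for u g
    by (simp add: wmean_def)
  have C: "wmean (\<lambda>\<theta>. cos \<theta> * sin \<theta>) fx b r = wmean (\<lambda>\<theta>. sin \<theta> * cos \<theta>) fx b r"
    by (simp add: wmean_def mult.commute)
  have "wmean sin f b r = of_real r * (wmean (\<lambda>\<theta>. cos \<theta> * cos \<theta>) fy b r - wmean (\<lambda>\<theta>. sin \<theta> * cos \<theta>) fx b r)"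
    using P unfolding N C by (simp add: add_eq_0_iff2 right_diff_distrib)
  then have "of_real r * (wmean (\<lambda>\<theta>. sin \<theta> * cos \<theta>) fx b r + wmean (\<lambda>\<theta>. sin \<theta> * sin \<theta>) fy b r) + of_real 1 * wmean sin f b r
      = of_real r * wmean (\<lambda>_. 1) fy b r" using S by (simp add: algebra_simps)
  then show ?thesis using D by metis
qed

end


section \<open>Pizzetti's formula\<close>

text \<open>The Laplacian of an array of derivatives is again such an array, so its powers need no
  new differentiation; each application costs two orders.\<close>

definition jet_lap :: "(nat \<Rightarrow> nat \<Rightarrow> complex \<Rightarrow> complex) \<Rightarrow> nat \<Rightarrow> nat \<Rightarrow> complex \<Rightarrow> complex" where
  "jet_lap F = (\<lambda>i j z. F (i + 2) j z + F i (j + 2) z)"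

lemma jet_mono: "jet N F \<Longrightarrow> M \<le> N \<Longrightarrow> jet M F"
  by (auto simp: jet_def)

lemma jet_continuous: "jet N F \<Longrightarrow> i + j \<le> N \<Longrightarrow> continuous_on UNIV (F i j)"
  by (auto simp: jet_def)

lemma jet_jet_lap:
  assumes "jet (N + 2) F"
  shows "jet N (jet_lap F)"
  using assms unfolding jet_def jet_lap_def
  by (auto intro!: continuous_intros has_dir_deriv_add)

lemma jet_jet_lap_funpow: "jet (N + 2 * k) F \<Longrightarrow> jet N ((jet_lap ^^ k) F)"
proof (induction k arbitrary: N)
  case (Suc k)
  then show ?case using jet_jet_lap[of N "(jet_lap ^^ k) F"] Suc.IH[of "N + 2"] by simp
qed auto

lemma jet_lap_funpow_shift:
  "(jet_lap ^^ k) (\<lambda>i j. F (i + p) (j + q)) = (\<lambda>i j. (jet_lap ^^ k) F (i + p) (j + q))"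
  by (induction k) (auto simp: jet_lap_def fun_eq_iff)

lemma jet_C1: "jet (Suc N) F \<Longrightarrow> i + j \<le> N \<Longrightarrow> C1 (F i j) (F (Suc i) j) (F i (Suc j))"
  by unfold_locales (auto simp: jet_def)

text \<open>The derivative bound is asked only at interior points, since below it is obtained by
  dividing by a positive radius.\<close>

lemma norm_diff_le_deriv_bound:
  fixes g :: "real \<Rightarrow> complex"
  assumes "\<And>s. (g has_vector_derivative g' s) (at s)" "0 \<le> r" "\<And>s. 0 < s \<Longrightarrow> s < r \<Longrightarrow> norm (g' s) \<le> C"
  shows "norm (g r - g 0) \<le> r * C"
proof (cases "r = 0")
  case False
  have "continuous_on {0..r} g"
    using assms(1) by (meson continuous_at_imp_continuous_on has_vector_derivative_continuous)
  then obtain x where x: "x \<in> {0<..<r}" "norm (g r - g 0) \<le> norm ((r - 0) *\<^sub>R g' x)"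
    using mvt_general[of 0 r g "\<lambda>s h. h *\<^sub>R g' s"] assms(1,2) False by (auto simp: has_vector_derivative_def)
  note x(2)
  also have "norm ((r - 0) *\<^sub>R g' x) \<le> r * C" using assms(3)[of x] x(1) by (auto intro!: mult_left_mono)
  finally show ?thesis .
qed simp

lemma has_vector_derivative_of_real_power:
  "((\<lambda>r. c * of_real r ^ Suc n / of_nat (Suc n) :: complex) has_vector_derivative c * of_real r ^ n) (at r)"
proof -
  have "((\<lambda>r. c * r ^ Suc n / of_nat (Suc n) :: complex) has_field_derivative c * of_real r ^ n) (at (of_real r))"
    by (rule derivative_eq_intros refl | simp del: of_nat_Suc)+
  from has_vector_derivative_real_field[OF this] show ?thesis by simp
qed

text \<open>Solving \<open>(r u')' = r * r ^ (2 * j)\<close> gives \<open>r ^ (2 * j + 2)\<close>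
  divided by the square of \<open>2 * j + 2\<close>, which is the recursion
  \<open>mean_coeff_Suc\<close>; the initial value \<open>2 * pi\<close> is the length of the
  integration interval.\<close>

definition mean_coeff :: "nat \<Rightarrow> complex" where
  "mean_coeff j = of_real (2 * pi / (4 ^ j * (fact j)\<^sup>2))"

lemma mean_coeff_Suc: "mean_coeff (Suc j) = mean_coeff j / of_nat (2 * j + 2) ^ 2"
proof -
  have "(4::real) ^ Suc j * (fact (Suc j))\<^sup>2 = 4 ^ j * (fact j)\<^sup>2 * (real (2 * j + 2))\<^sup>2"
    by (simp add: power2_eq_square algebra_simps)
  then show ?thesis unfolding mean_coeff_def by (metis divide_divide_eq_left of_real_divide of_real_of_nat_eq of_real_power)
qed

lemma mean_coeff_nz: "mean_coeff j \<noteq> 0" "mean_coeff 0 = 2 * of_real pi"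
  by (auto simp: mean_coeff_def)

lemma wmean_const_zero_radius: "wmean (\<lambda>_. 1) f b 0 = 2 * of_real pi * f b"
  by (simp add: wmean_def scaleR_conv_of_real)

text \<open>Pizzetti's formula with remainder. The circular mean \<open>u\<close> of \<open>f\<close> satisfies
  \<open>(r u')' = r \<cdot> (mean of the Laplacian of f)\<close>; integrating twice raises the order of the remainder by two.\<close>

lemma pizzetti_remainder:
  assumes "jet (2 * k) F" "0 \<le> r" "r < \<delta>"
    and "\<And>s. 0 \<le> s \<Longrightarrow> s < \<delta> \<Longrightarrow>
      norm (wmean (\<lambda>_. 1) ((jet_lap ^^ k) F 0 0) b s - 2 * of_real pi * (jet_lap ^^ k) F 0 0 b) \<le> \<epsilon>"
  shows "norm (wmean (\<lambda>_. 1) (F 0 0) b r - (\<Sum>j\<le>k. mean_coeff j * (jet_lap ^^ j) F 0 0 b * of_real r ^ (2 * j))) \<le> \<epsilon> * r ^ (2 * k)"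
  using assms
proof (induction k arbitrary: F r)
  case 0
  then show ?case by (simp add: mean_coeff_nz)
next
  case (Suc k)
  \<comment> \<open>The induction hypothesis is applied to the mean of the Laplacian
    \<open>G\<close>, whose expansion is one term shorter.\<close>
  define G where "G = jet_lap F"
  have G: "jet (2 * k) G" unfolding G_def using Suc.prems by (intro jet_jet_lap) simp
  have FG: "(jet_lap ^^ Suc j) F = (jet_lap ^^ j) G" for j by (simp add: funpow_Suc_right G_def del: funpow.simps)
  have C1: "C1 (F 0 0) (F 1 0) (F 0 1)" "C1 (F 1 0) (F 2 0) (F 1 1)" "C1 (F 0 1) (F 1 1) (F 0 2)"
    using jet_C1[of 1 F 0 0] jet_C1[of 1 F 1 0] jet_C1[of 1 F 0 1] jet_mono[OF Suc.prems(1), of 2]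
    by (auto simp: numeral_2_eq_2)
  define c where "c = (\<lambda>j. mean_coeff j * (jet_lap ^^ j) G 0 0 b)"
  have IH: "norm (wmean (\<lambda>_. 1) (G 0 0) b s - (\<Sum>j\<le>k. c j * of_real s ^ (2 * j))) \<le> \<epsilon> * s ^ (2 * k)"
    if "0 \<le> s" "s < \<delta>" for s
    unfolding c_def using Suc.IH[OF G that] Suc.prems(4)[unfolded FG] by blast
  have \<epsilon>: "\<epsilon> \<ge> 0" using Suc.prems(2,3) Suc.prems(4)[of 0] norm_ge_zero order_trans by (smt (verit))
  \<comment> \<open>With \<open>u\<close> the mean of \<open>F 0 0\<close>, \<open>B\<close> is
    \<open>r u'\<close> and \<open>v\<close> is \<open>u\<close>, each minus the antiderivative
    coming from the expansion of the mean of \<open>G\<close>. The constant term of \<open>u\<close>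
    is left in \<open>v\<close> and reappears as \<open>v 0\<close>.\<close>
  define B where "B = (\<lambda>r. of_real r * wmean cos (F 1 0) b r + of_real r * wmean sin (F 0 1) b r
     - (\<Sum>j\<le>k. c j * of_real r ^ Suc (2 * j + 1) / of_nat (Suc (2 * j + 1))))"
  define v where "v = (\<lambda>r. wmean (\<lambda>_. 1) (F 0 0) b r
     - (\<Sum>j\<le>k. (c j / of_nat (Suc (2 * j + 1))) * of_real r ^ Suc (2 * j + 1) / of_nat (Suc (2 * j + 1))))"
  have G00: "wmean (\<lambda>_. 1) (G 0 0) b r = wmean (\<lambda>_. 1) (F 2 0) b r + wmean (\<lambda>_. 1) (F 0 2) b r" for r
    unfolding G_def jet_lap_def using C1 by (simp add: wmean_add C1_def numeral_2_eq_2)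
  have B': "(B has_vector_derivative of_real r * (wmean (\<lambda>_. 1) (G 0 0) b r - (\<Sum>j\<le>k. c j * of_real r ^ (2 * j)))) (at r)" for r
  proof -
    have "(B has_vector_derivative of_real r * wmean (\<lambda>_. 1) (F 2 0) b r + of_real r * wmean (\<lambda>_. 1) (F 0 2) b r
       - (\<Sum>j\<le>k. c j * of_real r ^ (2 * j + 1))) (at r)"
      unfolding B_def
      by (intro has_vector_derivative_diff has_vector_derivative_add has_vector_derivative_sum
          has_vector_derivative_of_real_power C1.wmean_cos_deriv[OF C1(2)] C1.wmean_sin_deriv[OF C1(3)])
    then show ?thesis by (simp add: G00 algebra_simps sum_distrib_left)
  qed
  \<comment> \<open>Estimating by length times supremum gives up the factor that exact integration
    would yield, but it keeps the constant \<open>\<epsilon>\<close> unchanged through the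
    induction.\<close>
  have Bb: "norm (B s) \<le> s * (\<epsilon> * s ^ (2 * k + 1))" if "0 \<le> s" "s < \<delta>" for s
  proof -
    have "norm (B s - B 0) \<le> s * (\<epsilon> * s ^ (2 * k + 1))"
    proof (rule norm_diff_le_deriv_bound[OF B' that(1)])
      fix t assume t: "0 < t" "t < s"
      have "norm (of_real t * (wmean (\<lambda>_. 1) (G 0 0) b t - (\<Sum>j\<le>k. c j * of_real t ^ (2 * j)))) \<le> t * (\<epsilon> * t ^ (2 * k))"
        unfolding norm_mult using t IH[of t] that by (simp add: mult_left_mono)
      also have "\<dots> = \<epsilon> * t ^ (2 * k + 1)" by simp
      also have "\<dots> \<le> \<epsilon> * s ^ (2 * k + 1)" using t \<epsilon> by (intro mult_left_mono power_mono) auto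
      finally show "norm (of_real t * (wmean (\<lambda>_. 1) (G 0 0) b t - (\<Sum>j\<le>k. c j * of_real t ^ (2 * j)))) \<le> \<epsilon> * s ^ (2 * k + 1)" .
    qed
    moreover have "B 0 = 0" by (simp add: B_def)
    ultimately show ?thesis by simp
  qed
  define v' where "v' = (\<lambda>r. wmean (\<lambda>\<theta>. 1 * cos \<theta>) (F 1 0) b r + wmean (\<lambda>\<theta>. 1 * sin \<theta>) (F 0 1) b r
       - (\<Sum>j\<le>k. (c j / of_nat (Suc (2 * j + 1))) * of_real r ^ (2 * j + 1)))"
  have v': "(v has_vector_derivative v' r) (at r)" for r
    unfolding v_def v'_def
    by (intro has_vector_derivative_diff has_vector_derivative_sum
          has_vector_derivative_of_real_power C1.wmean_deriv[OF C1(1)] continuous_intros)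
  have Bv: "B r = of_real r * v' r" for r
    by (simp add: B_def v'_def algebra_simps sum_distrib_left)
  have "norm (v r - v 0) \<le> r * (\<epsilon> * r ^ (2 * k + 1))"
  proof (rule norm_diff_le_deriv_bound[OF v' Suc.prems(2)])
    fix t assume t: "0 < t" "t < r"
    have "t * norm (v' t) \<le> t * (\<epsilon> * t ^ (2 * k + 1))"
      using Bb[of t] t Suc.prems(3) by (simp add: Bv norm_mult)
    then have "norm (v' t) \<le> \<epsilon> * t ^ (2 * k + 1)" using t by simp
    also have "\<dots> \<le> \<epsilon> * r ^ (2 * k + 1)" using t \<epsilon> by (intro mult_left_mono power_mono) auto
    finally show "norm (v' t) \<le> \<epsilon> * r ^ (2 * k + 1)" .
  qed
  moreover have "v 0 = 2 * of_real pi * F 0 0 b" by (simp add: v_def wmean_const_zero_radius)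
  moreover have "v r - 2 * of_real pi * F 0 0 b
     = wmean (\<lambda>_. 1) (F 0 0) b r - (\<Sum>j\<le>Suc k. mean_coeff j * (jet_lap ^^ j) F 0 0 b * of_real r ^ (2 * j))"
    unfolding sum.atMost_Suc_shift FG mean_coeff_Suc
    by (simp add: v_def mean_coeff_nz c_def power2_eq_square add_divide_distrib)
  ultimately show ?case by (simp add: mult_ac)
qed

text \<open>The \<open>k\<close>-th Laplacian and its means vanish, so the remainder estimate holds
  with error constant 0 at every radius. The mean is then a polynomial in the square of
  \<open>r\<close>, of degree below \<open>k\<close>.\<close>

lemma pizzetti_exact:
  assumes F: "jet (2 * k) F" and z: "\<And>z. (jet_lap ^^ k) F 0 0 z = 0" and r: "0 \<le> r"
  shows "wmean (\<lambda>_. 1) (F 0 0) b r = (\<Sum>j<k. mean_coeff j * (jet_lap ^^ j) F 0 0 b * of_real r ^ (2 * j))"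
proof -
  have "norm (wmean (\<lambda>_. 1) (F 0 0) b r - (\<Sum>j\<le>k. mean_coeff j * (jet_lap ^^ j) F 0 0 b * of_real r ^ (2 * j))) \<le> 0 * r ^ (2 * k)"
    using r by (intro pizzetti_remainder[OF F, of r "r + 1"]) (auto simp: z wmean_def)
  then show ?thesis by (simp add: z lessThan_Suc_atMost[symmetric])
qed

lemma wmean_tendsto_center:
  assumes f: "continuous_on UNIV f" and "\<epsilon> > 0"
  obtains \<delta> where "\<delta> > 0" "\<And>s. 0 \<le> s \<Longrightarrow> s < \<delta> \<Longrightarrow> norm (wmean (\<lambda>_. 1) f b s - 2 * of_real pi * f b) \<le> \<epsilon>"
proof -
  obtain \<delta> where \<delta>: "\<delta> > 0" "\<And>x. dist x b < \<delta> \<Longrightarrow> dist (f x) (f b) < \<epsilon> / (2 * pi)"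
    using f \<open>\<epsilon> > 0\<close> unfolding continuous_on_iff by (metis UNIV_I divide_pos_pos pi_gt_zero zero_less_mult_iff zero_less_numeral)
  have "norm (wmean (\<lambda>_. 1) f b s - 2 * of_real pi * f b) \<le> \<epsilon>" if "0 \<le> s" "s < \<delta>" for s
  proof -
    have "wmean (\<lambda>_. 1) (\<lambda>_. f b) b s = 2 * of_real pi * f b" by (simp add: wmean_def scaleR_conv_of_real)
    then have "wmean (\<lambda>_. 1) f b s - 2 * of_real pi * f b = wmean (\<lambda>_. 1) (\<lambda>z. f z - f b) b s"
      using wmean_diff[OF f, of "\<lambda>_. f b" "\<lambda>_. 1" b s] by simp
    also have "norm \<dots> \<le> 2 * pi * (\<epsilon> / (2 * pi))"
    proof (rule wmean_bound)
      show "norm (f (b + of_real s * cis \<theta>) - f b) \<le> \<epsilon> / (2 * pi)" for \<theta>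
        using \<delta>(2)[of "b + of_real s * cis \<theta>"] that by (simp add: dist_norm norm_mult less_imp_le)
    qed (auto intro!: continuous_intros f)
    finally show ?thesis by simp
  qed
  then show ?thesis using that \<delta>(1) by blast
qed

text \<open>The argument of \<open>z\<close> only shifts a periodic integrand. The left side is an
  integral over affine substitutions in \<open>f\<close>, hence stays in \<open>V\<close>; the right
  side shows that it is radial in \<open>z\<close>.\<close>

lemma wmean_rotate:
  assumes f: "continuous_on UNIV f"
  shows "integral {0..2*pi} (\<lambda>\<theta>. f (b + z * cis \<theta>)) = wmean (\<lambda>_. 1) f b (norm z)"
proof -
  \<comment> \<open>The argument is moved into \<open>[0, 2 * pi]\<close> so that the shifted period
    can be cut at \<open>2 * pi\<close>.\<close>
  define \<alpha> where "\<alpha> = (if Arg z \<ge> 0 then Arg z else Arg z + 2 * pi)"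
  have \<alpha>: "0 \<le> \<alpha>" "\<alpha> \<le> 2 * pi" using Arg_bounded[of z] pi_gt_zero unfolding \<alpha>_def by auto
  define g where "g = (\<lambda>\<theta>. f (b + of_real (norm z) * cis \<theta>))"
  have "cis \<alpha> = cis (Arg z)" by (simp add: \<alpha>_def flip: cis_mult)
  then have "z = of_real (norm z) * cis \<alpha>" using rcis_cmod_Arg[of z] by (simp add: rcis_def)
  then have zc: "z * cis \<theta> = of_real (norm z) * cis (\<theta> + \<alpha>)" for \<theta>
    by (metis cis_mult mult.assoc mult.commute)
  have gi: "g integrable_on {a..c}" for a c
    unfolding g_def by (intro integrable_continuous_real continuous_on_compose2[OF f] continuous_intros) auto
  have per: "g (\<theta> + 2 * pi) = g \<theta>" for \<theta> by (simp add: g_def flip: cis_mult)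
  have "integral {0..2*pi} (\<lambda>\<theta>. f (b + z * cis \<theta>)) = integral {0..2*pi} (\<lambda>\<theta>. g (\<theta> + \<alpha>))"
    by (simp add: g_def zc)
  also have "\<dots> = integral {\<alpha>..2*pi + \<alpha>} g" using integral_shift_real_ivl[of \<alpha> \<alpha> "2 * pi + \<alpha>" g] by simp
  also have "\<dots> = integral {\<alpha>..2*pi} g + integral {2*pi..2*pi + \<alpha>} g"
    using \<alpha> gi by (subst Henstock_Kurzweil_Integration.integral_combine) auto
  also have "integral {2*pi..2*pi + \<alpha>} g = integral {0..\<alpha>} (\<lambda>\<theta>. g (\<theta> + 2 * pi))"
    using integral_shift_real_ivl[of "2*pi" "2*pi" "2*pi + \<alpha>" g] by simp
  also have "\<dots> = integral {0..\<alpha>} g" by (simp add: per)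
  also have "integral {\<alpha>..2*pi} g + integral {0..\<alpha>} g = integral {0..2*pi} g"
    using \<alpha> gi Henstock_Kurzweil_Integration.integral_combine[of 0 \<alpha> "2*pi" g] by (simp add: add.commute)
  finally show ?thesis by (simp add: wmean_def g_def)
qed

text \<open>Rescaling the remainder term of Pizzetti's formula isolates the first power of \<open>|z|\<^sup>2\<close>
  that is not yet known to lie in \<open>V\<close>.\<close>

lemma norm_power_in_closed_subspace:
  assumes V: "closed_subspace V" and aff: "\<And>f a c. f \<in> V \<Longrightarrow> (\<lambda>z. f (a * z + c)) \<in> V"
    and F: "jet (2 * k) F" "F 0 0 \<in> V" and nz: "(jet_lap ^^ k) F 0 0 b \<noteq> 0"
    and low: "\<And>j. j < k \<Longrightarrow> (\<lambda>z. of_real (norm z) ^ (2 * j)) \<in> V"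
  shows "(\<lambda>z. of_real (norm z) ^ (2 * k)) \<in> V"
proof -
  have cF: "continuous_on UNIV (F 0 0)" using F by (intro jet_continuous) auto
  define M where "M = (\<lambda>z::complex. wmean (\<lambda>_. 1) (F 0 0) b (norm z))"
  have "continuous_on ({0..2*pi} \<times> UNIV) (\<lambda>(\<theta>, z). F 0 0 (b + z * cis \<theta>))"
    unfolding split_beta by (intro continuous_on_compose2[OF cF] continuous_intros) auto
  then have "(\<lambda>z. integral {0..2*pi} (\<lambda>\<theta>. F 0 0 (b + z * cis \<theta>))) \<in> V"
    using aff[OF F(2), of "cis _" b] by (intro closed_subspace_integral[OF V]) (simp_all add: add.commute mult.commute)
  then have M: "M \<in> V" by (simp add: wmean_rotate[OF cF] M_def)
  define c where "c = (\<lambda>j. mean_coeff j * (jet_lap ^^ j) F 0 0 b)"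
  have ck: "c k \<noteq> 0" using nz mean_coeff_nz by (simp add: c_def)
  have "(\<lambda>z. c k * of_real (norm z) ^ (2 * k)) \<in> ucl V"
  proof (rule uclI)
    fix K :: "complex set" and \<epsilon> :: real assume K: "compact K" "\<epsilon> > 0"
    obtain R where R: "R > 0" "\<And>z. z \<in> K \<Longrightarrow> norm z \<le> R"
      using compact_imp_bounded[OF K(1)] bounded_pos by metis
    define e where "e = \<epsilon> / (2 * R ^ (2 * k))"
    have e: "e > 0" "e * R ^ (2 * k) < \<epsilon>" using K R by (auto simp: e_def)
    obtain \<delta> where \<delta>: "\<delta> > 0" "\<And>s. 0 \<le> s \<Longrightarrow> s < \<delta> \<Longrightarrow>
        norm (wmean (\<lambda>_. 1) ((jet_lap ^^ k) F 0 0) b s - 2 * of_real pi * (jet_lap ^^ k) F 0 0 b) \<le> e"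
      using wmean_tendsto_center[of "(jet_lap ^^ k) F 0 0" e b] jet_continuous[OF jet_jet_lap_funpow[of 0 k F]] F e by auto
    \<comment> \<open>\<open>t\<close> shrinks \<open>K\<close> into the disc of radius
      \<open>\<delta>\<close>, where the remainder is at most
      \<open>e * (t * norm z) ^ (2 * k)\<close>. Dividing by \<open>t ^ (2 * k)\<close> in
      \<open>g\<close> leaves \<open>e * norm z ^ (2 * k)\<close>, which is small on all of
      \<open>K\<close>.\<close>
    define t where "t = \<delta> / (2 * R)"
    have t: "t > 0" "t * R < \<delta>" using \<delta> R by (auto simp: t_def field_simps)
    define g where "g = (\<lambda>z. inverse (of_real t ^ (2 * k)) * (M (of_real t * z + 0) - (\<Sum>j<k. (c j * of_real t ^ (2 * j)) * of_real (norm z) ^ (2 * j))))"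
    have "g \<in> V" unfolding g_def
      by (intro closed_subspaceD(4)[OF V] closed_subspaceD(6)[OF V] closed_subspace_sum[OF V] aff M low) auto
    moreover have "norm (g z - c k * of_real (norm z) ^ (2 * k)) < \<epsilon>" if z: "z \<in> K" for z
    proof -
      have tz: "t * norm z < \<delta>" using R(2)[OF z] t by (smt (verit) mult_left_mono)
      have "norm (wmean (\<lambda>_. 1) (F 0 0) b (t * norm z) - (\<Sum>j\<le>k. c j * of_real (t * norm z) ^ (2 * j))) \<le> e * (t * norm z) ^ (2 * k)"
        unfolding c_def using t tz \<delta>(2) by (intro pizzetti_remainder[OF F(1), where \<delta> = \<delta>]) auto
      then have "norm (M (of_real t * z + 0) - (\<Sum>j\<le>k. c j * of_real (t * norm z) ^ (2 * j))) \<le> e * (t * norm z) ^ (2 * k)"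
        using t by (simp add: M_def norm_mult)
      moreover have "g z - c k * of_real (norm z) ^ (2 * k)
          = (M (of_real t * z + 0) - (\<Sum>j\<le>k. c j * of_real (t * norm z) ^ (2 * j))) / of_real (t ^ (2 * k))"
        using t by (simp add: g_def lessThan_Suc_atMost[symmetric] power_mult_distrib field_simps mult.assoc)
      ultimately have "norm (g z - c k * of_real (norm z) ^ (2 * k)) \<le> e * (t * norm z) ^ (2 * k) / t ^ (2 * k)"
        using t by (simp only: norm_divide norm_of_real) (simp add: divide_right_mono)
      also have "\<dots> = e * norm z ^ (2 * k)" using t by (simp add: power_mult_distrib)
      also have "\<dots> \<le> e * R ^ (2 * k)" using e R(2)[OF z] by (intro mult_left_mono power_mono) auto
      finally show ?thesis using e by simp
    qed
    ultimately show "\<exists>g\<in>V. \<forall>z\<in>K. norm (g z - c k * of_real (norm z) ^ (2 * k)) < \<epsilon>" by blast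
  qed
  then have "(\<lambda>z. inverse (c k) * (c k * of_real (norm z) ^ (2 * k))) \<in> V"
    by (intro closed_subspaceD(4)[OF V] closed_subspaceD(1)[OF V])
  then show ?thesis using ck by (simp add: mult.assoc[symmetric])
qed


section \<open>Partial derivatives recovered from circular means\<close>

text \<open>Richardson extrapolation: each step cancels one further power.\<close>

lemma extrapolation_weights:
  "\<exists>\<gamma>::nat \<Rightarrow> real. \<forall>j\<le>k. (\<Sum>i\<le>k. \<gamma> i * (4 ^ i) ^ j) = (if j = 0 then 1 else 0)"
proof (induction k)
  case 0
  then show ?case by (intro exI[of _ "\<lambda>_. 1"]) auto
next
  case (Suc k)
  then obtain \<mu> :: "nat \<Rightarrow> real" where \<mu>: "\<And>j. j \<le> k \<Longrightarrow> (\<Sum>i\<le>k. \<mu> i * (4 ^ i) ^ j) = (if j = 0 then 1 else 0)" by blast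
  define c :: real where "c = 4 ^ Suc k"
  have "c \<ge> 4" unfolding c_def by simp
  then have c: "c - 1 \<noteq> 0" by simp
  \<comment> \<open>Shifting \<open>\<mu>\<close> by one index multiplies its \<open>j\<close>-th
    moment by \<open>4 ^ j\<close>. The combination thus multiplies the moment by
    \<open>(c - 4 ^ j) / (c - 1)\<close>, which is 1 at \<open>j = 0\<close> and 0 at
    \<open>j = Suc k\<close>.\<close>
  define \<gamma> where "\<gamma> i = (c * (if i \<le> k then \<mu> i else 0) - (if i = 0 then 0 else \<mu> (i - 1))) / (c - 1)" for i
  have "(\<Sum>i\<le>Suc k. \<gamma> i * (4 ^ i) ^ j) = (c - 4 ^ j) * (\<Sum>i\<le>k. \<mu> i * (4 ^ i) ^ j) / (c - 1)" for j
  proof -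
    have "(\<Sum>i\<le>Suc k. (if i = 0 then 0 else \<mu> (i - 1)) * (4 ^ i) ^ j) = 4 ^ j * (\<Sum>i\<le>k. \<mu> i * (4 ^ i) ^ j)"
      by (subst sum.atMost_Suc_shift) (simp add: sum_distrib_left power_mult_distrib mult_ac)
    moreover have "(\<Sum>i\<le>Suc k. (if i \<le> k then \<mu> i else 0) * (4 ^ i) ^ j) = (\<Sum>i\<le>k. \<mu> i * (4 ^ i) ^ j)"
      by simp
    moreover have "(\<Sum>i\<le>Suc k. \<gamma> i * (4 ^ i) ^ j) = (c * (\<Sum>i\<le>Suc k. (if i \<le> k then \<mu> i else 0) * (4 ^ i) ^ j)
        - (\<Sum>i\<le>Suc k. (if i = 0 then 0 else \<mu> (i - 1)) * (4 ^ i) ^ j)) / (c - 1)"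
      unfolding sum_distrib_left sum_subtractf[symmetric] sum_divide_distrib
      by (intro sum.cong refl) (simp add: \<gamma>_def algebra_simps diff_divide_distrib add_divide_distrib)
    ultimately show ?thesis by (simp add: left_diff_distrib)
  qed
  then have "\<forall>j\<le>Suc k. (\<Sum>i\<le>Suc k. \<gamma> i * (4 ^ i) ^ j) = (if j = 0 then 1 else 0)"
    using \<mu> c by (auto simp: le_Suc_eq c_def)
  then show ?case by blast
qed

text \<open>To leading order \<open>wmean cos f b r\<close> is \<open>pi * r\<close> times the
  x-derivative at \<open>b\<close>, and likewise \<open>sin\<close> gives the y-derivative; this
  explains the normalisation. The weights \<open>\<gamma>\<close> are to remove the higher even
  powers of the radius; the radii \<open>2 ^ i\<close> have the squares \<open>4 ^ i\<close>, the
  nodes of \<open>extrapolation_weights\<close>.\<close>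

definition deriv_op :: "(real \<Rightarrow> real) \<Rightarrow> (nat \<Rightarrow> real) \<Rightarrow> nat \<Rightarrow> (complex \<Rightarrow> complex) \<Rightarrow> complex \<Rightarrow> complex" where
  "deriv_op w \<gamma> k f b = (\<Sum>i\<le>k. of_real (\<gamma> i / (pi * 2 ^ i)) * wmean w f b (2 ^ i))"

text \<open>By \<open>pizzetti_exact\<close> the mean of \<open>G\<close> is a polynomial in the
  square of \<open>r\<close>. Integrating the assumed derivative from 0 shows that
  \<open>wmean w f b r / r\<close> is one too, with constant term \<open>pi * G 0 0 b\<close>, and
  the moments of \<open>\<gamma>\<close> pick out this term.\<close>

lemma deriv_op_eq:
  assumes G: "jet (2 * k) G" and z: "\<And>z. (jet_lap ^^ k) G 0 0 z = 0"
    and D: "\<And>r. ((\<lambda>r. of_real r * wmean w f b r) has_vector_derivative of_real r * wmean (\<lambda>_. 1) (G 0 0) b r) (at r)"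
    and \<gamma>: "\<And>j. j \<le> k \<Longrightarrow> (\<Sum>i\<le>k. \<gamma> i * (4 ^ i) ^ j) = (if j = 0 then 1 else 0)"
  shows "deriv_op w \<gamma> k f b = G 0 0 b"
proof -
  define c where "c = (\<lambda>j. mean_coeff j * (jet_lap ^^ j) G 0 0 b)"
  define v where "v = (\<lambda>r. of_real r * wmean w f b r - (\<Sum>j<k. c j * of_real r ^ Suc (2 * j + 1) / of_nat (Suc (2 * j + 1))))"
  have D': "(v has_vector_derivative of_real r * wmean (\<lambda>_. 1) (G 0 0) b r - (\<Sum>j<k. c j * of_real r ^ (2 * j + 1))) (at r)" for r
    unfolding v_def by (intro has_vector_derivative_diff D has_vector_derivative_sum has_vector_derivative_of_real_power)
  have v: "v r = 0" if "r \<ge> 0" for r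
  proof -
    have "norm (v r - v 0) \<le> r * 0"
      using pizzetti_exact[OF G z] 
      by (intro norm_diff_le_deriv_bound[OF D' that]) (simp add: c_def sum_distrib_left mult_ac)
    then show ?thesis by (simp add: v_def)
  qed
  have w: "wmean w f b (2 ^ i) / 2 ^ i = (\<Sum>j<k. c j / of_nat (2 * j + 2) * of_real ((4 ^ i) ^ j))" for i
  proof -
    have "of_real (2 ^ i) * wmean w f b (2 ^ i) = (\<Sum>j<k. c j * of_real (2 ^ i) ^ Suc (2 * j + 1) / of_nat (Suc (2 * j + 1)))"
      using v[of "2 ^ i"] by (simp add: v_def)
    then have "wmean w f b (2 ^ i) / 2 ^ i = (\<Sum>j<k. c j * of_real (2 ^ i) ^ Suc (2 * j + 1) / of_nat (Suc (2 * j + 1))) / (2 ^ i * 2 ^ i)"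
      by (simp add: field_simps)
    also have "\<dots> = (\<Sum>j<k. c j / of_nat (2 * j + 2) * of_real ((4 ^ i) ^ j))"
    proof -
      have "(2 ^ i) ^ (2 * j) = (((4::complex) ^ i) ^ j)" for j
      proof -
        have "((4::complex) ^ i) ^ j = ((2 ^ 2) ^ i) ^ j" by simp
        then show ?thesis by (simp only: power_mult[symmetric] mult_ac)
      qed
      then have "c j * of_real (2 ^ i) ^ Suc (2 * j + 1) = (2 ^ i * 2 ^ i) * (c j * (4 ^ i) ^ j)" for j
        by (simp add: mult_ac)
      then show ?thesis unfolding sum_divide_distrib by (intro sum.cong refl) simp
    qed
    finally show ?thesis .
  qed
  have "deriv_op w \<gamma> k f b = (\<Sum>i\<le>k. of_real (\<gamma> i / pi) * (wmean w f b (2 ^ i) / 2 ^ i))"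
    by (simp add: deriv_op_def)
  also have "\<dots> = (\<Sum>i\<le>k. \<Sum>j<k. c j / of_nat (2 * j + 2) / of_real pi * of_real (\<gamma> i * (4 ^ i) ^ j))"
    unfolding w sum_distrib_left by (intro sum.cong refl) (simp add: field_simps)
  also have "\<dots> = (\<Sum>j<k. c j / of_nat (2 * j + 2) / of_real pi * of_real (\<Sum>i\<le>k. \<gamma> i * (4 ^ i) ^ j))"
    by (subst sum.swap) (simp only: sum_distrib_left of_real_sum)
  also have "\<dots> = (\<Sum>j<k. if j = 0 then G 0 0 b else 0)"
    by (intro sum.cong refl) (auto simp: \<gamma> c_def mean_coeff_nz)
  \<comment> \<open>For \<open>k = 0\<close> the sum is empty, and then the hypothesis says that
    \<open>G 0 0\<close> itself vanishes.\<close>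
  also have "\<dots> = G 0 0 b" using z[of b] by (cases "k = 0") (auto simp: sum.delta)
  finally show ?thesis .
qed

text \<open>Every entry is an iterated derivative of the vanishing entry \<open>(0, 0)\<close>,
  reached first along \<open>i = 0\<close> and then in \<open>i\<close>. It follows that the shifted
  jets used for \<open>deriv_op_jet\<close> are annihilated as well.\<close>

lemma jet_lap_funpow_jet_zero:
  assumes F: "jet (M + 2 * k) F" and z: "\<And>z. (jet_lap ^^ k) F 0 0 z = 0"
  shows "i + j \<le> M \<Longrightarrow> (jet_lap ^^ k) F i j z = 0"
proof -
  let ?H = "(jet_lap ^^ k) F"
  have H: "jet M ?H" using jet_jet_lap_funpow[OF F] .
  have *: "j \<le> M \<Longrightarrow> ?H 0 j = (\<lambda>_. 0)" for j
  proof (induction j)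
    case (Suc j)
    have "has_dir_deriv \<i> (?H 0 j) (?H 0 (Suc j))" using H Suc.prems unfolding jet_def by simp
    then have "has_dir_deriv \<i> (\<lambda>_. 0) (?H 0 (Suc j))" using Suc by simp
    then show ?case by (intro ext has_dir_deriv_unique_zero)
  qed (use z in auto)
  have "i + j \<le> M \<Longrightarrow> ?H i j = (\<lambda>_. 0)" for i j
  proof (induction i)
    case (Suc i)
    have "has_dir_deriv 1 (?H i j) (?H (Suc i) j)" using H Suc.prems unfolding jet_def by simp
    then have "has_dir_deriv 1 (\<lambda>_. 0) (?H (Suc i) j)" using Suc by simp
    then show ?case by (intro ext has_dir_deriv_unique_zero)
  qed (use * in auto)
  then show "i + j \<le> M \<Longrightarrow> ?H i j z = 0" by simp
qed

lemma deriv_op_jet: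
  assumes F: "jet (Suc M + 2 * k) F" and z: "\<And>z. (jet_lap ^^ k) F 0 0 z = 0" and ij: "i + j \<le> M"
    and \<gamma>: "\<And>j. j \<le> k \<Longrightarrow> (\<Sum>i\<le>k. \<gamma> i * (4 ^ i) ^ j) = (if j = 0 then 1 else 0)"
  shows "deriv_op cos \<gamma> k (F i j) = F (Suc i) j" "deriv_op sin \<gamma> k (F i j) = F i (Suc j)"
proof -
  have C1: "C1 (F i j) (F (Suc i) j) (F i (Suc j))" using jet_mono[OF F, of "Suc M"] ij by (intro jet_C1) auto
  have js: "jet (2 * k) (\<lambda>p q. F (p + i') (q + j'))" if "i' + j' \<le> Suc M" for i' j'
    using F that unfolding jet_def by auto
  have zs: "(jet_lap ^^ k) (\<lambda>p q. F (p + i') (q + j')) 0 0 z = 0" if "i' + j' \<le> Suc M" for i' j' z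
    unfolding jet_lap_funpow_shift using jet_lap_funpow_jet_zero[OF F z] that by simp
  show "deriv_op cos \<gamma> k (F i j) = F (Suc i) j"
    using deriv_op_eq[OF js[of "Suc i" j] zs[of "Suc i" j] _ \<gamma>, of cos "F i j"] C1.wmean_cos_deriv[OF C1] ij
    by (auto simp: fun_eq_iff)
  show "deriv_op sin \<gamma> k (F i j) = F i (Suc j)"
    using deriv_op_eq[OF js[of i "Suc j"] zs[of i "Suc j"] _ \<gamma>, of sin "F i j"] C1.wmean_sin_deriv[OF C1] ij
    by (auto simp: fun_eq_iff)
qed

section \<open>Operators continuous for locally uniform convergence\<close>

lemma continuous_deriv_op:
  assumes "continuous_on UNIV f" "continuous_on UNIV w"
  shows "continuous_on UNIV (deriv_op w \<gamma> k f)"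
  unfolding deriv_op_def[abs_def] by (intro continuous_intros continuous_wmean assms)

text \<open>\<open>K'\<close> and \<open>\<delta>\<close> depend on the operator, \<open>K\<close>
  and \<open>\<epsilon>\<close> only, never on the functions. \<open>K'\<close> may exceed
  \<open>K\<close>, because circular means look beyond the point at which they are
  evaluated.\<close>

definition ucont_op :: "((complex \<Rightarrow> complex) \<Rightarrow> complex \<Rightarrow> complex) \<Rightarrow> bool" where
  "ucont_op T \<longleftrightarrow> (\<forall>K \<epsilon>. compact K \<longrightarrow> \<epsilon> > 0 \<longrightarrow> (\<exists>K' \<delta>. compact K' \<and> \<delta> > 0 \<and>
     (\<forall>f g. continuous_on UNIV f \<longrightarrow> continuous_on UNIV g \<longrightarrow> (\<forall>z\<in>K'. norm (f z - g z) < \<delta>) \<longrightarrow>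
       (\<forall>z\<in>K. norm (T f z - T g z) < \<epsilon>))))"

lemma ucont_opE:
  assumes "ucont_op T" "compact K" "\<epsilon> > 0"
  obtains K' \<delta> where "compact K'" "\<delta> > 0"
    "\<And>f g z. continuous_on UNIV f \<Longrightarrow> continuous_on UNIV g \<Longrightarrow> (\<And>z. z \<in> K' \<Longrightarrow> norm (f z - g z) < \<delta>) \<Longrightarrow>
       z \<in> K \<Longrightarrow> norm (T f z - T g z) < \<epsilon>"
proof -
  have "\<exists>K' \<delta>. compact K' \<and> \<delta> > 0 \<and>
     (\<forall>f g. continuous_on UNIV f \<longrightarrow> continuous_on UNIV g \<longrightarrow> (\<forall>z\<in>K'. norm (f z - g z) < \<delta>) \<longrightarrow>
       (\<forall>z\<in>K. norm (T f z - T g z) < \<epsilon>))"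
    using assms(1)[unfolded ucont_op_def, rule_format, OF assms(2,3)] .
  then show ?thesis by (elim exE conjE) (rule that, assumption+, simp)
qed

lemma ucont_opI:
  assumes "\<And>K \<epsilon>. compact K \<Longrightarrow> \<epsilon> > 0 \<Longrightarrow> \<exists>K' \<delta>. compact K' \<and> \<delta> > 0 \<and>
     (\<forall>f g. continuous_on UNIV f \<longrightarrow> continuous_on UNIV g \<longrightarrow> (\<forall>z\<in>K'. norm (f z - g z) < \<delta>) \<longrightarrow>
       (\<forall>z\<in>K. norm (T f z - T g z) < \<epsilon>))"
  shows "ucont_op T"
  unfolding ucont_op_def using assms by (intro allI impI)

lemma ucont_op_id: "ucont_op (\<lambda>f. f)"
  by (rule ucont_opI) auto

lemma ucont_op_comp:
  assumes T: "ucont_op T" and S: "ucont_op S" and c: "\<And>f. continuous_on UNIV f \<Longrightarrow> continuous_on UNIV (S f)"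
  shows "ucont_op (\<lambda>f. T (S f))"
proof (rule ucont_opI)
  fix K :: "complex set" and \<epsilon> :: real assume K: "compact K" "\<epsilon> > 0"
  obtain K' \<delta> where 1: "compact K'" "\<delta> > 0"
    "\<And>f g z. continuous_on UNIV f \<Longrightarrow> continuous_on UNIV g \<Longrightarrow> (\<And>z. z \<in> K' \<Longrightarrow> norm (f z - g z) < \<delta>) \<Longrightarrow>
       z \<in> K \<Longrightarrow> norm (T f z - T g z) < \<epsilon>" using ucont_opE[OF T K] by blast
  obtain K'' \<delta>' where 2: "compact K''" "\<delta>' > 0"
    "\<And>f g z. continuous_on UNIV f \<Longrightarrow> continuous_on UNIV g \<Longrightarrow> (\<And>z. z \<in> K'' \<Longrightarrow> norm (f z - g z) < \<delta>') \<Longrightarrow>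
       z \<in> K' \<Longrightarrow> norm (S f z - S g z) < \<delta>" using ucont_opE[OF S 1(1,2)] by blast
  show "\<exists>K' \<delta>. compact K' \<and> \<delta> > 0 \<and> (\<forall>f g. continuous_on UNIV f \<longrightarrow> continuous_on UNIV g \<longrightarrow>
      (\<forall>z\<in>K'. norm (f z - g z) < \<delta>) \<longrightarrow> (\<forall>z\<in>K. norm (T (S f) z - T (S g) z) < \<epsilon>))"
    by (rule exI[of _ K''], rule exI[of _ \<delta>']) (auto intro!: 1 2 c)
qed

lemma ucont_op_add:
  assumes T: "ucont_op T" and S: "ucont_op S"
  shows "ucont_op (\<lambda>f z. T f z + S f z)"
proof (rule ucont_opI)
  fix K :: "complex set" and \<epsilon> :: real assume K: "compact K" "\<epsilon> > 0"
  then have e: "\<epsilon>/2 > 0" by simp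
  obtain K' \<delta> where 1: "compact K'" "\<delta> > 0"
    "\<And>f g z. continuous_on UNIV f \<Longrightarrow> continuous_on UNIV g \<Longrightarrow> (\<And>z. z \<in> K' \<Longrightarrow> norm (f z - g z) < \<delta>) \<Longrightarrow>
       z \<in> K \<Longrightarrow> norm (T f z - T g z) < \<epsilon>/2" using ucont_opE[OF T K(1) e] by blast
  obtain K'' \<delta>' where 2: "compact K''" "\<delta>' > 0"
    "\<And>f g z. continuous_on UNIV f \<Longrightarrow> continuous_on UNIV g \<Longrightarrow> (\<And>z. z \<in> K'' \<Longrightarrow> norm (f z - g z) < \<delta>') \<Longrightarrow>
       z \<in> K \<Longrightarrow> norm (S f z - S g z) < \<epsilon>/2" using ucont_opE[OF S K(1) e] by blast
  have "norm (T f z + S f z - (T g z + S g z)) < \<epsilon>"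
    if "continuous_on UNIV f" "continuous_on UNIV g" "\<forall>z\<in>K' \<union> K''. norm (f z - g z) < min \<delta> \<delta>'" "z \<in> K" for f g z
  proof -
    have "norm (T f z - T g z) < \<epsilon>/2" "norm (S f z - S g z) < \<epsilon>/2"
      using 1(3)[OF that(1,2) _ that(4)] 2(3)[OF that(1,2) _ that(4)] that(3) by auto
    then have "norm ((T f z - T g z) + (S f z - S g z)) < \<epsilon>/2 + \<epsilon>/2" by (rule norm_add_less)
    then show ?thesis by (simp add: algebra_simps)
  qed
  then show "\<exists>K' \<delta>. compact K' \<and> \<delta> > 0 \<and> (\<forall>f g. continuous_on UNIV f \<longrightarrow> continuous_on UNIV g \<longrightarrow>
      (\<forall>z\<in>K'. norm (f z - g z) < \<delta>) \<longrightarrow> (\<forall>z\<in>K. norm (T f z + S f z - (T g z + S g z)) < \<epsilon>))"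
    using 1 2 by (intro exI[of _ "K' \<union> K''"] exI[of _ "min \<delta> \<delta>'"]) auto
qed

lemma ucont_op_deriv_op:
  assumes w: "continuous_on UNIV w" "\<And>\<theta>. \<bar>w \<theta>\<bar> \<le> 1"
  shows "ucont_op (deriv_op w \<gamma> k)"
proof (rule ucont_opI)
  fix K :: "complex set" and \<epsilon> :: real assume K: "compact K" "\<epsilon> > 0"
  define K' where "K' = {x + y | x y. x \<in> K \<and> y \<in> cball (0::complex) (2 ^ k)}"
  have K': "compact K'" unfolding K'_def by (intro compact_sums K compact_cball)
  \<comment> \<open>\<open>C\<close> bounds the operator norm: a mean whose weight is at most 1 in
    modulus is bounded by \<open>2 * pi\<close> times the supremum over its circle. The largest
    circle has radius \<open>2 ^ k\<close>, hence the choice of \<open>K'\<close>.\<close>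
  define C where "C = (\<Sum>i\<le>k. \<bar>\<gamma> i / (pi * 2 ^ i)\<bar> * (2 * pi))"
  have C: "C \<ge> 0" unfolding C_def by (intro sum_nonneg) auto
  define \<delta> where "\<delta> = \<epsilon> / (C + 1)"
  have \<delta>: "\<delta> > 0" "C * \<delta> < \<epsilon>" using C K by (auto simp: \<delta>_def field_simps)
  have "norm (deriv_op w \<gamma> k f b - deriv_op w \<gamma> k g b) < \<epsilon>"
    if f: "continuous_on UNIV f" and g: "continuous_on UNIV g" and fg: "\<forall>z\<in>K'. norm (f z - g z) < \<delta>" and b: "b \<in> K" for f g b
  proof -
    have "norm (deriv_op w \<gamma> k f b - deriv_op w \<gamma> k g b)
        = norm (\<Sum>i\<le>k. of_real (\<gamma> i / (pi * 2 ^ i)) * wmean w (\<lambda>z. f z - g z) b (2 ^ i))"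
      unfolding deriv_op_def sum_subtractf[symmetric] right_diff_distrib[symmetric] wmean_diff[OF f g w(1)] ..
    also have "\<dots> \<le> (\<Sum>i\<le>k. \<bar>\<gamma> i / (pi * 2 ^ i)\<bar> * (2 * pi * \<delta>))"
    proof (intro sum_norm_le)
      fix i assume i: "i \<in> {..k}"
      have "norm (wmean w (\<lambda>z. f z - g z) b (2 ^ i)) \<le> 2 * pi * \<delta>"
      proof (rule wmean_bound)
        fix \<theta>
        have "norm (of_real (2 ^ i) * cis \<theta>) \<le> 2 ^ k" using i by (simp add: norm_mult norm_power)
        then have "b + of_real (2 ^ i) * cis \<theta> \<in> K'" using b unfolding K'_def by force
        then show "norm (f (b + of_real (2 ^ i) * cis \<theta>) - g (b + of_real (2 ^ i) * cis \<theta>)) \<le> \<delta>"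
          using fg less_imp_le by blast
      qed (auto intro!: continuous_intros f g w)
      then show "norm (of_real (\<gamma> i / (pi * 2 ^ i)) * wmean w (\<lambda>z. f z - g z) b (2 ^ i)) \<le> \<bar>\<gamma> i / (pi * 2 ^ i)\<bar> * (2 * pi * \<delta>)"
        unfolding norm_mult norm_of_real by (intro mult_left_mono) auto
    qed
    also have "\<dots> = C * \<delta>" by (simp add: C_def sum_distrib_right mult.assoc)
    finally show ?thesis using \<delta> by simp
  qed
  then show "\<exists>K' \<delta>. compact K' \<and> \<delta> > 0 \<and> (\<forall>f g. continuous_on UNIV f \<longrightarrow> continuous_on UNIV g \<longrightarrow>
      (\<forall>z\<in>K'. norm (f z - g z) < \<delta>) \<longrightarrow> (\<forall>z\<in>K. norm (deriv_op w \<gamma> k f z - deriv_op w \<gamma> k g z) < \<epsilon>))"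
    using K' \<delta>(1) by (intro exI[of _ K'] exI[of _ \<delta>]) auto
qed


section \<open>Limits of polyharmonic functions\<close>

text \<open>The integral form of the derivative relation involves the functions only on a segment,
  so it passes to uniform limits; \<open>has_dir_derivI_integral\<close> then returns to
  derivatives.\<close>

lemma has_dir_deriv_limit:
  assumes f: "continuous_on UNIV f" and f': "continuous_on UNIV f'"
    and lim: "\<And>K \<epsilon>. compact K \<Longrightarrow> \<epsilon> > 0 \<Longrightarrow> \<exists>g g'. has_dir_deriv e g g' \<and> continuous_on UNIV g' \<and>
      (\<forall>z\<in>K. norm (g z - f z) < \<epsilon>) \<and> (\<forall>z\<in>K. norm (g' z - f' z) < \<epsilon>)"
  shows "has_dir_deriv e f f'"
proof (rule has_dir_derivI_integral[OF f'])
  fix z and t :: real assume t: "0 \<le> t"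
  define d where "d = integral {0..t} (\<lambda>s. f' (z + e * of_real s)) - (f (z + e * of_real t) - f z)"
  define K where "K = (\<lambda>s. z + e * of_real s) ` {0..t}"
  have K: "compact K" unfolding K_def by (intro compact_continuous_image continuous_intros) auto
  have "norm d \<le> 0"
  proof (rule field_le_epsilon)
    fix \<epsilon> :: real assume "\<epsilon> > 0"
    \<comment> \<open>The divisor \<open>t + 2\<close> collects one error \<open>\<eta>\<close> per
      unit of length from the integral and one from each endpoint.\<close>
    define \<eta> where "\<eta> = \<epsilon> / (t + 2)"
    have "\<eta> * (t + 2) = \<epsilon>" using t by (simp add: \<eta>_def)
    then have \<eta>: "\<eta> > 0" "\<eta> * t + \<eta> + \<eta> = \<epsilon>"
      using \<open>\<epsilon> > 0\<close> t by (simp add: \<eta>_def, simp add: algebra_simps)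
    obtain g g' where g: "has_dir_deriv e g g'" "continuous_on UNIV g'"
      "\<And>z. z \<in> K \<Longrightarrow> norm (g z - f z) < \<eta>" "\<And>z. z \<in> K \<Longrightarrow> norm (g' z - f' z) < \<eta>"
      using lim[OF K \<eta>(1)] by blast
    have eq: "integral {0..t} (\<lambda>s. g' (z + e * of_real s)) = g (z + e * of_real t) - g z"
      by (rule has_dir_deriv_eq_integral[OF g(1) t])
    have "norm (g' (z + e * of_real s) - f' (z + e * of_real s)) \<le> \<eta>" if "s \<in> {0..t}" for s
    proof -
      have "z + e * of_real s \<in> K" unfolding K_def using that by (rule imageI)
      then show ?thesis using g(4) less_imp_le by blast
    qed
    then have "norm (integral {0..t} (\<lambda>s. g' (z + e * of_real s) - f' (z + e * of_real s))) \<le> \<eta> * (t - 0)"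
      using t by (intro integral_bound continuous_intros continuous_line f' g(2)) auto
    moreover have "integral {0..t} (\<lambda>s. g' (z + e * of_real s) - f' (z + e * of_real s))
       = integral {0..t} (\<lambda>s. g' (z + e * of_real s)) - integral {0..t} (\<lambda>s. f' (z + e * of_real s))"
      by (intro integral_diff integrable_continuous_real continuous_line f' g(2))
    ultimately have 1: "norm (g (z + e * of_real t) - g z - integral {0..t} (\<lambda>s. f' (z + e * of_real s))) \<le> \<eta> * t"
      using eq by simp
    have "z + e * of_real t \<in> K" "z + e * of_real 0 \<in> K" using t unfolding K_def by (auto simp del: of_real_0)
    then have 2: "norm (g (z + e * of_real t) - f (z + e * of_real t)) \<le> \<eta>" "norm (g z - f z) \<le> \<eta>"
      using g(3)[of "z + e * of_real t"] g(3)[of z] by auto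
    have "d = - (g (z + e * of_real t) - g z - integral {0..t} (\<lambda>s. f' (z + e * of_real s)))
        + (g (z + e * of_real t) - f (z + e * of_real t)) - (g z - f z)"
      by (simp add: d_def)
    also have "norm \<dots> \<le> \<eta> * t + \<eta> + \<eta>"
    proof -
      have "norm (- x + y - w) \<le> norm x + norm y + norm w" for x y w :: complex
        using norm_triangle_ineq4[of "- x + y" w] norm_triangle_ineq[of "- x" y] by simp
      then show ?thesis using 1 2 by (rule order_trans[OF _ add_mono[OF add_mono]])
    qed
    finally show "norm d \<le> 0 + \<epsilon>" using \<eta> by simp
  qed
  then show "integral {0..t} (\<lambda>s. f' (z + e * of_real s)) = f (z + e * of_real t) - f z"
    by (simp add: d_def)
qed

lemma px_eq: "has_dir_deriv 1 f f' \<Longrightarrow> px f = f'"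
  by (auto simp: has_dir_deriv_def px_def fun_eq_iff intro!: vector_derivative_at)

lemma py_eq: "has_dir_deriv \<i> f f' \<Longrightarrow> py f = f'"
  by (auto simp: has_dir_deriv_def py_def fun_eq_iff intro!: vector_derivative_at)

text \<open>The array already commutes, so only the numbers of x- and y-derivatives in the list
  matter; \<open>True\<close> stands for y.\<close>

lemma iter_partial_jet:
  assumes "\<And>N. jet N G"
  shows "iter_partial ds (G 0 0) = G (length (filter Not ds)) (length (filter (\<lambda>d. d) ds))"
proof (induction ds)
  case (Cons d ds)
  have "has_dir_deriv 1 (G i j) (G (Suc i) j)" "has_dir_deriv \<i> (G i j) (G i (Suc j))" for i j
    using assms[of "Suc (i + j)"] by (auto simp: jet_def)
  then show ?case using Cons by (auto simp: iter_partial_def px_eq py_eq)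
qed (simp add: iter_partial_def)

lemma polyharmonic_jet:
  assumes G: "\<And>N. jet N G" and z: "\<And>z. (jet_lap ^^ k) G 0 0 z = 0"
  shows "polyharmonic (G 0 0)"
proof -
  have D: "has_dir_deriv 1 (H i j) (H (Suc i) j)" "has_dir_deriv \<i> (H i j) (H i (Suc j))" if "\<And>N. jet N H" for H i j
    using that[of "Suc (i + j)"] by (auto simp: jet_def)
  have smooth: "smooth_C (G 0 0)"
    unfolding smooth_C_def iter_partial_jet[of G, OF G]
  proof (intro allI conjI)
    fix ds z
    let ?i = "length (filter Not ds)" and ?j = "length (filter (\<lambda>d. d) ds)"
    show "continuous_on UNIV (G ?i ?j)" using G[of "?i + ?j"] by (rule jet_continuous) simp
    show "(\<lambda>t::real. G ?i ?j (z + of_real t)) differentiable at 0"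
      using D(1)[of G ?i ?j, OF G] by (auto simp: has_dir_deriv_def intro: differentiableI_vector)
    show "(\<lambda>t::real. G ?i ?j (z + \<i> * of_real t)) differentiable at 0"
      using D(2)[of G ?i ?j, OF G] by (auto simp: has_dir_deriv_def intro: differentiableI_vector)
  qed
  have L: "laplacian (H 0 0) = jet_lap H 0 0" if "\<And>N. jet N H" for H
    using px_eq[OF D(1)[of H, OF that]] py_eq[OF D(2)[of H, OF that]]
    by (simp add: laplacian_def jet_lap_def numeral_2_eq_2)
  have "(laplacian ^^ m) (G 0 0) = (jet_lap ^^ m) G 0 0" for m
  proof (induction m)
    case (Suc m)
    have H: "jet N ((jet_lap ^^ m) G)" for N using jet_jet_lap_funpow[OF G] .
    show ?case using L[OF H] Suc by simp
  qed simp
  then show ?thesis unfolding polyharmonic_def using z smooth by (intro conjI exI[of _ k]) auto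
qed

text \<open>Each Laplacian reads two orders further. Needed because the arrays compared in the limit
  argument agree only up to a finite order.\<close>

lemma jet_lap_funpow_cong:
  assumes "\<And>i j. i + j \<le> M + 2 * k \<Longrightarrow> F i j = H i j" "i + j \<le> M"
  shows "(jet_lap ^^ k) F i j = (jet_lap ^^ k) H i j"
  using assms
proof (induction k arbitrary: M i j)
  case (Suc k)
  then show ?case using Suc.IH[of "M + 2" "i + 2" j] Suc.IH[of "M + 2" i "j + 2"] by (simp add: jet_lap_def)
qed auto

text \<open>A Weyl-type lemma. On smooth functions annihilated by the \<open>k\<close>-th power of the Laplacian, partial
  differentiation coincides with the operators \<open>deriv_op\<close>, which are continuous for locally
  uniform convergence; hence all partial derivatives pass to the limit.\<close>

lemma polyharmonic_limit:
  assumes \<rho>: "continuous_on UNIV \<rho>"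
    and lim: "\<And>N. \<rho> \<in> ucl {F 0 0 | F. jet N F \<and> (\<forall>z. (jet_lap ^^ k) F 0 0 z = 0)}"
  shows "polyharmonic \<rho>"
proof -
  obtain \<gamma> :: "nat \<Rightarrow> real" where \<gamma>: "\<And>j. j \<le> k \<Longrightarrow> (\<Sum>i\<le>k. \<gamma> i * (4 ^ i) ^ j) = (if j = 0 then 1 else 0)"
    using extrapolation_weights[of k] by blast
  define Dx where "Dx = deriv_op cos \<gamma> k"
  define Dy where "Dy = deriv_op sin \<gamma> k"
  \<comment> \<open>\<open>T \<rho>\<close> is the candidate for the array of partial derivatives of
    \<open>\<rho>\<close>; it can be formed before any differentiability is known.\<close>
  define T where "T = (\<lambda>f i j. (Dx ^^ i) ((Dy ^^ j) f))"
  have cx: "continuous_on UNIV ((Dx ^^ i) f)" if "continuous_on UNIV f" for i f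
    by (induction i) (simp_all add: that Dx_def continuous_deriv_op continuous_on_cos)
  have cy: "continuous_on UNIV ((Dy ^^ i) f)" if "continuous_on UNIV f" for i f
    by (induction i) (simp_all add: that Dy_def continuous_deriv_op continuous_on_sin)
  have ux: "ucont_op (\<lambda>f. (Dx ^^ i) f)" for i
  proof (induction i)
    case (Suc i)
    have "ucont_op (\<lambda>f. Dx ((Dx ^^ i) f))"
      by (rule ucont_op_comp[OF _ Suc cx]) (auto simp: Dx_def intro!: ucont_op_deriv_op continuous_intros)
    then show ?case by simp
  qed (simp add: ucont_op_id)
  have uy: "ucont_op (\<lambda>f. (Dy ^^ i) f)" for i
  proof (induction i)
    case (Suc i)
    have "ucont_op (\<lambda>f. Dy ((Dy ^^ i) f))"
      by (rule ucont_op_comp[OF _ Suc cy]) (auto simp: Dy_def intro!: ucont_op_deriv_op continuous_intros)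
    then show ?case by simp
  qed (simp add: ucont_op_id)
  have uT: "ucont_op (\<lambda>f. T f i j)" for i j
    unfolding T_def by (rule ucont_op_comp[OF ux uy cy])
  have uL: "ucont_op (\<lambda>f. (jet_lap ^^ m) (T f) i j)" for m i j
  proof (induction m arbitrary: i j)
    case (Suc m)
    then show ?case using ucont_op_add[OF Suc[of "i + 2" j] Suc[of i "j + 2"]] by (simp add: jet_lap_def)
  qed (simp add: uT)
  \<comment> \<open>The candidate is correct on annihilated jets. Starting from
    \<open>F 0 0\<close>, the y-derivatives are replaced by operators first, then the
    x-derivatives.\<close>
  have FT: "F i j = T (F 0 0) i j"
    if F: "jet (M + 2 * k) F" "\<forall>z. (jet_lap ^^ k) F 0 0 z = 0" and ij: "i + j \<le> M" for M F i j
  proof -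
    have j: "j \<le> M \<Longrightarrow> F 0 j = (Dy ^^ j) (F 0 0)" for j
    proof (induction j)
      case (Suc j)
      then obtain M' where M': "M = Suc M'" "j \<le> M'" by (cases M) auto
      show ?case using deriv_op_jet(2)[of M' k F 0 j \<gamma>] F M' \<gamma> Suc by (simp add: Dy_def)
    qed simp
    have "i + j \<le> M \<Longrightarrow> F i j = T (F 0 0) i j" for i
    proof (induction i)
      case (Suc i)
      then obtain M' where M': "M = Suc M'" "i + j \<le> M'" by (cases M) auto
      show ?case using deriv_op_jet(1)[of M' k F i j \<gamma>] F M' \<gamma> Suc by (simp add: Dx_def T_def)
    next
      case 0
      then show ?case using j[of j] by (simp add: T_def)
    qed
    then show ?thesis using ij by blast
  qed
  \<comment> \<open>Two operators are handled at once, since a function and its derivative must be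
    approximated by entries of the same jet.\<close>
  have approx: "\<exists>F. jet (M + 2 * k) F \<and> (\<forall>z. (jet_lap ^^ k) F 0 0 z = 0) \<and>
      (\<forall>z\<in>K. norm (T1 (F 0 0) z - T1 \<rho> z) < \<epsilon>) \<and> (\<forall>z\<in>K. norm (T2 (F 0 0) z - T2 \<rho> z) < \<epsilon>)"
    if K: "compact K" "\<epsilon> > 0" and T12: "ucont_op T1" "ucont_op T2" for M K \<epsilon> T1 T2
  proof -
    obtain K1 \<delta>1 where 1: "compact K1" "\<delta>1 > 0"
      "\<And>f g z. continuous_on UNIV f \<Longrightarrow> continuous_on UNIV g \<Longrightarrow> (\<And>z. z \<in> K1 \<Longrightarrow> norm (f z - g z) < \<delta>1) \<Longrightarrow>
         z \<in> K \<Longrightarrow> norm (T1 f z - T1 g z) < \<epsilon>" using ucont_opE[OF T12(1) K] by blast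
    obtain K2 \<delta>2 where 2: "compact K2" "\<delta>2 > 0"
      "\<And>f g z. continuous_on UNIV f \<Longrightarrow> continuous_on UNIV g \<Longrightarrow> (\<And>z. z \<in> K2 \<Longrightarrow> norm (f z - g z) < \<delta>2) \<Longrightarrow>
         z \<in> K \<Longrightarrow> norm (T2 f z - T2 g z) < \<epsilon>" using ucont_opE[OF T12(2) K] by blast
    obtain g where g: "g \<in> {F 0 0 | F. jet (M + 2 * k) F \<and> (\<forall>z. (jet_lap ^^ k) F 0 0 z = 0)}"
      "\<And>z. z \<in> K1 \<union> K2 \<Longrightarrow> norm (g z - \<rho> z) < min \<delta>1 \<delta>2"
      using uclE[OF lim[of "M + 2 * k"] compact_Un[OF 1(1) 2(1)], of "min \<delta>1 \<delta>2"] 1(2) 2(2)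
      unfolding min_less_iff_conj by blast
    then obtain F where F: "jet (M + 2 * k) F" "\<forall>z. (jet_lap ^^ k) F 0 0 z = 0" "g = F 0 0" by blast
    have cF: "continuous_on UNIV (F 0 0)" using F(1) by (rule jet_continuous) simp
    have "norm (T1 (F 0 0) z - T1 \<rho> z) < \<epsilon>" "norm (T2 (F 0 0) z - T2 \<rho> z) < \<epsilon>" if "z \<in> K" for z
      using 1(3)[OF cF \<rho> _ that] 2(3)[OF cF \<rho> _ that] g(2) F(3) by auto
    then show ?thesis using F by blast
  qed
  have cT: "continuous_on UNIV (T \<rho> i j)" for i j unfolding T_def by (intro cx cy \<rho>)
  have "jet N (T \<rho>)" for N
    unfolding jet_def
  proof (intro conjI allI impI cT)
    fix i j
    show "has_dir_deriv 1 (T \<rho> i j) (T \<rho> (Suc i) j)"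
    proof (rule has_dir_deriv_limit[OF cT cT])
      fix K :: "complex set" and \<epsilon> :: real assume K: "compact K" "\<epsilon> > 0"
      obtain F where F: "jet (Suc (i + j) + 2 * k) F" "\<forall>z. (jet_lap ^^ k) F 0 0 z = 0"
        "\<forall>z\<in>K. norm (T (F 0 0) i j z - T \<rho> i j z) < \<epsilon>" "\<forall>z\<in>K. norm (T (F 0 0) (Suc i) j z - T \<rho> (Suc i) j z) < \<epsilon>"
        using approx[OF K uT uT, of "Suc (i + j)" i j "Suc i" j] by blast
      have "has_dir_deriv 1 (F i j) (F (Suc i) j)" "continuous_on UNIV (F (Suc i) j)"
        using F(1) by (auto simp: jet_def)
      then show "\<exists>g g'. has_dir_deriv 1 g g' \<and> continuous_on UNIV g' \<and>
          (\<forall>z\<in>K. norm (g z - T \<rho> i j z) < \<epsilon>) \<and> (\<forall>z\<in>K. norm (g' z - T \<rho> (Suc i) j z) < \<epsilon>)"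
        using F(3,4) FT[OF F(1,2), of i j] FT[OF F(1,2), of "Suc i" j]
        by (intro exI[of _ "F i j"] exI[of _ "F (Suc i) j"]) auto
    qed
    show "has_dir_deriv \<i> (T \<rho> i j) (T \<rho> i (Suc j))"
    proof (rule has_dir_deriv_limit[OF cT cT])
      fix K :: "complex set" and \<epsilon> :: real assume K: "compact K" "\<epsilon> > 0"
      obtain F where F: "jet (Suc (i + j) + 2 * k) F" "\<forall>z. (jet_lap ^^ k) F 0 0 z = 0"
        "\<forall>z\<in>K. norm (T (F 0 0) i j z - T \<rho> i j z) < \<epsilon>" "\<forall>z\<in>K. norm (T (F 0 0) i (Suc j) z - T \<rho> i (Suc j) z) < \<epsilon>"
        using approx[OF K uT uT, of "Suc (i + j)" i j i "Suc j"] by blast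
      have "has_dir_deriv \<i> (F i j) (F i (Suc j))" "continuous_on UNIV (F i (Suc j))"
        using F(1) by (auto simp: jet_def)
      then show "\<exists>g g'. has_dir_deriv \<i> g g' \<and> continuous_on UNIV g' \<and>
          (\<forall>z\<in>K. norm (g z - T \<rho> i j z) < \<epsilon>) \<and> (\<forall>z\<in>K. norm (g' z - T \<rho> i (Suc j) z) < \<epsilon>)"
        using F(3,4) FT[OF F(1,2), of i j] FT[OF F(1,2), of i "Suc j"]
        by (intro exI[of _ "F i j"] exI[of _ "F i (Suc j)"]) auto
    qed
  qed
  moreover have "(jet_lap ^^ k) (T \<rho>) 0 0 z = 0" for z
  proof -
    have "norm ((jet_lap ^^ k) (T \<rho>) 0 0 z) \<le> 0"
    proof (rule field_le_epsilon)
      fix \<epsilon> :: real assume "\<epsilon> > 0"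
      \<comment> \<open>One \<open>2 * k\<close> is the order read by the iterated Laplacian at
        \<open>(0, 0)\<close>; the other is the surplus order that \<open>FT\<close> asks
        for.\<close>
      then obtain F where F: "jet (2 * k + 2 * k) F" "\<forall>z. (jet_lap ^^ k) F 0 0 z = 0"
        "norm ((jet_lap ^^ k) (T (F 0 0)) 0 0 z - (jet_lap ^^ k) (T \<rho>) 0 0 z) < \<epsilon>"
        using approx[of "{z}" \<epsilon>, OF compact_sing _ uL uL, of "2 * k" k 0 0 k 0 0] by blast
      have "(jet_lap ^^ k) (T (F 0 0)) 0 0 = (jet_lap ^^ k) F 0 0"
        by (rule jet_lap_funpow_cong[of 0]) (simp_all add: FT[OF F(1,2), symmetric])
      then show "norm ((jet_lap ^^ k) (T \<rho>) 0 0 z) \<le> 0 + \<epsilon>" using F(2,3) by simp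
    qed
    then show ?thesis by simp
  qed
  moreover have "T \<rho> 0 0 = \<rho>" by (simp add: T_def)
  ultimately show ?thesis using polyharmonic_jet[of "T \<rho>" k] by simp
qed

lemma norm_powers_in_closed_subspace:
  assumes V: "closed_subspace V" and aff: "\<And>f a c. f \<in> V \<Longrightarrow> (\<lambda>z. f (a * z + c)) \<in> V"
    and \<rho>: "\<rho> \<in> V" "continuous_on UNIV \<rho>" "\<not> polyharmonic \<rho>"
  shows "(\<lambda>z. of_real (norm z) ^ (2 * k)) \<in> V"
proof (induction k rule: less_induct)
  case (less k)
  show ?case
  proof (rule ccontr)
    assume nV: "(\<lambda>z. of_real (norm z) ^ (2 * k)) \<notin> V"
    have zero: "(jet_lap ^^ k) F 0 0 z = 0" if "jet (2 * k) F" "F 0 0 \<in> V" for F z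
      using norm_power_in_closed_subspace[OF V aff that _ less] nV by blast
    have tr: "f \<in> V \<Longrightarrow> (\<lambda>z. f (z + c)) \<in> V" for f c using aff[of f 1 c] by simp
    have "\<rho> \<in> ucl {F 0 0 | F. jet N F \<and> (\<forall>z. (jet_lap ^^ k) F 0 0 z = 0)}" for N
    proof (rule ucl_mono[OF _ jet_dense[OF V tr \<rho>(1,2)]])
      show "{F 0 0 | F. jet (N + 2 * k) F \<and> F 0 0 \<in> V} \<subseteq> {F 0 0 | F. jet N F \<and> (\<forall>z. (jet_lap ^^ k) F 0 0 z = 0)}"
        using zero jet_mono[of "N + 2 * k" _ "2 * k"] jet_mono[of "N + 2 * k" _ N] by fastforce
    qed
    then show False using polyharmonic_limit[OF \<rho>(2)] \<rho>(3) by blast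
  qed
qed


section \<open>Density of shallow networks\<close>

lemma ucl_compose:
  assumes f: "f \<in> ucl S" and h: "continuous_on UNIV h" and S: "\<And>g. g \<in> S \<Longrightarrow> (\<lambda>z. g (h z)) \<in> S'"
  shows "(\<lambda>z. f (h z)) \<in> ucl S'"
proof (rule uclI)
  fix K :: "'c set" and \<epsilon> :: real assume K: "compact K" "\<epsilon> > 0"
  have "compact (h ` K)" using K h by (intro compact_continuous_image continuous_on_subset[OF h]) auto
  then obtain g where "g \<in> S" "\<And>z. z \<in> h ` K \<Longrightarrow> norm (g z - f z) < \<epsilon>" using uclE[OF f _ K(2)] by blast
  then show "\<exists>g\<in>S'. \<forall>z\<in>K. norm (g z - f (h z)) < \<epsilon>" by (intro bexI[OF _ S]) auto
qed

lemma lin_hull_compose: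
  assumes "g \<in> lin_hull S" and S: "\<And>f. f \<in> S \<Longrightarrow> (\<lambda>z. f (h z)) \<in> S'"
  shows "(\<lambda>z. g (h z)) \<in> lin_hull S'"
  using assms(1) by induction (auto intro: lin_hull.intros S)

lemma lin_hull_mult:
  assumes S: "\<And>f g. f \<in> S \<Longrightarrow> g \<in> S \<Longrightarrow> (\<lambda>z. f z * g z) \<in> S"
    and f: "f \<in> lin_hull S" and g: "g \<in> lin_hull S"
  shows "(\<lambda>z. f z * g z) \<in> lin_hull S"
proof -
  have *: "(\<lambda>z. s z * g z) \<in> lin_hull S" if "s \<in> S" for s
    using g
  proof induction
    case (step g f c)
    have "(\<lambda>z. c * (s z * f z) + s z * g z) \<in> lin_hull S"
      using lin_hull.step[OF step.IH S[OF that step.hyps(2)], of c] .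
    then show ?case by (simp add: algebra_simps)
  qed (simp add: lin_hull.zero)
  show ?thesis using f
  proof induction
    case (step h s c)
    have "(\<lambda>z. c * (s z * g z) + h z * g z) \<in> lin_hull S"
      using lin_hull_comb[OF *[OF step.hyps(2)] step.IH, of c] .
    then show ?case by (simp add: algebra_simps)
  qed (simp add: lin_hull.zero)
qed

text \<open>Polynomials in the square of \<open>norm z\<close> are combinations of the given powers,
  and Weierstrass approximation of \<open>G\<close> on the compact image of \<open>K\<close> does
  the rest.\<close>

lemma radial_in_closed_subspace:
  fixes V :: "(complex \<Rightarrow> complex) set"
  assumes V: "closed_subspace V" and pow: "\<And>k. (\<lambda>z. of_real (norm z) ^ (2 * k)) \<in> V"
    and G: "continuous_on UNIV (G :: real \<Rightarrow> real)"
  shows "(\<lambda>z. of_real (G ((norm z)\<^sup>2))) \<in> V"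
proof -
  have "(\<lambda>z. of_real (G ((norm z)\<^sup>2))) \<in> ucl V"
  proof (rule uclI)
    fix K :: "complex set" and \<epsilon> :: real assume K: "compact K" "\<epsilon> > 0"
    have "compact ((\<lambda>z. (norm z)\<^sup>2) ` K)" by (intro compact_continuous_image continuous_intros K)
    then obtain p where p: "real_polynomial_function p" "\<And>x. x \<in> (\<lambda>z. (norm z)\<^sup>2) ` K \<Longrightarrow> \<bar>G x - p x\<bar> < \<epsilon>"
      using Stone_Weierstrass_real_polynomial_function[OF _ continuous_on_subset[OF G subset_UNIV] K(2)] by blast
    obtain a n where pn: "p = (\<lambda>x. \<Sum>i\<le>n::nat. a i * x ^ i)"
      using p(1) unfolding real_polynomial_function_iff_sum by blast
    have "(\<lambda>z. \<Sum>i\<le>n. of_real (a i) * of_real (norm z) ^ (2 * i)) \<in> V"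
      by (intro closed_subspace_sum[OF V] pow)
    moreover have "(\<lambda>z. \<Sum>i\<le>n. of_real (a i) * of_real (norm z) ^ (2 * i)) = (\<lambda>z::complex. of_real (p ((norm z)\<^sup>2)) :: complex)"
      by (simp add: pn power_mult)
    ultimately have "(\<lambda>z. of_real (p ((norm z)\<^sup>2))) \<in> V" by simp
    moreover have "norm (of_real (p ((norm z)\<^sup>2)) - of_real (G ((norm z)\<^sup>2)) :: complex) < \<epsilon>" if "z \<in> K" for z
      using p(2)[of "(norm z)\<^sup>2"] that by (simp flip: of_real_diff add: abs_minus_commute)
    ultimately show "\<exists>g\<in>V. \<forall>z\<in>K. norm (g z - of_real (G ((norm z)\<^sup>2))) < \<epsilon>"
      by (intro bexI[of _ "\<lambda>z. of_real (p ((norm z)\<^sup>2))"]) auto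
  qed
  then show ?thesis by (rule closed_subspaceD(1)[OF V])
qed

text \<open>Far from the origin circles look like lines: \<open>(|z + R|\<^sup>2 - R\<^sup>2) / (2R) \<rightarrow> Re z\<close> as \<open>R \<rightarrow> \<infinity>\<close>.\<close>

lemma exp_Re_in_closed_subspace:
  fixes V :: "(complex \<Rightarrow> complex) set"
  assumes V: "closed_subspace V" and aff: "\<And>f a c. f \<in> V \<Longrightarrow> (\<lambda>z. f (a * z + c)) \<in> V"
    and pow: "\<And>k. (\<lambda>z. of_real (norm z) ^ (2 * k)) \<in> V"
  shows "(\<lambda>z. of_real (exp (Re z))) \<in> V"
proof -
  have fR: "(\<lambda>z. of_real (exp (Re z + (norm z)\<^sup>2 / (2 * R)))) \<in> V" if R: "R > 0" for R :: real
  proof -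
    have "(\<lambda>z. of_real (exp (((norm z)\<^sup>2 - R\<^sup>2) / (2 * R)))) \<in> V"
      using R by (intro radial_in_closed_subspace[OF V pow] continuous_intros) auto
    from aff[OF this, of 1 "of_real R"]
    have "(\<lambda>z. of_real (exp (((norm (z + of_real R))\<^sup>2 - R\<^sup>2) / (2 * R)))) \<in> V" by simp
    moreover have "((norm (z + of_real R))\<^sup>2 - R\<^sup>2) / (2 * R) = Re z + (norm z)\<^sup>2 / (2 * R)" for z
      using R unfolding cmod_power2 by (simp add: field_simps power2_eq_square)
    ultimately show ?thesis by simp
  qed
  have "(\<lambda>z. of_real (exp (Re z))) \<in> ucl V"
  proof (rule uclI)
    fix K :: "complex set" and \<epsilon> :: real assume K: "compact K" "\<epsilon> > 0"
    obtain B where B: "B > 0" "\<And>z. z \<in> K \<Longrightarrow> norm z \<le> B"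
      using compact_imp_bounded[OF K(1)] bounded_pos by metis
    \<comment> \<open>Chosen so that \<open>exp B * (exp \<eta> - 1) = \<epsilon>\<close>. The
      choice of \<open>R\<close> below keeps the perturbation of the exponent at most
      \<open>\<eta> / 2\<close> on \<open>K\<close>.\<close>
    define \<eta> where "\<eta> = ln (1 + \<epsilon> / exp B)"
    have \<eta>: "\<eta> > 0" "exp \<eta> = 1 + \<epsilon> / exp B" using K by (auto simp: \<eta>_def exp_ln add_pos_pos)
    define R where "R = B\<^sup>2 / \<eta>"
    have R: "R > 0" "B\<^sup>2 / (2 * R) < \<eta>" using B \<eta> by (auto simp: R_def)
    have "norm (of_real (exp (Re z + (norm z)\<^sup>2 / (2 * R))) - of_real (exp (Re z)) :: complex) < \<epsilon>" if z: "z \<in> K" for z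
    proof -
      define u where "u = (norm z)\<^sup>2 / (2 * R)"
      have u: "0 \<le> u" "u < \<eta>"
      proof -
        show "0 \<le> u" using R by (simp add: u_def)
        have "u \<le> B\<^sup>2 / (2 * R)" unfolding u_def using R B(2)[OF z] by (intro divide_right_mono power_mono) auto
        then show "u < \<eta>" using R by simp
      qed
      have "norm (of_real (exp (Re z + u)) - of_real (exp (Re z)) :: complex) = \<bar>exp (Re z) * (exp u - 1)\<bar>"
        unfolding of_real_diff[symmetric] norm_of_real by (simp add: exp_add right_diff_distrib)
      also have "\<dots> = exp (Re z) * (exp u - 1)" using u by (simp add: abs_mult)
      also have "\<dots> \<le> exp B * (exp u - 1)"
        using u B(2)[OF z] complex_Re_le_cmod[of z] by (intro mult_right_mono) auto
      also have "\<dots> < exp B * (exp \<eta> - 1)" using u by simp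
      also have "\<dots> = \<epsilon>" by (simp add: \<eta>)
      finally show ?thesis by (simp add: u_def)
    qed
    then show "\<exists>g\<in>V. \<forall>z\<in>K. norm (g z - of_real (exp (Re z))) < \<epsilon>" by (intro bexI[OF _ fR[OF R(1)]]) auto
  qed
  then show ?thesis by (rule closed_subspaceD(1)[OF V])
qed

text \<open>The form is bilinear, without conjugation, because the layers are complex-affine in the
  input; after taking real parts \<open>a\<close> still reaches every real-linear
  functional.\<close>

definition exp_ridge :: "complex ^ 'n::finite \<Rightarrow> complex ^ 'n \<Rightarrow> complex" where
  "exp_ridge a z = of_real (exp (Re (\<Sum>j\<in>UNIV. a $ j * z $ j)))"

text \<open>Products of ridge exponentials add their directions and direction 0 gives the constants,
  so Stone-Weierstrass applies to the real-valued members of the hull. Real and imaginary parts of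
  \<open>f\<close> are then combined.\<close>

lemma exp_ridge_dense:
  fixes f :: "complex ^ 'n::finite \<Rightarrow> complex"
  assumes f: "continuous_on UNIV f"
  shows "f \<in> ucl (lin_hull (range exp_ridge))"
proof -
  define L :: "(complex ^ 'n \<Rightarrow> complex) set" where "L = lin_hull (range exp_ridge)"
  have cont_ridge: "continuous_on A (exp_ridge a)" for A and a :: "complex ^ 'n"
    unfolding exp_ridge_def[abs_def] by (intro continuous_intros)
  have contL: "continuous_on A g" if "g \<in> L" for g A
    using that unfolding L_def by induction (auto intro!: continuous_intros cont_ridge)
  have mult_ridge: "(\<lambda>z. exp_ridge a z * exp_ridge b z) = exp_ridge (a + b)" for a b :: "complex ^ 'n"
    by (simp add: exp_ridge_def fun_eq_iff distrib_right sum.distrib exp_add)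
  have constL: "(\<lambda>_. c) \<in> L" for c
    using lin_hull.step[OF lin_hull.zero, of "exp_ridge 0" "range exp_ridge" c] unfolding L_def
    by (simp add: exp_ridge_def)
  have ridgeL: "exp_ridge a \<in> L" for a unfolding L_def by (intro lin_hull_incl) auto
  have real: "(\<lambda>z. of_real (u z)) \<in> ucl L" if u: "continuous_on UNIV u" for u :: "complex ^ 'n \<Rightarrow> real"
  proof (rule uclI)
    fix K :: "(complex ^ 'n) set" and \<epsilon> :: real assume K: "compact K" "\<epsilon> > 0"
    interpret function_ring_on "{g. (\<lambda>z. of_real (g z)) \<in> L}" K
    proof
      fix g assume "g \<in> {g :: complex ^ 'n \<Rightarrow> real. (\<lambda>z. of_real (g z)) \<in> L}"
      then have "continuous_on K (\<lambda>z. Re (of_real (g z)))" by (intro continuous_intros contL) simp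
      then show "continuous_on K g" by simp
    next
      fix g h assume "g \<in> {g :: complex ^ 'n \<Rightarrow> real. (\<lambda>z. of_real (g z)) \<in> L}" "h \<in> {g. (\<lambda>z. of_real (g z)) \<in> L}"
      then have gh: "(\<lambda>z. of_real (g z)) \<in> L" "(\<lambda>z. of_real (h z)) \<in> L" by auto
      show "(\<lambda>x. g x + h x) \<in> {g. (\<lambda>z. of_real (g z)) \<in> L}"
        using lin_hull_comb[of _ _ _ 1, OF gh[unfolded L_def]] by (simp add: L_def)
      show "(\<lambda>x. g x * h x) \<in> {g. (\<lambda>z. of_real (g z)) \<in> L}"
      proof -
        have "(\<lambda>z. of_real (g z) * of_real (h z)) \<in> L"
          unfolding L_def by (rule lin_hull_mult[OF _ gh[unfolded L_def]]) (auto simp: mult_ridge)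
        then show ?thesis by simp
      qed
    next
      fix x y :: "complex ^ 'n" assume "x \<noteq> y"
      then obtain j where j: "x $ j \<noteq> y $ j" by (auto simp: vec_eq_iff)
      have ax: "Re (\<Sum>i\<in>UNIV. axis j c $ i * w $ i) = Re (c * w $ j)" for c and w :: "complex ^ 'n"
        by (simp add: axis_def if_distrib[of "\<lambda>x. x * _"] cong: if_cong)
      \<comment> \<open>The coefficients \<open>1\<close> and \<open>\<i>\<close> test the real part
        and, up to sign, the imaginary part of coordinate \<open>j\<close>.\<close>
      have "Re (1 * x $ j) \<noteq> Re (1 * y $ j) \<or> Re (\<i> * x $ j) \<noteq> Re (\<i> * y $ j)"
        using j by (auto simp: complex_eq_iff)
      then obtain c where "Re (c * x $ j) \<noteq> Re (c * y $ j)" by blast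
      then show "\<exists>f\<in>{g. (\<lambda>z. of_real (g z)) \<in> L}. f x \<noteq> f y"
        using ridgeL[of "axis j c"] unfolding exp_ridge_def[abs_def]
        by (intro bexI[of _ "\<lambda>z. exp (Re (\<Sum>i\<in>UNIV. axis j c $ i * z $ i))"])
           (simp_all only: ax exp_inj_iff mem_Collect_eq not_False_eq_True)
    qed (use K constL in auto)
    obtain g where "(\<lambda>z. of_real (g z)) \<in> L" "\<And>x. x \<in> K \<Longrightarrow> \<bar>u x - g x\<bar> < \<epsilon>"
      using Stone_Weierstrass_basic[OF continuous_on_subset[OF u] K(2)] by auto
    then show "\<exists>g\<in>L. \<forall>z\<in>K. norm (g z - of_real (u z)) < \<epsilon>"
      by (intro bexI[of _ "\<lambda>z. of_real (g z)"]) (auto simp: abs_minus_commute simp flip: of_real_diff)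
  qed
  have V: "closed_subspace (ucl L)" unfolding L_def by (rule closed_subspace_ucl_lin_hull)
  have "(\<lambda>z. \<i> * of_real (Im (f z)) + of_real (Re (f z))) \<in> ucl L"
    by (intro closed_subspaceD(3)[OF V] real continuous_intros f)
  then show ?thesis by (simp add: L_def complex_eq[symmetric] add.commute)
qed

text \<open>The analytic work is done in one complex variable. Substituting a linear form into a
  one-variable neuron gives a neuron in \<open>n\<close> variables, and carries
  \<open>exp (Re z)\<close> to \<open>exp_ridge a\<close>.\<close>

lemma shallow_dense:
  fixes f :: "complex ^ 'n::finite \<Rightarrow> complex"
  assumes \<rho>: "continuous_on UNIV \<rho>" "\<not> polyharmonic \<rho>" and f: "continuous_on UNIV f"
  shows "f \<in> ucl (lin_hull {\<lambda>z. \<rho> ((\<Sum>j\<in>UNIV. a j * z $ j) + b) | a b. True})"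
proof -
  define S where "S = {\<lambda>z::complex. \<rho> (a * z + b) | a b. True}"
  define V where "V = ucl (lin_hull S)"
  define Sn where "Sn = {\<lambda>z::complex^'n. \<rho> ((\<Sum>j\<in>UNIV. a j * z $ j) + b) | a b. True}"
  have V: "closed_subspace V" unfolding V_def by (rule closed_subspace_ucl_lin_hull)
  have aff: "(\<lambda>z. f (a * z + c)) \<in> V" if "f \<in> V" for f a c
    using that unfolding V_def
  proof (rule ucl_compose)
    show "continuous_on UNIV (\<lambda>z. a * z + c)" by (intro continuous_intros)
    fix g assume "g \<in> lin_hull S"
    then show "(\<lambda>z. g (a * z + c)) \<in> lin_hull S"
    proof (rule lin_hull_compose)
      fix g assume "g \<in> S"
      then obtain a' b' where "g = (\<lambda>z. \<rho> (a' * z + b'))" by (auto simp: S_def)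
      then have "(\<lambda>z. g (a * z + c)) = (\<lambda>z. \<rho> ((a' * a) * z + (a' * c + b')))"
        by (simp add: algebra_simps)
      then show "(\<lambda>z. g (a * z + c)) \<in> S" by (auto simp: S_def)
    qed
  qed
  have "\<rho> \<in> S" unfolding S_def mem_Collect_eq by (intro exI[of _ 1] exI[of _ 0]) simp
  then have "\<rho> \<in> V" unfolding V_def by (intro ucl_incl lin_hull_incl)
  then have "(\<lambda>z. of_real (exp (Re z))) \<in> V"
    by (intro exp_Re_in_closed_subspace[OF V aff] norm_powers_in_closed_subspace[OF V aff _ \<rho>])
  then have E: "exp_ridge a \<in> ucl (lin_hull Sn)" for a :: "complex ^ 'n"
    unfolding V_def exp_ridge_def[abs_def]
  proof (rule ucl_compose[where h = "\<lambda>z. \<Sum>j\<in>UNIV. a $ j * z $ j"])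
    fix g assume "g \<in> lin_hull S"
    then show "(\<lambda>z. g (\<Sum>j\<in>UNIV. a $ j * z $ j)) \<in> lin_hull Sn"
    proof (rule lin_hull_compose)
      fix g assume "g \<in> S"
      then obtain a' b' where "g = (\<lambda>z. \<rho> (a' * z + b'))" by (auto simp: S_def)
      then have "(\<lambda>z::complex^'n. g (\<Sum>j\<in>UNIV. a $ j * z $ j)) = (\<lambda>z. \<rho> ((\<Sum>j\<in>UNIV. (a' * a $ j) * z $ j) + b'))"
        by (simp add: sum_distrib_left mult.assoc)
      then show "(\<lambda>z::complex^'n. g (\<Sum>j\<in>UNIV. a $ j * z $ j)) \<in> Sn"
        unfolding Sn_def mem_Collect_eq by (intro exI[of _ "\<lambda>j. a' * a $ j"] exI[of _ b']) simp
    qed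
  qed (intro continuous_intros)
  have "g \<in> ucl (lin_hull Sn)" if "g \<in> lin_hull (range exp_ridge)" for g
    using that
  proof induction
    case zero
    show ?case by (intro ucl_incl lin_hull.zero)
  next
    case (step g f c)
    then show ?case using E by (auto intro!: ucl_comb lin_hull_comb)
  qed
  then have "f \<in> ucl (lin_hull Sn)" using exp_ridge_dense[OF f] ucl_trans by blast
  then show ?thesis by (simp add: Sn_def)
qed


section \<open>Deep narrow networks as register machines\<close>

text \<open>Grows by a layer behind the existing ones, matching the \<open>foldl\<close> in
  \<open>NN\<close> over a list extended on the right.\<close>

inductive_set hidden :: "(complex \<Rightarrow> complex) \<Rightarrow> nat \<Rightarrow> (complex ^ 'n::finite \<Rightarrow> nat \<Rightarrow> complex) set"
  for \<rho> W where
  base: "(\<lambda>x. act \<rho> W (in_layer W A b x)) \<in> hidden \<rho> W"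
| step: "y \<in> hidden \<rho> W \<Longrightarrow> (\<lambda>x. act \<rho> W (hid_layer W A b (y x))) \<in> hidden \<rho> W"

lemma out_layer_hidden_in_NN:
  fixes y :: "complex ^ 'n::finite \<Rightarrow> nat \<Rightarrow> complex"
  assumes "y \<in> hidden \<rho> W"
  shows "(\<lambda>x. out_layer W A b (y x) :: complex ^ 'm::finite) \<in> NN \<rho> W"
proof -
  have "\<exists>A1 b1 hs. y = (\<lambda>x. foldl (\<lambda>y (A, b). act \<rho> W (hid_layer W A b y)) (act \<rho> W (in_layer W A1 b1 x)) hs)"
    using assms
  proof induction
    case (base A b)
    show ?case by (intro exI[of _ A] exI[of _ b] exI[of _ "[]"]) simp
  next
    case (step y A b)
    then obtain A1 b1 hs where "y = (\<lambda>x. foldl (\<lambda>y (A, b). act \<rho> W (hid_layer W A b y)) (act \<rho> W (in_layer W A1 b1 x)) hs)"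
      by blast
    then show ?case by (intro exI[of _ A1] exI[of _ b1] exI[of _ "hs @ [(A, b)]"]) simp
  qed
  then show ?thesis unfolding NN_def by blast
qed

text \<open>The machine state: input registers, output registers and one scalar slot, all affine in
  the last hidden vector. A readout is not a layer of its own; it merges into the affine map that
  follows.\<close>

definition readout :: "nat \<Rightarrow> ('n::finite \<Rightarrow> nat \<Rightarrow> complex) \<Rightarrow> ('n \<Rightarrow> complex) \<Rightarrow> ('m::finite \<Rightarrow> nat \<Rightarrow> complex) \<Rightarrow> ('m \<Rightarrow> complex)
    \<Rightarrow> (nat \<Rightarrow> complex) \<Rightarrow> complex \<Rightarrow> (nat \<Rightarrow> complex) \<Rightarrow> (complex ^ 'n) \<times> (complex ^ 'm) \<times> complex" where
  "readout W A b A' b' a c v = (out_layer W A b v, out_layer W A' b' v, (\<Sum>j<W. a j * v j) + c)"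

definition reachable :: "(complex \<Rightarrow> complex) \<Rightarrow> nat \<Rightarrow> (complex ^ 'n::finite \<Rightarrow> (complex ^ 'n) \<times> (complex ^ 'm::finite) \<times> complex) set" where
  "reachable \<rho> W = {\<lambda>x. readout W A b A' b' a c (y x) | A b A' b' a c y. y \<in> hidden \<rho> W}"

lemma reachableI: "y \<in> hidden \<rho> W \<Longrightarrow> (\<And>x. f x = readout W A b A' b' a c (y x)) \<Longrightarrow> f \<in> reachable \<rho> W"
  unfolding reachable_def mem_Collect_eq
  by (intro exI[of _ A] exI[of _ b] exI[of _ A'] exI[of _ b'] exI[of _ a] exI[of _ c] exI[of _ y]) auto

text \<open>One machine instruction: the slot is added to the output registers along
  \<open>k\<close> and then loaded with the argument of the next neuron. Being affine, it costs no
  activation layer.\<close>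

lemma reachable_affine:
  assumes "f \<in> reachable \<rho> W"
  shows "(\<lambda>z. case f z of (x, y, s) \<Rightarrow> (x, y + (\<chi> i. s * k $ i), (\<Sum>j\<in>UNIV. l j * x $ j) + t)) \<in> reachable \<rho> W"
proof -
  obtain A b A' b' a c y where f: "f = (\<lambda>x. readout W A b A' b' a c (y x))" and y: "y \<in> hidden \<rho> W"
    using assms unfolding reachable_def by blast
  show ?thesis
  proof (rule reachableI[OF y])
    fix x
    have 1: "out_layer W A' b' (y x) + (\<chi> i. ((\<Sum>j<W. a j * y x j) + c) * k $ i)
        = out_layer W (\<lambda>i j. A' i j + a j * k $ i) (\<lambda>i. b' i + c * k $ i) (y x)"
      by (simp add: out_layer_def vec_eq_iff sum.distrib sum_distrib_right sum_distrib_left algebra_simps)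
    have 2: "(\<Sum>j\<in>UNIV. l j * out_layer W A b (y x) $ j) + t
        = (\<Sum>j<W. (\<Sum>i\<in>UNIV. l i * A i j) * y x j) + ((\<Sum>i\<in>UNIV. l i * b i) + t)"
    proof -
      have "(\<Sum>j\<in>UNIV. l j * out_layer W A b (y x) $ j) = (\<Sum>i\<in>UNIV. \<Sum>j<W. l i * A i j * y x j) + (\<Sum>i\<in>UNIV. l i * b i)"
        by (simp add: out_layer_def sum.distrib sum_distrib_left distrib_left mult.assoc)
      then show ?thesis by (subst (asm) sum.swap) (simp add: sum_distrib_right)
    qed
    show "(case f x of (x, y, s) \<Rightarrow> (x, y + (\<chi> i. s * k $ i), (\<Sum>j\<in>UNIV. l j * x $ j) + t))
      = readout W A b (\<lambda>i j. A' i j + a j * k $ i) (\<lambda>i. b' i + c * k $ i) (\<lambda>j. \<Sum>i\<in>UNIV. l i * A i j)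
          ((\<Sum>i\<in>UNIV. l i * b i) + t) (y x)"
      by (simp add: f readout_def 1 2)
  qed
qed

text \<open>The values of a good approximant stay within distance 1 of the compact image of
  \<open>K\<close> under \<open>f\<close>; there \<open>\<Phi>\<close> is uniformly continuous and
  close to \<open>\<Psi>\<close>. Layers can thus be replaced one at a time, without tracking errors
  through the depth.\<close>

lemma ucl_postcompose:
  fixes f :: "'a::topological_space \<Rightarrow> 'b::euclidean_space" and \<Phi> :: "'b \<Rightarrow> 'c::real_normed_vector"
  assumes f: "f \<in> ucl S" "continuous_on UNIV f" and \<Phi>: "continuous_on UNIV \<Phi>"
    and ap: "\<And>K \<epsilon>. compact K \<Longrightarrow> \<epsilon> > 0 \<Longrightarrow> \<exists>\<Psi>. (\<forall>g\<in>S. (\<lambda>z. \<Psi> (g z)) \<in> S') \<and> (\<forall>w\<in>K. norm (\<Psi> w - \<Phi> w) < \<epsilon>)"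
  shows "(\<lambda>z. \<Phi> (f z)) \<in> ucl S'"
proof (rule uclI)
  fix K :: "'a set" and \<epsilon> :: real assume K: "compact K" "\<epsilon> > 0"
  define K' where "K' = {x + y | x y. x \<in> f ` K \<and> y \<in> cball (0::'b) 1}"
  have K': "compact K'" unfolding K'_def
    by (intro compact_sums compact_cball compact_continuous_image K continuous_on_subset[OF f(2)]) auto
  have "uniformly_continuous_on K' \<Phi>"
    by (intro compact_uniformly_continuous continuous_on_subset[OF \<Phi>] K') auto
  then obtain \<delta> where \<delta>: "\<delta> > 0" "\<And>x y. x \<in> K' \<Longrightarrow> y \<in> K' \<Longrightarrow> dist y x < \<delta> \<Longrightarrow> dist (\<Phi> y) (\<Phi> x) < \<epsilon>/2"
    unfolding uniformly_continuous_on_def using K by (metis half_gt_zero)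
  obtain g where g: "g \<in> S" "\<And>z. z \<in> K \<Longrightarrow> norm (g z - f z) < min \<delta> 1"
    using uclE[OF f(1) K(1), of "min \<delta> 1"] \<delta> by auto
  obtain \<Psi> where \<Psi>: "\<And>g. g \<in> S \<Longrightarrow> (\<lambda>z. \<Psi> (g z)) \<in> S'" "\<And>w. w \<in> K' \<Longrightarrow> norm (\<Psi> w - \<Phi> w) < \<epsilon>/2"
    using ap[OF K', of "\<epsilon>/2"] K by auto
  have "norm (\<Psi> (g z) - \<Phi> (f z)) < \<epsilon>" if z: "z \<in> K" for z
  proof -
    have K'I: "f z + y \<in> K'" if "norm y \<le> 1" for y using z that unfolding K'_def by force
    have "f z + (g z - f z) \<in> K'" "f z + 0 \<in> K'" using g(2)[OF z] by (intro K'I; simp)+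
    then have m: "g z \<in> K'" "f z \<in> K'" by simp_all
    then have "norm (\<Phi> (g z) - \<Phi> (f z)) < \<epsilon>/2" using \<delta>(2)[of "f z" "g z"] g(2)[OF z] by (simp add: dist_norm)
    then have "norm ((\<Psi> (g z) - \<Phi> (g z)) + (\<Phi> (g z) - \<Phi> (f z))) < \<epsilon>/2 + \<epsilon>/2"
      using \<Psi>(2)[OF m(1)] by (intro norm_add_less)
    then show ?thesis by simp
  qed
  then show "\<exists>h\<in>S'. \<forall>z\<in>K. norm (h z - \<Phi> (f z)) < \<epsilon>" by (intro bexI[OF _ \<Psi>(1)[OF g(1)]]) auto
qed

definition map_vec :: "(complex \<Rightarrow> complex) \<Rightarrow> complex ^ 'k::finite \<Rightarrow> complex ^ 'k" where
  "map_vec \<kappa> x = (\<chi> i. \<kappa> (x $ i))"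

lemma norm_vec_le_sum: "norm (x :: complex ^ 'k::finite) \<le> (\<Sum>i\<in>UNIV. norm (x $ i))"
  unfolding norm_vec_def by (rule L2_set_le_sum) simp

inductive_set shallow :: "(complex \<Rightarrow> complex) \<Rightarrow> (complex ^ 'n::finite \<Rightarrow> complex ^ 'm::finite) set" for \<rho> where
  zero: "(\<lambda>_. 0) \<in> shallow \<rho>"
| step: "g \<in> shallow \<rho> \<Longrightarrow> (\<lambda>z. g z + (\<chi> i. \<rho> ((\<Sum>j\<in>UNIV. a j * z $ j) + b) * k $ i)) \<in> shallow \<rho>"

text \<open>Each output coordinate is approximated separately; a scalar summand with coefficient
  \<open>c\<close> in coordinate \<open>k\<close> becomes a vector summand with coefficient
  \<open>axis k c\<close>.\<close>

lemma vec_shallow_dense: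
  fixes f :: "complex ^ 'n::finite \<Rightarrow> complex ^ 'm::finite"
  assumes \<rho>: "continuous_on UNIV \<rho>" "\<not> polyharmonic \<rho>" and f: "continuous_on UNIV f"
  shows "f \<in> ucl (shallow \<rho>)"
proof -
  define S where "S = {\<lambda>z::complex^'n. \<rho> ((\<Sum>j\<in>UNIV. a j * z $ j) + b) | a b. True}"
  have add: "(\<lambda>z. G z + axis k (u z)) \<in> shallow \<rho>"
    if "u \<in> lin_hull S" "G \<in> shallow \<rho>" for u and G :: "complex ^ 'n \<Rightarrow> complex ^ 'm" and k
    using that
  proof induction
    case zero
    have "axis k (0::complex) = 0" by (simp add: axis_def vec_eq_iff)
    show ?case using zero unfolding \<open>axis k 0 = 0\<close> by simp
  next
    case (step g s c)
    then obtain a b where s: "s = (\<lambda>z. \<rho> ((\<Sum>j\<in>UNIV. a j * z $ j) + b))" by (auto simp: S_def)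
    have "(\<lambda>z. (G z + axis k (g z)) + (\<chi> i. \<rho> ((\<Sum>j\<in>UNIV. a j * z $ j) + b) * axis k c $ i)) \<in> shallow \<rho>"
      using step by (intro shallow.step) auto
    moreover have "(G z + axis k (g z)) + (\<chi> i. \<rho> ((\<Sum>j\<in>UNIV. a j * z $ j) + b) * axis k c $ i) = G z + axis k (c * s z + g z)" for z
      by (simp add: vec_eq_iff axis_def s)
    ultimately show ?case by simp
  qed
  have sum: "(\<lambda>z. \<Sum>k\<in>I. axis k (u k z)) \<in> (shallow \<rho> :: (complex ^ 'n \<Rightarrow> complex ^ 'm) set)" if "\<And>k. u k \<in> lin_hull S" for u I
  proof (induction I rule: infinite_finite_induct)
    case (insert k I)
    then show ?case using add[OF that[of k] insert.IH, of k] by (simp add: add.commute)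
  qed (auto intro: shallow.zero)
  show ?thesis
  proof (rule uclI)
    fix K :: "(complex ^ 'n) set" and \<epsilon> :: real assume K: "compact K" "\<epsilon> > 0"
    define e where "e = \<epsilon> / (real CARD('m) + 1)"
    have e: "e > 0" "real CARD('m) * e < \<epsilon>" using K by (auto simp: e_def field_simps)
    have "\<exists>u\<in>lin_hull S. \<forall>z\<in>K. norm (u z - f z $ k) < e" for k
    proof -
      have "(\<lambda>z. f z $ k) \<in> ucl (lin_hull S)" unfolding S_def
        by (intro shallow_dense[OF \<rho>] continuous_intros f)
      then obtain g where "g \<in> lin_hull S" "\<And>z. z \<in> K \<Longrightarrow> norm (g z - f z $ k) < e"
        using uclE[OF _ K(1) e(1)] by meson
      then show ?thesis by (intro bexI[of _ g] ballI)
    qed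
    then obtain u where u: "\<And>k. u k \<in> lin_hull S" "\<And>k z. z \<in> K \<Longrightarrow> norm (u k z - f z $ k) < e" by metis
    have "norm ((\<Sum>k\<in>UNIV. axis k (u k z)) - f z) < \<epsilon>" if z: "z \<in> K" for z
    proof -
      have c: "(\<Sum>k\<in>UNIV. axis k (u k z)) $ i = u i z" for i
        by (simp add: axis_def if_distrib cong: if_cong)
      have "norm ((\<Sum>k\<in>UNIV. axis k (u k z)) - f z) \<le> (\<Sum>i\<in>UNIV. norm (u i z - f z $ i))"
        by (rule order_trans[OF norm_vec_le_sum]) (simp add: c del: sum_component)
      also have "\<dots> \<le> (\<Sum>i\<in>(UNIV::'m set). e)" by (intro sum_mono less_imp_le u z)
      finally show ?thesis using e by simp
    qed
    then show "\<exists>g\<in>shallow \<rho>. \<forall>z\<in>K. norm (g z - f z) < \<epsilon>" by (intro bexI[OF _ sum[of u UNIV, OF u(1)]]) auto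
  qed
qed


text \<open>\<open>d\<close> neurons jointly relay one register up to the involution
  \<open>\<kappa>\<close>, in the applications the identity or conjugation. \<open>P\<close> counts
  the registers, \<open>e\<close> numbers them, and the single neuron beyond \<open>d * P\<close>
  evaluates the current summand. All that remains of differentiability is
  \<open>approx\<close>.\<close>

locale register_net =
  fixes \<rho> \<kappa> :: "complex \<Rightarrow> complex" and d P W :: nat and e :: "'n::finite + 'm::finite \<Rightarrow> nat"
  assumes cont_\<rho>: "continuous_on UNIV \<rho>" and cont_\<kappa>: "continuous_on UNIV \<kappa>"
    and \<kappa>_\<kappa>: "\<And>y. \<kappa> (\<kappa> y) = y" and \<kappa>_0: "\<kappa> 0 = 0"
    and P_eq: "P = CARD('n) + CARD('m)" and W_eq: "W = d * P + 1" and bij: "bij_betw e UNIV {..<P}"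
    and approx: "\<And>B \<epsilon>. \<epsilon> > 0 \<Longrightarrow> \<exists>\<alpha> \<beta> \<gamma> \<delta>. \<forall>y. norm y \<le> B \<longrightarrow>
      norm ((\<Sum>q<d. \<gamma> q * \<rho> (\<alpha> q * y + \<beta> q)) + \<delta> - \<kappa> y) < \<epsilon>"
begin

text \<open>Neuron \<open>p < d * P\<close> is number \<open>p mod d\<close> in the block of
  register \<open>p div d\<close>; the last one, \<open>p = d * P\<close>, receives the slot
  unchanged.\<close>

definition neuron_input :: "(nat \<Rightarrow> complex) \<Rightarrow> (nat \<Rightarrow> complex) \<Rightarrow> ('n + 'm \<Rightarrow> complex) \<Rightarrow> complex \<Rightarrow> nat \<Rightarrow> complex" where
  "neuron_input \<alpha> \<beta> u s p = (if p < d * P then \<alpha> (p mod d) * u (inv e (p div d)) + \<beta> (p mod d) else s)"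

definition relay :: "(nat \<Rightarrow> complex) \<Rightarrow> (nat \<Rightarrow> complex) \<Rightarrow> (nat \<Rightarrow> complex) \<Rightarrow> complex \<Rightarrow> complex \<Rightarrow> complex" where
  "relay \<alpha> \<beta> \<gamma> \<delta> y = (\<Sum>q<d. \<gamma> q * \<rho> (\<alpha> q * y + \<beta> q)) + \<delta>"

lemma e_less: "e r < P" using bij by (auto simp: bij_betw_def)

lemma e_idx: "e r * d + q < d * P" if "q < d"
proof -
  have "e r * d + q < (e r + 1) * d" using that by simp
  also have "\<dots> \<le> P * d" using e_less[of r] by (intro mult_right_mono) auto
  finally show ?thesis by (simp add: mult.commute)
qed

lemma inv_e: "inv e (e r) = r" using bij by (simp add: bij_betw_def)

text \<open>The coefficients are supported on the block of \<open>r\<close>, so the sum over all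
  neurons collapses to the \<open>d\<close> neurons that relay \<open>u r\<close>.\<close>

lemma register_sum:
  assumes v: "\<And>p. p < W \<Longrightarrow> v p = \<rho> (neuron_input \<alpha> \<beta> u s p)"
  shows "(\<Sum>j<W. (if j < d * P \<and> j div d = e r then \<gamma> (j mod d) else 0) * v j) + \<delta> = relay \<alpha> \<beta> \<gamma> \<delta> (u r)"
proof -
  let ?h = "\<lambda>q. e r * d + q"
  have "(\<Sum>j<W. (if j < d * P \<and> j div d = e r then \<gamma> (j mod d) else 0) * v j)
      = (\<Sum>j\<in>?h ` {..<d}. (if j < d * P \<and> j div d = e r then \<gamma> (j mod d) else 0) * v j)"
  proof (rule sum.mono_neutral_right)
    show "?h ` {..<d} \<subseteq> {..<W}" using e_idx[of _ r] by (auto simp: W_eq intro: less_SucI)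
    show "\<forall>j\<in>{..<W} - ?h ` {..<d}. (if j < d * P \<and> j div d = e r then \<gamma> (j mod d) else 0) * v j = 0"
    proof safe
      fix j assume j: "j < W" "j \<notin> ?h ` {..<d}"
      have "\<not> (j < d * P \<and> j div d = e r)"
      proof
        assume *: "j < d * P \<and> j div d = e r"
        then have "d > 0" by (cases d) auto
        then have "j = ?h (j mod d)" "j mod d < d" using * div_mult_mod_eq[of j d] by auto
        then show False using j by blast
      qed
      then show "(if j < d * P \<and> j div d = e r then \<gamma> (j mod d) else 0) * v j = 0" by (subst if_not_P) auto
    qed
  qed simp
  also have "\<dots> = (\<Sum>q<d. (if ?h q < d * P \<and> ?h q div d = e r then \<gamma> (?h q mod d) else 0) * v (?h q))"
    by (subst sum.reindex) (auto simp: inj_on_def)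
  also have "\<dots> = (\<Sum>q<d. \<gamma> q * \<rho> (\<alpha> q * u r + \<beta> q))"
  proof (rule sum.cong[OF refl])
    fix q assume q: "q \<in> {..<d}"
    then have 1: "?h q < d * P" using e_idx by simp
    have 2: "?h q div d = e r" "?h q mod d = q" using q by auto
    show "(if ?h q < d * P \<and> ?h q div d = e r then \<gamma> (?h q mod d) else 0) * v (?h q) = \<gamma> q * \<rho> (\<alpha> q * u r + \<beta> q)"
      using 1 v[of "?h q"] by (simp only: 2 W_eq neuron_input_def inv_e if_True simp_thms)
  qed
  finally show ?thesis by (simp add: relay_def)
qed

lemma readout_relay:
  assumes v: "\<And>p. p < W \<Longrightarrow> v p = \<rho> (neuron_input \<alpha> \<beta> u s p)"
  shows "readout W (\<lambda>i j. if j < d * P \<and> j div d = e (Inl i) then \<gamma> (j mod d) else 0) (\<lambda>_. \<delta>)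
     (\<lambda>i j. if j < d * P \<and> j div d = e (Inr i) then \<gamma> (j mod d) else 0) (\<lambda>_. \<delta>)
     (\<lambda>j. if j = d * P then 1 else 0) 0 v
   = ((\<chi> i. relay \<alpha> \<beta> \<gamma> \<delta> (u (Inl i))), (\<chi> i. relay \<alpha> \<beta> \<gamma> \<delta> (u (Inr i))), \<rho> s)"
proof -
  have "(\<Sum>j<W. (if j = d * P then 1 else 0) * v j) = \<rho> s"
    using v[of "d * P"] by (simp add: W_eq neuron_input_def if_distrib[of "\<lambda>x. x * _"] cong: if_cong)
  moreover have "(\<Sum>j<W. (if j < d * P \<and> j div d = e r then \<gamma> (j mod d) else 0) * v j) + \<delta> = relay \<alpha> \<beta> \<gamma> \<delta> (u r)" for r
    by (rule register_sum[OF v])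
  ultimately show ?thesis unfolding readout_def out_layer_def by (simp only: add_0_right)
qed

definition relay_map :: "(nat \<Rightarrow> complex) \<Rightarrow> (nat \<Rightarrow> complex) \<Rightarrow> (nat \<Rightarrow> complex) \<Rightarrow> complex \<Rightarrow>
    (complex ^ 'n) \<times> (complex ^ 'm) \<times> complex \<Rightarrow> (complex ^ 'n) \<times> (complex ^ 'm) \<times> complex" where
  "relay_map \<alpha> \<beta> \<gamma> \<delta> = (\<lambda>(x, y, s). (map_vec (relay \<alpha> \<beta> \<gamma> \<delta>) x, map_vec (relay \<alpha> \<beta> \<gamma> \<delta>) y, \<rho> s))"

text \<open>Start of the machine: the first affine map sees only the input, and zero coefficients
  give the output registers and the slot the initial content 0.\<close>

lemma relay_map_base: "(\<lambda>z. relay_map \<alpha> \<beta> \<gamma> \<delta> (z, 0, 0)) \<in> reachable \<rho> W"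
proof (rule reachableI[OF hidden.base])
  fix z :: "complex ^ 'n"
  define u :: "complex ^ 'n \<Rightarrow> 'n + 'm \<Rightarrow> complex" where "u = (\<lambda>z. case_sum (\<lambda>i. z $ i) (\<lambda>_. 0))"
  define A where "A = (\<lambda>p j. if p < d * P then \<alpha> (p mod d) * case_sum (\<lambda>i. if i = j then 1 else 0) (\<lambda>_. 0) (inv e (p div d)) else 0)"
  define b where "b = (\<lambda>p. if p < d * P then \<beta> (p mod d) else 0)"
  have "act \<rho> W (in_layer W A b z) p = \<rho> (neuron_input \<alpha> \<beta> (u z) 0 p)" if "p < W" for p
  proof -
    have "(\<Sum>j\<in>UNIV. A p j * z $ j) + b p = neuron_input \<alpha> \<beta> (u z) 0 p"
      by (cases "inv e (p div d)")
        (auto simp: A_def b_def u_def neuron_input_def mult.assoc sum_distrib_left[symmetric] if_distrib[of "\<lambda>x. x * _"] cong: if_cong)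
    then show ?thesis using that by (simp add: act_def in_layer_def)
  qed
  from readout_relay[OF this, of \<gamma> \<delta>]
  show "relay_map \<alpha> \<beta> \<gamma> \<delta> (z, 0, 0) = readout W (\<lambda>i j. if j < d * P \<and> j div d = e (Inl i) then \<gamma> (j mod d) else 0) (\<lambda>_. \<delta>)
     (\<lambda>i j. if j < d * P \<and> j div d = e (Inr i) then \<gamma> (j mod d) else 0) (\<lambda>_. \<delta>)
     (\<lambda>j. if j = d * P then 1 else 0) 0 (act \<rho> W (in_layer W
       (\<lambda>p j. if p < d * P then \<alpha> (p mod d) * case_sum (\<lambda>i. if i = j then 1 else 0) (\<lambda>_. 0) (inv e (p div d)) else 0)
       (\<lambda>p. if p < d * P then \<beta> (p mod d) else 0) z))"
    by (simp add: relay_map_def u_def map_vec_def A_def b_def)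
qed

lemma relay_map_step:
  assumes "f \<in> reachable \<rho> W"
  shows "(\<lambda>z. relay_map \<alpha> \<beta> \<gamma> \<delta> (f z)) \<in> reachable \<rho> W"
proof -
  obtain A b A' b' a c y where f: "f = (\<lambda>x. readout W A b A' b' a c (y x))" and y: "y \<in> hidden \<rho> W"
    using assms unfolding reachable_def by blast
  define u where "u = (\<lambda>z. case_sum (\<lambda>i. out_layer W A b (y z) $ i) (\<lambda>i. out_layer W A' b' (y z) $ i))"
  define s where "s = (\<lambda>z. (\<Sum>j<W. a j * y z j) + c)"
  \<comment> \<open>The old readout is substituted into the next affine map: relaying neurons scale
    it by \<open>\<alpha>\<close> and shift it by \<open>\<beta>\<close>, the last neuron takes the
    slot as it is.\<close>
  define HA where "HA = (\<lambda>p j. if p < d * P then \<alpha> (p mod d) * case_sum A A' (inv e (p div d)) j else a j)"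
  define Hb where "Hb = (\<lambda>p. if p < d * P then \<alpha> (p mod d) * case_sum b b' (inv e (p div d)) + \<beta> (p mod d) else c)"
  have v: "act \<rho> W (hid_layer W HA Hb (y z)) p = \<rho> (neuron_input \<alpha> \<beta> (u z) (s z) p)" if "p < W" for p z
  proof -
    have "(\<Sum>j<W. HA p j * y z j) + Hb p = neuron_input \<alpha> \<beta> (u z) (s z) p"
      by (cases "inv e (p div d)")
        (auto simp: HA_def Hb_def u_def s_def neuron_input_def out_layer_def distrib_left sum_distrib_left mult.assoc)
    then show ?thesis using that by (simp add: act_def hid_layer_def)
  qed
  have fz: "f z = ((\<chi> i. u z (Inl i)), (\<chi> i. u z (Inr i)), s z)" for z
    by (simp add: f readout_def u_def s_def)
  show ?thesis
  proof (rule reachableI[OF hidden.step[OF y]])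
    fix z
    show "relay_map \<alpha> \<beta> \<gamma> \<delta> (f z) = readout W (\<lambda>i j. if j < d * P \<and> j div d = e (Inl i) then \<gamma> (j mod d) else 0) (\<lambda>_. \<delta>)
       (\<lambda>i j. if j < d * P \<and> j div d = e (Inr i) then \<gamma> (j mod d) else 0) (\<lambda>_. \<delta>)
       (\<lambda>j. if j = d * P then 1 else 0) 0 (act \<rho> W (hid_layer W HA Hb (y z)))"
      using readout_relay[where v = "act \<rho> W (hid_layer W HA Hb (y z))", OF v] by (simp add: relay_map_def fz map_vec_def)
  qed
qed

section \<open>From approximate relays to the exact involution\<close>

definition ideal_map :: "(complex ^ 'n) \<times> (complex ^ 'm) \<times> complex \<Rightarrow> (complex ^ 'n) \<times> (complex ^ 'm) \<times> complex" where
  "ideal_map = (\<lambda>(x, y, s). (map_vec \<kappa> x, map_vec \<kappa> y, \<rho> s))"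

lemma continuous_map_vec: "continuous_on A f \<Longrightarrow> continuous_on A (\<lambda>z. map_vec \<kappa> (f z))"
  unfolding map_vec_def by (intro continuous_intros continuous_on_compose2[OF cont_\<kappa>]) auto

lemma continuous_ideal_map: "continuous_on UNIV ideal_map"
  unfolding ideal_map_def split_beta
  by (intro continuous_on_Pair continuous_map_vec continuous_on_compose2[OF cont_\<rho>] continuous_intros) auto

lemma relay_map_approx:
  assumes K: "compact K" and "\<epsilon> > 0"
  shows "\<exists>\<alpha> \<beta> \<gamma> \<delta>. \<forall>w\<in>K. norm (relay_map \<alpha> \<beta> \<gamma> \<delta> w - ideal_map w) < \<epsilon>"
proof -
  obtain B where B: "\<And>w. w \<in> K \<Longrightarrow> norm w \<le> B"
    using compact_imp_bounded[OF K] bounded_iff by metis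
  define \<eta> where "\<eta> = \<epsilon> / (real P + 1)"
  have \<eta>: "\<eta> > 0" "real P * \<eta> < \<epsilon>" using \<open>\<epsilon> > 0\<close> by (auto simp: \<eta>_def field_simps)
  obtain \<alpha> \<beta> \<gamma> \<delta> where ap: "\<And>y. norm y \<le> B \<Longrightarrow> norm (relay \<alpha> \<beta> \<gamma> \<delta> y - \<kappa> y) < \<eta>"
    using approx[OF \<eta>(1), of B] unfolding relay_def by blast
  have vec: "norm (map_vec (relay \<alpha> \<beta> \<gamma> \<delta>) x - map_vec \<kappa> x) \<le> real CARD('k) * \<eta>" if "norm x \<le> B" for x :: "complex ^ 'k::finite"
  proof -
    have "norm (map_vec (relay \<alpha> \<beta> \<gamma> \<delta>) x - map_vec \<kappa> x) \<le> (\<Sum>i\<in>UNIV. norm (relay \<alpha> \<beta> \<gamma> \<delta> (x $ i) - \<kappa> (x $ i)))"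
      by (rule order_trans[OF norm_vec_le_sum]) (simp add: map_vec_def)
    also have "\<dots> \<le> (\<Sum>i\<in>(UNIV::'k set). \<eta>)"
      by (intro sum_mono less_imp_le ap order_trans[OF Finite_Cartesian_Product.norm_nth_le that])
    finally show ?thesis by simp
  qed
  have "norm (relay_map \<alpha> \<beta> \<gamma> \<delta> w - ideal_map w) < \<epsilon>" if w: "w \<in> K" for w
  proof -
    obtain x y s where xys: "w = (x, y, s)" by (cases w)
    have "norm x \<le> norm w" "norm y \<le> norm w"
      using norm_fst_le[of x "(y, s)"] norm_snd_le[of "(y, s)" x] norm_fst_le[of y s] unfolding xys by auto
    then have xy: "norm x \<le> B" "norm y \<le> B" using B[OF w] by auto
    \<comment> \<open>Both maps apply \<open>\<rho>\<close> to the slot exactly, so only the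
      registers contribute to the error.\<close>
    have "norm (relay_map \<alpha> \<beta> \<gamma> \<delta> w - ideal_map w)
      = norm (map_vec (relay \<alpha> \<beta> \<gamma> \<delta>) x - map_vec \<kappa> x, map_vec (relay \<alpha> \<beta> \<gamma> \<delta>) y - map_vec \<kappa> y, 0::complex)"
      by (simp add: relay_map_def ideal_map_def xys)
    also have "\<dots> \<le> norm (map_vec (relay \<alpha> \<beta> \<gamma> \<delta>) x - map_vec \<kappa> x) + norm (map_vec (relay \<alpha> \<beta> \<gamma> \<delta>) y - map_vec \<kappa> y)"
      by (rule order_trans[OF norm_Pair_le]) (simp add: norm_Pair)
    also have "\<dots> \<le> real CARD('n) * \<eta> + real CARD('m) * \<eta>" by (intro add_mono vec xy)
    also have "\<dots> < \<epsilon>" using \<eta> by (simp add: P_eq algebra_simps)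
    finally show ?thesis .
  qed
  then show ?thesis by blast
qed

lemma ideal_map_reachable:
  assumes f: "f \<in> ucl (reachable \<rho> W)" "continuous_on UNIV f"
  shows "(\<lambda>z. ideal_map (f z)) \<in> ucl (reachable \<rho> W)"
proof (rule ucl_postcompose[OF f continuous_ideal_map])
  fix K :: "((complex ^ 'n) \<times> (complex ^ 'm) \<times> complex) set" and \<epsilon> :: real
  assume "compact K" "\<epsilon> > 0"
  then obtain \<alpha> \<beta> \<gamma> \<delta> where "\<forall>w\<in>K. norm (relay_map \<alpha> \<beta> \<gamma> \<delta> w - ideal_map w) < \<epsilon>"
    using relay_map_approx by blast
  then show "\<exists>\<Psi>. (\<forall>g\<in>reachable \<rho> W. (\<lambda>z. \<Psi> (g z)) \<in> reachable \<rho> W) \<and> (\<forall>w\<in>K. norm (\<Psi> w - ideal_map w) < \<epsilon>)"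
    using relay_map_step by blast
qed

lemma ideal_map_base: "(\<lambda>z. ideal_map (z, 0, 0)) \<in> ucl (reachable \<rho> W)"
proof (rule uclI)
  fix K :: "(complex ^ 'n) set" and \<epsilon> :: real
  assume K: "compact K" "\<epsilon> > 0"
  have "compact ((\<lambda>z. (z, 0::complex ^ 'm, 0::complex)) ` K)" using K by (intro compact_continuous_image continuous_intros)
  from relay_map_approx[OF this K(2)] obtain \<alpha> \<beta> \<gamma> \<delta> where
    "\<And>z. z \<in> K \<Longrightarrow> norm (relay_map \<alpha> \<beta> \<gamma> \<delta> (z, 0, 0) - ideal_map (z, 0, 0)) < \<epsilon>" by blast
  then show "\<exists>g\<in>reachable \<rho> W. \<forall>z\<in>K. norm (g z - ideal_map (z, 0, 0)) < \<epsilon>"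
    by (intro bexI[OF _ relay_map_base]) auto
qed

lemma affine_reachable:
  fixes x :: "complex ^ 'n \<Rightarrow> complex ^ 'n" and y :: "complex ^ 'n \<Rightarrow> complex ^ 'm"
  assumes f: "(\<lambda>z. (x z, y z, s z)) \<in> ucl (reachable \<rho> W)"
    and "continuous_on UNIV x" "continuous_on UNIV y" "continuous_on UNIV s"
  shows "(\<lambda>z. (x z, y z + (\<chi> i. s z * k $ i), (\<Sum>j\<in>UNIV. l j * x z $ j) + t)) \<in> ucl (reachable \<rho> W)"
proof -
  define \<Phi> :: "(complex ^ 'n) \<times> (complex ^ 'm) \<times> complex \<Rightarrow> (complex ^ 'n) \<times> (complex ^ 'm) \<times> complex" where
    "\<Phi> = (\<lambda>w. case w of (x, y, s) \<Rightarrow> (x, y + (\<chi> i. s * k $ i), (\<Sum>j\<in>UNIV. l j * x $ j) + t))"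
  have "(\<lambda>z. \<Phi> (x z, y z, s z)) \<in> ucl (reachable \<rho> W)"
  proof (rule ucl_postcompose[OF f])
    show "continuous_on UNIV (\<lambda>z. (x z, y z, s z))" by (intro continuous_on_Pair assms)
    show "continuous_on UNIV \<Phi>" unfolding \<Phi>_def split_beta by (intro continuous_intros)
    show "\<exists>\<Psi>. (\<forall>g\<in>reachable \<rho> W. (\<lambda>z. \<Psi> (g z)) \<in> reachable \<rho> W) \<and> (\<forall>w\<in>K. norm (\<Psi> w - \<Phi> w) < \<epsilon>)" if "\<epsilon> > 0" for K \<epsilon>
      using that reachable_affine unfolding \<Phi>_def by (intro exI[of _ \<Phi>, unfolded \<Phi>_def]) auto
  qed
  then show ?thesis by (simp add: \<Phi>_def)
qed

lemma map_vec_map_vec: "map_vec \<kappa> (map_vec \<kappa> x) = x"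
  by (simp add: map_vec_def \<kappa>_\<kappa>)

lemma continuous_shallow: "g \<in> shallow \<rho> \<Longrightarrow> continuous_on UNIV g"
  by (induction rule: shallow.induct) (auto intro!: continuous_intros continuous_on_compose2[OF cont_\<rho>])

text \<open>Two layers add one summand: between them all registers hold \<open>\<kappa>\<close> of their intended content,
  which the second layer undoes because \<open>\<kappa>\<close> is an involution.\<close>

lemma shallow_reachable:
  fixes g :: "complex ^ 'n \<Rightarrow> complex ^ 'm"
  assumes "g \<in> shallow \<rho>"
  shows "\<exists>s. continuous_on UNIV s \<and> (\<lambda>z. (map_vec \<kappa> z, map_vec \<kappa> (g (map_vec \<kappa> z)), s z)) \<in> ucl (reachable \<rho> W)"
  using assms
proof induction
  case zero
  have "map_vec \<kappa> (0 :: complex ^ 'm) = 0" by (simp add: map_vec_def \<kappa>_0 vec_eq_iff)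
  then show ?case using ideal_map_base by (intro exI[of _ "\<lambda>_. \<rho> 0"]) (simp add: ideal_map_def continuous_intros)
next
  case (step g l t k)
  then obtain s where s: "continuous_on UNIV s" "(\<lambda>z. (map_vec \<kappa> z, map_vec \<kappa> (g (map_vec \<kappa> z)), s z)) \<in> ucl (reachable \<rho> W)"
    by blast
  have cg: "continuous_on UNIV (\<lambda>z. g (map_vec \<kappa> z))"
    by (intro continuous_on_compose2[OF continuous_shallow[OF step.hyps]] continuous_map_vec continuous_intros) auto
  have c1: "continuous_on UNIV (\<lambda>z. map_vec \<kappa> z :: complex ^ 'n)" by (intro continuous_map_vec continuous_intros)
  have c2: "continuous_on UNIV (\<lambda>z. map_vec \<kappa> (g (map_vec \<kappa> z)))" by (intro continuous_map_vec cg)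
  define r where "r = (\<lambda>z::complex^'n. (\<Sum>j\<in>UNIV. l j * map_vec \<kappa> z $ j) + t)"
  have cr: "continuous_on UNIV r" unfolding r_def by (intro continuous_intros c1)
  have c\<rho>: "continuous_on UNIV (\<lambda>z. \<rho> (r z))" by (intro continuous_on_compose2[OF cont_\<rho>] cr) auto
  \<comment> \<open>The argument is loaded while the input registers hold
    \<open>map_vec \<kappa> z\<close>, which is why the machine evaluates \<open>g\<close> there;
    coefficient 0 leaves the output registers alone.\<close>
  have "(\<lambda>z. (map_vec \<kappa> z, map_vec \<kappa> (g (map_vec \<kappa> z)), r z)) \<in> ucl (reachable \<rho> W)"
    using affine_reachable[OF s(2) c1 c2 s(1), of 0 l t] by (simp add: r_def zero_vec_def[symmetric])
  from ideal_map_reachable[OF this] have "(\<lambda>z. (z, g (map_vec \<kappa> z), \<rho> (r z))) \<in> ucl (reachable \<rho> W)"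
    by (simp add: ideal_map_def map_vec_map_vec continuous_on_Pair c1 c2 cr)
  \<comment> \<open>The output registers now hold plain values, so the evaluated summand can be
    added; the zero form clears the slot.\<close>
  from affine_reachable[OF this continuous_on_id cg c\<rho>, of k "\<lambda>_. 0" 0]
  have "(\<lambda>z. (z, g (map_vec \<kappa> z) + (\<chi> i. \<rho> (r z) * k $ i), 0)) \<in> ucl (reachable \<rho> W)"
    by simp
  from ideal_map_reachable[OF this]
  have "(\<lambda>z. (map_vec \<kappa> z, map_vec \<kappa> (g (map_vec \<kappa> z) + (\<chi> i. \<rho> (r z) * k $ i)), \<rho> 0)) \<in> ucl (reachable \<rho> W)"
    by (simp add: ideal_map_def continuous_on_Pair continuous_on_add continuous_on_vec_lambda continuous_on_mult_right cg c\<rho>)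
  then show ?case by (intro exI[of _ "\<lambda>_. \<rho> 0"]) (simp add: r_def)
qed

text \<open>The machine computes \<open>g\<close> at \<open>map_vec \<kappa> z\<close>.
  Approximating \<open>h\<close> precomposed with \<open>map_vec \<kappa>\<close> by shallow
  networks compensates for this, because \<open>\<kappa>\<close> is an involution.\<close>

lemma universal_NN:
  assumes nph: "\<not> polyharmonic \<rho>"
  shows "universal (NN \<rho> W :: (complex ^ 'n \<Rightarrow> complex ^ 'm) set)"
proof -
  have sh: "(\<lambda>z. g (map_vec \<kappa> z)) \<in> ucl (NN \<rho> W)" if g: "g \<in> shallow \<rho>" for g :: "complex ^ 'n \<Rightarrow> complex ^ 'm"
  proof -
    obtain s where s: "continuous_on UNIV s" "(\<lambda>z. (map_vec \<kappa> z, map_vec \<kappa> (g (map_vec \<kappa> z)), s z)) \<in> ucl (reachable \<rho> W)"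
      using shallow_reachable[OF g] by blast
    have "continuous_on UNIV (\<lambda>z. (map_vec \<kappa> z, map_vec \<kappa> (g (map_vec \<kappa> z)), s z))"
      by (intro continuous_on_Pair continuous_map_vec continuous_on_compose2[OF continuous_shallow[OF g]] s(1) continuous_intros) auto
    from ideal_map_reachable[OF s(2) this]
    have *: "(\<lambda>z. (z, g (map_vec \<kappa> z), \<rho> (s z))) \<in> ucl (reachable \<rho> W)"
      by (simp add: ideal_map_def map_vec_map_vec)
    show ?thesis
    proof (rule uclI)
      fix K :: "(complex ^ 'n) set" and \<epsilon> :: real assume K: "compact K" "\<epsilon> > 0"
      obtain f where f: "f \<in> reachable \<rho> W" "\<And>z. z \<in> K \<Longrightarrow> norm (f z - (z, g (map_vec \<kappa> z), \<rho> (s z))) < \<epsilon>"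
        using uclE[OF * K] by blast
      obtain A b A' b' a c y where fy: "f = (\<lambda>x. readout W A b A' b' a c (y x))" and y: "y \<in> hidden \<rho> W"
        using f(1) unfolding reachable_def by blast
      have "norm (out_layer W A' b' (y z) - g (map_vec \<kappa> z)) < \<epsilon>" if "z \<in> K" for z
      proof -
        let ?w = "f z - (z, g (map_vec \<kappa> z), \<rho> (s z))"
        have "norm (fst (snd ?w)) \<le> norm ?w"
          using norm_snd_le[of "snd ?w" "fst ?w"] norm_fst_le[of "fst (snd ?w)" "snd (snd ?w)"]
          by (simp only: prod.collapse)
        then show ?thesis using f(2)[OF that] by (simp add: fy readout_def)
      qed
      then show "\<exists>h\<in>NN \<rho> W. \<forall>z\<in>K. norm (h z - g (map_vec \<kappa> z)) < \<epsilon>"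
        by (intro bexI[OF _ out_layer_hidden_in_NN[OF y]]) auto
    qed
  qed
  have "h \<in> ucl (NN \<rho> W)" if h: "continuous_on UNIV h" for h :: "complex ^ 'n \<Rightarrow> complex ^ 'm"
  proof -
    have c1: "continuous_on UNIV (\<lambda>z. map_vec \<kappa> z :: complex ^ 'n)" by (intro continuous_map_vec continuous_intros)
    have "(\<lambda>z. h (map_vec \<kappa> z)) \<in> ucl (shallow \<rho>)"
      by (intro vec_shallow_dense[OF cont_\<rho> nph] continuous_on_compose2[OF h c1]) auto
    from ucl_compose[OF this c1, of "ucl (NN \<rho> W)"] sh
    have "h \<in> ucl (ucl (NN \<rho> W))" by (simp add: map_vec_map_vec)
    then show ?thesis by (rule ucl_trans) simp
  qed
  then show ?thesis unfolding universal_def ucl_def by blast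
qed

end

text \<open>First-order expansion in Wirtinger form. The error is measured against the scale
  \<open>t\<close> and not against \<open>norm h\<close>, so that division by \<open>t\<close> makes
  it uniform over \<open>h = t * y\<close> with \<open>norm y \<le> C\<close>.\<close>

lemma real_diff_at_relay:
  assumes diff: "real_diff_at \<rho> z0" and "\<epsilon> > 0" "C \<ge> 0"
  obtains t :: real where "t > 0" "\<And>h. norm h \<le> C * t \<Longrightarrow>
    norm (\<rho> (z0 + h) - \<rho> z0 - wirt \<rho> z0 * h - wirt_bar \<rho> z0 * cnj h) \<le> \<epsilon> * t"
proof -
  define \<eta> where "\<eta> = \<epsilon> / (C + 1)"
  have \<eta>: "\<eta> > 0" "\<eta> * C \<le> \<epsilon>" using assms by (auto simp: \<eta>_def field_simps)
  have eq: "wirt \<rho> z0 * h + wirt_bar \<rho> z0 * cnj h = px \<rho> z0 * of_real (Re h) + py \<rho> z0 * of_real (Im h)" for h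
    by (simp add: wirt_def wirt_bar_def complex_eq_iff field_simps)
  define q where "q = (\<lambda>h. \<rho> (z0 + h) - \<rho> z0 - px \<rho> z0 * of_real (Re h) - py \<rho> z0 * of_real (Im h))"
  have "((\<lambda>h. q h / h) \<longlongrightarrow> 0) (at 0)" using diff by (simp add: real_diff_at_def q_def)
  then obtain \<delta> where \<delta>: "\<delta> > 0" "\<And>h. h \<noteq> 0 \<Longrightarrow> norm h < \<delta> \<Longrightarrow> norm (q h / h) < \<eta>"
    using \<eta>(1) unfolding tendsto_iff eventually_at by (force simp: dist_norm)
  define t where "t = \<delta> / (2 * (C + 1))"
  have "C * t < \<delta>" using assms \<delta>(1) by (simp add: t_def field_simps add_nonneg_pos)
  then have t: "t > 0" "C * t < \<delta>" using assms \<delta>(1) by (auto simp: t_def)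
  have "norm (\<rho> (z0 + h) - \<rho> z0 - wirt \<rho> z0 * h - wirt_bar \<rho> z0 * cnj h) \<le> \<epsilon> * t" if h: "norm h \<le> C * t" for h
  proof (cases "h = 0")
    case False
    have "norm (q h) \<le> \<eta> * norm h" using \<delta>(2)[OF False] h t False by (simp add: norm_divide field_simps)
    also have "\<dots> \<le> \<eta> * (C * t)" using h \<eta> by (intro mult_left_mono) auto
    also have "\<dots> \<le> \<epsilon> * t" using \<eta>(2) t(1) mult_right_mono[of "\<eta> * C" \<epsilon> t] by (simp add: mult.assoc)
    also have "q h = \<rho> (z0 + h) - \<rho> z0 - wirt \<rho> z0 * h - wirt_bar \<rho> z0 * cnj h"
      using eq[of h] by (simp add: q_def diff_diff_eq add.assoc)
    finally show ?thesis .
  qed (use t assms in simp)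
  then show ?thesis using that t(1) by blast
qed

text \<open>If one Wirtinger derivative vanishes, the differential at \<open>z0\<close> is
  \<open>w\<close> times the identity or \<open>w\<close> times conjugation; a difference quotient
  with small real step \<open>t\<close>, divided by \<open>w\<close>, recovers
  \<open>\<kappa> y\<close>.\<close>

lemma relay_single:
  assumes diff: "real_diff_at \<rho> z0" and w: "w \<noteq> 0"
    and \<kappa>: "\<And>t h. w * (of_real t * \<kappa> h) = wirt \<rho> z0 * (of_real t * h) + wirt_bar \<rho> z0 * cnj (of_real t * h)"
    and "\<epsilon> > 0"
  shows "\<exists>\<alpha> \<beta> \<gamma> \<delta>. \<forall>y. norm y \<le> B \<longrightarrow> norm ((\<Sum>q<1::nat. \<gamma> q * \<rho> (\<alpha> q * y + \<beta> q)) + \<delta> - \<kappa> y) < \<epsilon>"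
proof -
  define \<eta> where "\<eta> = \<epsilon> * norm w / 2"
  have \<eta>: "\<eta> > 0" "\<eta> / norm w < \<epsilon>" using w \<open>\<epsilon> > 0\<close> by (auto simp: \<eta>_def)
  obtain t where t: "t > 0" "\<And>h. norm h \<le> \<bar>B\<bar> * t \<Longrightarrow>
      norm (\<rho> (z0 + h) - \<rho> z0 - wirt \<rho> z0 * h - wirt_bar \<rho> z0 * cnj h) \<le> \<eta> * t"
    using real_diff_at_relay[OF diff \<eta>(1), of "\<bar>B\<bar>"] by auto
  define c where "c = 1 / (w * of_real t)"
  have "norm (c * \<rho> (of_real t * y + z0) + - c * \<rho> z0 - \<kappa> y) < \<epsilon>" if y: "norm y \<le> B" for y
  proof -
    have "norm (of_real t * y) \<le> \<bar>B\<bar> * t" using y t by (simp add: norm_mult mult.commute mult_right_mono)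
    from t(2)[OF this]
    have 1: "norm (\<rho> (z0 + of_real t * y) - \<rho> z0 - w * (of_real t * \<kappa> y)) \<le> \<eta> * t"
      unfolding \<kappa> by (simp add: diff_diff_eq add.assoc)
    have "c * \<rho> (of_real t * y + z0) + - c * \<rho> z0 - \<kappa> y = (\<rho> (z0 + of_real t * y) - \<rho> z0 - w * (of_real t * \<kappa> y)) / (w * of_real t)"
      using w t by (simp add: c_def field_simps)
    also have "norm \<dots> \<le> \<eta> * t / (norm w * t)"
    proof -
      have "norm (w * of_real t) = norm w * t" using t by (simp add: norm_mult)
      then show ?thesis unfolding norm_divide using 1 t by (simp only: divide_right_mono mult_nonneg_nonneg norm_ge_zero less_imp_le)
    qed
    also have "\<dots> < \<epsilon>" using \<eta> t by simp
    finally show ?thesis .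
  qed
  then show ?thesis
    by (intro exI[of _ "\<lambda>_. of_real t"] exI[of _ "\<lambda>_. z0"] exI[of _ "\<lambda>_. c"] exI[of _ "- c * \<rho> z0"]) simp
qed

text \<open>Evaluating at \<open>z0 + t y\<close> and \<open>z0 + \<i> t y\<close> and combining with weights \<open>1\<close> and \<open>-\<i>\<close>
  cancels the antilinear part of the derivative.\<close>

lemma relay_double:
  assumes diff: "real_diff_at \<rho> z0" and w: "wirt \<rho> z0 \<noteq> 0" and "\<epsilon> > 0"
  shows "\<exists>\<alpha> \<beta> \<gamma> \<delta>. \<forall>y. norm y \<le> B \<longrightarrow> norm ((\<Sum>q<2::nat. \<gamma> q * \<rho> (\<alpha> q * y + \<beta> q)) + \<delta> - y) < \<epsilon>"
proof -
  define w where "w = wirt \<rho> z0"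
  define w' where "w' = wirt_bar \<rho> z0"
  have w0: "w \<noteq> 0" using w by (simp add: w_def)
  define \<eta> where "\<eta> = \<epsilon> * norm w / 2"
  have \<eta>: "\<eta> > 0" "\<eta> / norm w < \<epsilon>" using w0 \<open>\<epsilon> > 0\<close> by (auto simp: \<eta>_def)
  obtain t where t: "t > 0" "\<And>h. norm h \<le> \<bar>B\<bar> * t \<Longrightarrow>
      norm (\<rho> (z0 + h) - \<rho> z0 - w * h - w' * cnj h) \<le> \<eta> * t"
    using real_diff_at_relay[OF diff \<eta>(1), of "\<bar>B\<bar>"] unfolding w_def w'_def by auto
  \<comment> \<open>Each of the two neurons contributes \<open>w * t * y\<close>, hence the 2. The
    antilinear parts carry the factors \<open>1\<close> and \<open>(-\<i>) * cnj \<i> = -1\<close>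
    and cancel.\<close>
  define c where "c = 1 / (2 * w * of_real t)"
  have "norm (c * \<rho> (of_real t * y + z0) + - \<i> * c * \<rho> (\<i> * of_real t * y + z0) + (\<i> * c - c) * \<rho> z0 - y) < \<epsilon>" if y: "norm y \<le> B" for y
  proof -
    have n: "norm (of_real t * y) \<le> \<bar>B\<bar> * t" "norm (\<i> * of_real t * y) \<le> \<bar>B\<bar> * t"
      using y t by (simp_all add: norm_mult mult.commute mult_right_mono)
    define E1 where "E1 = \<rho> (z0 + of_real t * y) - \<rho> z0 - w * (of_real t * y) - w' * cnj (of_real t * y)"
    define E2 where "E2 = \<rho> (z0 + \<i> * of_real t * y) - \<rho> z0 - w * (\<i> * of_real t * y) - w' * cnj (\<i> * of_real t * y)"
    have E: "norm E1 \<le> \<eta> * t" "norm E2 \<le> \<eta> * t" unfolding E1_def E2_def using t(2)[OF n(1)] t(2)[OF n(2)] by auto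
    define N where "N = \<rho> (z0 + of_real t * y) - \<i> * \<rho> (z0 + \<i> * of_real t * y) + (\<i> - 1) * \<rho> z0"
    define D where "D = 2 * w * of_real t"
    have D: "D \<noteq> 0" using w0 t by (simp add: D_def)
    have N: "E1 - \<i> * E2 = N - D * y"
      unfolding E1_def E2_def N_def D_def by (simp add: algebra_simps)
    have "c * \<rho> (of_real t * y + z0) + - \<i> * c * \<rho> (\<i> * of_real t * y + z0) + (\<i> * c - c) * \<rho> z0 - y = c * N - y"
      by (simp add: N_def algebra_simps)
    also have "\<dots> = (E1 - \<i> * E2) / (2 * w * of_real t)"
      unfolding N D_def[symmetric] using D by (simp add: c_def D_def[symmetric] diff_divide_distrib)
    also have "norm \<dots> \<le> (\<eta> * t + \<eta> * t) / (2 * norm w * t)"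
    proof -
      have "norm (E1 - \<i> * E2) \<le> \<eta> * t + \<eta> * t"
        using E by (intro order_trans[OF norm_triangle_ineq4] add_mono) (auto simp: norm_mult)
      moreover have "norm (2 * w * of_real t) = 2 * norm w * t" using t by (simp add: norm_mult)
      ultimately show ?thesis unfolding norm_divide using t by (simp only:) (rule divide_right_mono, auto)
    qed
    also have "\<dots> = \<eta> / norm w" using t w0 by (simp add: field_simps)
    also have "\<dots> < \<epsilon>" by (rule \<eta>)
    finally show ?thesis .
  qed
  then show ?thesis
    by (intro exI[of _ "\<lambda>q. if q = 0 then of_real t else \<i> * of_real t"] exI[of _ "\<lambda>_. z0"]
        exI[of _ "\<lambda>q. if q = 0 then c else - \<i> * c"] exI[of _ "(\<i> * c - c) * \<rho> z0"]) (simp add: numeral_2_eq_2)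
qed

theorem theorem4p2:
  fixes \<rho> :: "complex \<Rightarrow> complex" and z0 :: complex
  assumes cont: "continuous_on UNIV \<rho>"
    and nph: "\<not> polyharmonic \<rho>"
    and diff: "real_diff_at \<rho> z0"
    and nz: "(px \<rho> z0, py \<rho> z0) \<noteq> (0, 0)"
  shows "(wirt \<rho> z0 \<noteq> 0 \<and> wirt_bar \<rho> z0 = 0 \<longrightarrow>
            universal (NN \<rho> (CARD('n::finite) + CARD('m::finite) + 1)
              :: (complex^'n \<Rightarrow> complex^'m) set))
       \<and> (wirt \<rho> z0 = 0 \<and> wirt_bar \<rho> z0 \<noteq> 0 \<longrightarrow>
            universal (NN \<rho> (CARD('n) + CARD('m) + 1) :: (complex^'n \<Rightarrow> complex^'m) set))
       \<and> (wirt \<rho> z0 \<noteq> 0 \<and> wirt_bar \<rho> z0 \<noteq> 0 \<longrightarrow>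
            universal (NN \<rho> (2 * CARD('n) + 2 * CARD('m) + 1) :: (complex^'n \<Rightarrow> complex^'m) set))"
proof -
  have "\<exists>e. bij_betw e (UNIV :: ('n + 'm) set) {0..<CARD('n + 'm)}"
    by (rule ex_bij_betw_finite_nat) simp
  then obtain e where e: "bij_betw e (UNIV :: ('n + 'm) set) {..<CARD('n) + CARD('m)}"
    by (auto simp: atLeast0LessThan)
  have "universal (NN \<rho> (CARD('n) + CARD('m) + 1) :: (complex^'n \<Rightarrow> complex^'m) set)"
    if w: "wirt \<rho> z0 \<noteq> 0" "wirt_bar \<rho> z0 = 0"
  proof -
    interpret register_net \<rho> "\<lambda>y. y" 1 "CARD('n) + CARD('m)" "CARD('n) + CARD('m) + 1" e
      by unfold_locales (use cont e relay_single[OF diff w(1), of "\<lambda>y. y"] w(2) in \<open>auto intro: continuous_intros\<close>)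
    show ?thesis by (rule universal_NN[OF nph])
  qed
  moreover have "universal (NN \<rho> (CARD('n) + CARD('m) + 1) :: (complex^'n \<Rightarrow> complex^'m) set)"
    if w: "wirt \<rho> z0 = 0" "wirt_bar \<rho> z0 \<noteq> 0"
  proof -
    interpret register_net \<rho> cnj 1 "CARD('n) + CARD('m)" "CARD('n) + CARD('m) + 1" e
      by unfold_locales (use cont e relay_single[OF diff w(2), of cnj] w(1) in \<open>auto intro: continuous_intros\<close>)
    show ?thesis by (rule universal_NN[OF nph])
  qed
  moreover have "universal (NN \<rho> (2 * CARD('n) + 2 * CARD('m) + 1) :: (complex^'n \<Rightarrow> complex^'m) set)"
    if w: "wirt \<rho> z0 \<noteq> 0"
  proof -
    interpret register_net \<rho> "\<lambda>y. y" 2 "CARD('n) + CARD('m)" "2 * CARD('n) + 2 * CARD('m) + 1" e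
      by unfold_locales (use cont e relay_double[OF diff w] in \<open>auto intro: continuous_intros\<close>)
    show ?thesis by (rule universal_NN[OF nph])
  qed
  ultimately show ?thesis by blast
qed

end
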